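(* Let $X,Y$ be convex QBSs and $f$ an analytic map from $X$ to $Y$. Then there exists a unique linear map $f_!:!X\multimap Y$ such that $f=f_!\circ\nabla_X$.
   Context: Quasi-Borel spaces. A quasi-Borel space (QBS) is a set $A$ with a set $M_A$ of maps $\mathbb{R}\to A$ that contains all constant maps, satisfies $\alpha\circ f\in M_A$ for $\alpha\in M_A$ and Borel measurable $f:\mathbb{R}\to\mathbb{R}$, and is closed under countable case splits along Borel partitions of $\mathbb{R}$. A measurable map $f:A\to B$ is one with $f\circ\alpha\in M_B$ for all $\alpha\in M_A$. QBSs form a cartesian closed category; $\mathrm{Qbs}(A,B)$ is the function-space QBS; subsets carry the subset structure; standard Borel spaces are QBSs with $M_A$ the Borel measurable maps. $S(A)$ is the QBS of sub-probability measures on $A$: classes of pairs $(\alpha,\mu)$, $\alpha\in\mathrm{Qbs}(\mathbb{R},A\amalg\{*\})$, $\mu$ a probability measure on $\mathbb{R}$, identified when $\int_{x\in A}f(x)\rho(\mathrm{d}x):=\int_{\alpha^{-1}(A)}f(\alpha(r))\mu(\mathrm{d}r)$ agree for all measurable $f:A\to[0,+\infty]$ (quotient structure). Convex QBSs. A convex QBS $X$ consists of QBSs $|X|$, $|X^\perp|$ and a measurable pairing $|X^\perp|\times|X|\to[0,1]$, $(\eta,x)\mapsto\eta x$, such that (i) $\eta x=\eta y$ for all $\eta$ implies $x=y$; (ii) there is a measurable $\mathbb{E}_X:S(|X|)\to|X|$ with $\eta\,\mathbb{E}_X(\mu)=\int\eta x\,\mu(\mathrm{d}x)$; (iii) there is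 a measurable map on the set of sequences $(x_n)\in|X|^{\mathbb{N}}$ with $\sum_n\eta x_n\le1$ for all $\eta$, giving $\sum_nx_n$ with $\eta(\sum_nx_n)=\sum_n\eta x_n$; and (i)–(iii) hold with $|X|,|X^\perp|$ exchanged. $X^\perp$ exchanges the roles. $\mathbb{W}$: $|\mathbb{W}|=|\mathbb{W}^\perp|=[0,1]$, pairing = product. $X\mathbin{\&}\mathbb{W}$: elements $|X|\times[0,1]$, tests the $(\eta,s)\in|X^\perp|\times[0,1]$ with $\eta x+sr\le1$ for all $(x,r)$, pairing $\eta x+sr$; $0_X$ is the element with $\eta0_X=0$ for all $\eta$. Multilinear maps. For convex QBSs $X_1,\dots,X_n,Y$, an $n$-linear map is a measurable $f:\prod|X_i|\to|Y|$ such that for each $k$ there is a measurable $f^{\perp k}$ from $|X_1|\times\cdots\times|Y^\perp|\times\cdots\times|X_n|$ ($|Y^\perp|$ in position $k$) to $|X_k^\perp|$ with $\eta f(x_1,\dots,x_n)=f^{\perp k}(x_1,\dots,\eta,\dots,x_n)x_k$; 1-linear = linear. $(X_1,\dots,X_n)\multimap Y$ is the convex QBS of $n$-linear maps ($r\mapsto f_r$ random iff $r\mapsto f_r$ and all $r\mapsto f_r^{\perp k}$ measurable), with tests the classes $[\theta]$ of $\theta=(\mu_p)_p\in S(\prod|X_i|\times|Y^\perp|)^{\mathbb{N}}$ with $\mathrm{Test}(f,\theta):=\sum_p\int\eta f(x_1,\dots,x_n)\mu_p(\mathrm{d}(x_1,\dots,x_n,\eta))\le1$ for all $f$, modulo equality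 of all $\mathrm{Test}(f,-)$, and pairing $[\theta]f=\mathrm{Test}(f,\theta)$. Tensors. $X^{\otimes n}=((X,\dots,X)\multimap\mathbb{W})^\perp$; $x_1\otimes\cdots\otimes x_n$ is the element with $f(x_1\otimes\cdots\otimes x_n)=f(x_1,\dots,x_n)$ for all tests $f$; linear maps out of $X^{\otimes n}$ are specified by their (determining) values on such elements. $X^{\otimes_s n}$ has as elements the permutation-invariant elements of $|X^{\otimes n}|$ and as tests the symmetric $n$-linear maps $(X,\dots,X)\multimap\mathbb{W}$; $|X^{\otimes_s0}|\cong[0,1]$. The exponential. $\rho_m=m^m(m+1)/m!$ ($0^0=1$). $\mathcal{J}_{m+1,m}$ is the restriction to $(X\mathbin{\&}\mathbb{W})^{\otimes_s m+1}$ of the linear map $(x_1,r_1)\otimes\cdots\otimes(x_{m+1},r_{m+1})\mapsto r_{m+1}(x_1,r_1)\otimes\cdots\otimes(x_m,r_m)$; $\mathcal{J}_{n,m}=\mathcal{J}_{m+1,m}\circ\cdots\circ\mathcal{J}_{n,n-1}$. $\mathcal{M}_{n,m}:(X\mathbin{\&}\mathbb{W})^{\otimes_s n}\multimap X^{\otimes_s m}$ is the restriction of $(x_1,r_1)\otimes\cdots\otimes(x_n,r_n)\mapsto r_{m+1}\cdots r_nx_1\otimes\cdots\otimes x_m$ ($m\le n$), $0$ ($m>n$). For $m,p>0$, $\mathcal{N}_{m,mp}$ is the restriction to $X^{\otimes_s m}$ of $x_1\otimes\cdots\otimes x_m\mapsto\sum_j\frac1{m^m}\bigotimes_{k=1}^{mp}y^j_k$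 over injections $j:\{1..m\}\to\{1..mp\}$, $y^j_k=(x_{j^{-1}(k)},0)$ if $k\in\mathrm{im}(j)$, $(0,1)$ otherwise; $\mathcal{N}_{m,n}=\mathcal{J}_{mp,n}\circ\mathcal{N}_{m,mp}$ with $p$ least positive with $mp\ge n$; $\mathcal{N}_{0,n}(r)=r(0,1)^{\otimes n}$. $\mathcal{K}_{m,n}=\sum_{k=0}^m\frac{1}{m+1}\frac{k^km!}{k!m^m}\mathcal{N}_{k,n}\circ\mathcal{M}_{m,k}$. $!X$: elements $(a_n)_n\in\prod_n|(X\mathbin{\&}\mathbb{W})^{\otimes_s n}|$ with $a_m=\mathcal{J}_{n,m}(a_n)$ for $m\le n$; tests the families $(f_n)_n$, $f_n\in\mathrm{Qbs}(|(X\mathbin{\&}\mathbb{W})^{\otimes n}|,[0,+\infty))$, with $f_n/\rho_n$ a symmetric element of $(X\mathbin{\&}\mathbb{W})^{\otimes n}\multimap\mathbb{W}$, $f_m=\rho_mf_n\circ\mathcal{K}_{m,n}$ ($m\le n$), and $\sup_nf_n(a_n)\le1$ on $|!X|$ (subset structures); pairing $\sup_nf_n(a_n)$. Analytic maps. $\nabla_X:|X|\to|!X|$, $x\mapsto((x,1)^{\otimes n})_n$. An analytic map from $X$ to $Y$ is a map $f:|X|\to|Y|$ such that $f=g\circ\nabla_X$ for some linear map $g:!X\multimap Y$. *)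

theory Defs
  imports "HOL-Probability.Probability" "HOL-Combinatorics.Permutations"
begin

section \<open>Quasi-Borel spaces\<close>

record 'a qbs =
  points :: "'a set"
  rand :: "(real \<Rightarrow> 'a) set"

text \<open>A Borel partition of the real line indexed by the naturals is given by the measurable map
  \<open>P\<close> sending a point to the index of its block.\<close>

definition is_qbs :: "'a qbs \<Rightarrow> bool" where
  "is_qbs A \<longleftrightarrow>
     (\<forall>\<alpha>\<in>rand A. range \<alpha> \<subseteq> points A) \<and>
     (\<forall>a\<in>points A. (\<lambda>_. a) \<in> rand A) \<and>
     (\<forall>\<alpha>\<in>rand A. \<forall>f\<in>borel_measurable borel. (\<lambda>r. \<alpha> (f r)) \<in> rand A) \<and>
     (\<forall>P \<alpha>. P \<in> measurable borel (count_space (UNIV :: nat set)) \<longrightarrow> (\<forall>i. \<alpha> i \<in> rand A)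
        \<longrightarrow> (\<lambda>r. \<alpha> (P r) r) \<in> rand A)"

definition qbs_hom :: "'a qbs \<Rightarrow> 'b qbs \<Rightarrow> ('a \<Rightarrow> 'b) set" where
  "qbs_hom A B = {f \<in> points A \<rightarrow> points B. \<forall>\<alpha>\<in>rand A. f \<circ> \<alpha> \<in> rand B}"

definition std_qbs :: "'a measure \<Rightarrow> 'a qbs" where
  "std_qbs M = \<lparr>points = space M, rand = measurable borel M\<rparr>"

abbreviation real_qbs :: "real qbs" where
  "real_qbs \<equiv> std_qbs borel"

abbreviation unit_qbs :: "real qbs" where
  "unit_qbs \<equiv> std_qbs (restrict_space borel {0..1})"

abbreviation nonneg_qbs :: "real qbs" where
  "nonneg_qbs \<equiv> std_qbs (restrict_space borel {0..})"

abbreviation ennreal_qbs :: "ennreal qbs" where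
  "ennreal_qbs \<equiv> std_qbs borel"

definition qbs_sub :: "'a qbs \<Rightarrow> 'a set \<Rightarrow> 'a qbs" where
  "qbs_sub A P = \<lparr>points = points A \<inter> P, rand = {\<alpha> \<in> rand A. range \<alpha> \<subseteq> P}\<rparr>"

definition qbs_quot :: "'a qbs \<Rightarrow> ('a \<times> 'a) set \<Rightarrow> 'a set qbs" where
  "qbs_quot A R = \<lparr>points = points A // R, rand = {\<lambda>r. R `` {\<alpha> r} |\<alpha>. \<alpha> \<in> rand A}\<rparr>"

definition qbs_pair :: "'a qbs \<Rightarrow> 'b qbs \<Rightarrow> ('a \<times> 'b) qbs" where
  "qbs_pair A B = \<lparr>points = points A \<times> points B,
     rand = {\<alpha>. fst \<circ> \<alpha> \<in> rand A \<and> snd \<circ> \<alpha> \<in> rand B}\<rparr>"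

definition qbs_prod :: "'i set \<Rightarrow> ('i \<Rightarrow> 'a qbs) \<Rightarrow> ('i \<Rightarrow> 'a) qbs" where
  "qbs_prod I A = \<lparr>points = (\<Pi>\<^sub>E i\<in>I. points (A i)),
     rand = {\<alpha>. range \<alpha> \<subseteq> (\<Pi>\<^sub>E i\<in>I. points (A i)) \<and> (\<forall>i\<in>I. (\<lambda>r. \<alpha> r i) \<in> rand (A i))}\<rparr>"

text \<open>The coproduct of \<open>A\<close> with a one-point space, the extra point being \<^term>\<open>None\<close>.\<close>

definition qbs_option :: "'a qbs \<Rightarrow> 'a option qbs" where
  "qbs_option A = \<lparr>points = insert None (Some ` points A),
     rand = {\<lambda>r. if r \<in> U then Some (\<beta> r) else None |U \<beta>.
               U \<in> sets borel \<and> (U \<noteq> {} \<longrightarrow> \<beta> \<in> rand A)}\<rparr>"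

text \<open>The elements of a function space are extensional functions, so that they are determined by
  their values on \<^term>\<open>points A\<close>.\<close>

definition qbs_fun :: "'a qbs \<Rightarrow> 'b qbs \<Rightarrow> ('a \<Rightarrow> 'b) qbs" where
  "qbs_fun A B = \<lparr>points = qbs_hom A B \<inter> extensional (points A),
     rand = {\<alpha>. range \<alpha> \<subseteq> qbs_hom A B \<inter> extensional (points A) \<and>
                (\<lambda>(r, a). \<alpha> r a) \<in> qbs_hom (qbs_pair real_qbs A) B}\<rparr>"

section \<open>Sub-probability measures\<close>

type_synonym 'a subprob_rep = "(real \<Rightarrow> 'a option) \<times> real measure"
type_synonym 'a subprob = "'a subprob_rep set"

definition rep_integral :: "('a \<Rightarrow> ennreal) \<Rightarrow> 'a subprob_rep \<Rightarrow> ennreal" where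
  "rep_integral f = (\<lambda>(\<alpha>, \<mu>). \<integral>\<^sup>+ r. (case \<alpha> r of None \<Rightarrow> 0 | Some x \<Rightarrow> f x) \<partial>\<mu>)"

definition subprob_reps :: "'a qbs \<Rightarrow> 'a subprob_rep qbs" where
  "subprob_reps A = qbs_pair (qbs_fun real_qbs (qbs_option A)) (std_qbs (prob_algebra borel))"

definition subprob_rel :: "'a qbs \<Rightarrow> ('a subprob_rep \<times> 'a subprob_rep) set" where
  "subprob_rel A = {(p, q). p \<in> points (subprob_reps A) \<and> q \<in> points (subprob_reps A) \<and>
     (\<forall>f\<in>qbs_hom A ennreal_qbs. rep_integral f p = rep_integral f q)}"

definition qbs_subprob :: "'a qbs \<Rightarrow> 'a subprob qbs" where
  "qbs_subprob A = qbs_quot (subprob_reps A) (subprob_rel A)"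

definition sint :: "'a subprob \<Rightarrow> ('a \<Rightarrow> ennreal) \<Rightarrow> ennreal" where
  "sint \<mu> f = the_elem (rep_integral f ` \<mu>)"

section \<open>Convex quasi-Borel spaces\<close>

record ('a, 'b) cqbs =
  elts :: "'a qbs"
  tests :: "'b qbs"
  pairing :: "'b \<Rightarrow> 'a \<Rightarrow> real"

definition dual :: "('a, 'b) cqbs \<Rightarrow> ('b, 'a) cqbs" where
  "dual X = \<lparr>elts = tests X, tests = elts X, pairing = (\<lambda>x \<eta>. pairing X \<eta> x)\<rparr>"

definition separated :: "('a, 'b) cqbs \<Rightarrow> bool" where
  "separated X \<longleftrightarrow> (\<forall>x\<in>points (elts X). \<forall>y\<in>points (elts X).
     (\<forall>\<eta>\<in>points (tests X). pairing X \<eta> x = pairing X \<eta> y) \<longrightarrow> x = y)"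

definition has_expectation :: "('a, 'b) cqbs \<Rightarrow> bool" where
  "has_expectation X \<longleftrightarrow> (\<exists>E\<in>qbs_hom (qbs_subprob (elts X)) (elts X).
     \<forall>\<mu>\<in>points (qbs_subprob (elts X)). \<forall>\<eta>\<in>points (tests X).
       ennreal (pairing X \<eta> (E \<mu>)) = sint \<mu> (\<lambda>x. ennreal (pairing X \<eta> x)))"

definition summable_seqs :: "('a, 'b) cqbs \<Rightarrow> (nat \<Rightarrow> 'a) qbs" where
  "summable_seqs X = qbs_sub (qbs_prod UNIV (\<lambda>_. elts X))
     {x. \<forall>\<eta>\<in>points (tests X). (\<Sum>n. ennreal (pairing X \<eta> (x n))) \<le> 1}"

definition has_sums :: "('a, 'b) cqbs \<Rightarrow> bool" where
  "has_sums X \<longleftrightarrow> (\<exists>S\<in>qbs_hom (summable_seqs X) (elts X).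
     \<forall>x\<in>points (summable_seqs X). \<forall>\<eta>\<in>points (tests X).
       ennreal (pairing X \<eta> (S x)) = (\<Sum>n. ennreal (pairing X \<eta> (x n))))"

definition convex_qbs :: "('a, 'b) cqbs \<Rightarrow> bool" where
  "convex_qbs X \<longleftrightarrow> is_qbs (elts X) \<and> is_qbs (tests X) \<and>
     (\<lambda>(\<eta>, x). pairing X \<eta> x) \<in> qbs_hom (qbs_pair (tests X) (elts X)) unit_qbs \<and>
     separated X \<and> has_expectation X \<and> has_sums X \<and>
     separated (dual X) \<and> has_expectation (dual X) \<and> has_sums (dual X)"

text \<open>Zero, scalar multiples and finite sums are the elements with the corresponding values under
  all tests.\<close>

definition czero :: "('a, 'b) cqbs \<Rightarrow> 'a" where
  "czero X = (THE z. z \<in> points (elts X) \<and> (\<forall>\<eta>\<in>points (tests X). pairing X \<eta> z = 0))"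

definition cscale :: "('a, 'b) cqbs \<Rightarrow> real \<Rightarrow> 'a \<Rightarrow> 'a" where
  "cscale X c x = (THE z. z \<in> points (elts X) \<and>
     (\<forall>\<eta>\<in>points (tests X). pairing X \<eta> z = c * pairing X \<eta> x))"

definition csum :: "('a, 'b) cqbs \<Rightarrow> 'i set \<Rightarrow> ('i \<Rightarrow> 'a) \<Rightarrow> 'a" where
  "csum X I x = (THE z. z \<in> points (elts X) \<and>
     (\<forall>\<eta>\<in>points (tests X). pairing X \<eta> z = (\<Sum>i\<in>I. pairing X \<eta> (x i))))"

definition W_cqbs :: "(real, real) cqbs" where
  "W_cqbs = \<lparr>elts = unit_qbs, tests = unit_qbs, pairing = (\<lambda>s r. s * r)\<rparr>"

definition with_W :: "('a, 'b) cqbs \<Rightarrow> ('a \<times> real, 'b \<times> real) cqbs" where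
  "with_W X = \<lparr>elts = qbs_pair (elts X) unit_qbs,
     tests = qbs_sub (qbs_pair (tests X) unit_qbs)
       {(\<eta>, s). \<forall>x\<in>points (elts X). \<forall>r\<in>{0..1}. pairing X \<eta> x + s * r \<le> 1},
     pairing = (\<lambda>(\<eta>, s) (x, r). pairing X \<eta> x + s * r)\<rparr>"

section \<open>Multilinear maps\<close>

text \<open>An \<open>n\<close>-tuple is an extensional function on \<open>{1..n}\<close>. The domain of the \<open>k\<close>-th adjoint, which has
  the tests of \<open>Y\<close> in place of the \<open>k\<close>-th factor, is represented by a test of \<open>Y\<close> paired with the tuple
  of the remaining factors.\<close>

definition tuples :: "nat \<Rightarrow> (nat \<Rightarrow> ('a, 'b) cqbs) \<Rightarrow> (nat \<Rightarrow> 'a) qbs" where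
  "tuples n X = qbs_prod {1..n} (\<lambda>i. elts (X i))"

definition adj_dom :: "nat \<Rightarrow> (nat \<Rightarrow> ('a, 'b) cqbs) \<Rightarrow> ('c, 'd) cqbs \<Rightarrow> nat \<Rightarrow> ('d \<times> (nat \<Rightarrow> 'a)) qbs" where
  "adj_dom n X Y k = qbs_pair (tests Y) (qbs_prod ({1..n} - {k}) (\<lambda>i. elts (X i)))"

definition is_adjoint :: "nat \<Rightarrow> (nat \<Rightarrow> ('a, 'b) cqbs) \<Rightarrow> ('c, 'd) cqbs \<Rightarrow> ((nat \<Rightarrow> 'a) \<Rightarrow> 'c) \<Rightarrow> nat
    \<Rightarrow> ('d \<times> (nat \<Rightarrow> 'a) \<Rightarrow> 'b) \<Rightarrow> bool" where
  "is_adjoint n X Y f k h \<longleftrightarrow> h \<in> points (qbs_fun (adj_dom n X Y k) (tests (X k))) \<and>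
     (\<forall>x\<in>points (tuples n X). \<forall>\<eta>\<in>points (tests Y).
        pairing Y \<eta> (f x) = pairing (X k) (h (\<eta>, restrict x ({1..n} - {k}))) (x k))"

definition adjoint :: "nat \<Rightarrow> (nat \<Rightarrow> ('a, 'b) cqbs) \<Rightarrow> ('c, 'd) cqbs \<Rightarrow> ((nat \<Rightarrow> 'a) \<Rightarrow> 'c) \<Rightarrow> nat
    \<Rightarrow> 'd \<times> (nat \<Rightarrow> 'a) \<Rightarrow> 'b" where
  "adjoint n X Y f k = (THE h. is_adjoint n X Y f k h)"

definition multilinear_maps :: "nat \<Rightarrow> (nat \<Rightarrow> ('a, 'b) cqbs) \<Rightarrow> ('c, 'd) cqbs \<Rightarrow> ((nat \<Rightarrow> 'a) \<Rightarrow> 'c) set" where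
  "multilinear_maps n X Y = {f \<in> points (qbs_fun (tuples n X) (elts Y)).
     \<forall>k\<in>{1..n}. \<exists>h. is_adjoint n X Y f k h}"

text \<open>The case of one factor, with 1-tuples identified with their only component.\<close>

definition linear_maps :: "('a, 'b) cqbs \<Rightarrow> ('c, 'd) cqbs \<Rightarrow> ('a \<Rightarrow> 'c) set" where
  "linear_maps X Y = {f \<in> points (qbs_fun (elts X) (elts Y)).
     \<exists>h\<in>qbs_hom (tests Y) (tests X). \<forall>x\<in>points (elts X). \<forall>\<eta>\<in>points (tests Y).
       pairing Y \<eta> (f x) = pairing X (h \<eta>) x}"

definition multilinear_qbs :: "nat \<Rightarrow> (nat \<Rightarrow> ('a, 'b) cqbs) \<Rightarrow> ('c, 'd) cqbs \<Rightarrow> ((nat \<Rightarrow> 'a) \<Rightarrow> 'c) qbs" where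
  "multilinear_qbs n X Y = \<lparr>points = multilinear_maps n X Y,
     rand = {\<phi>. range \<phi> \<subseteq> multilinear_maps n X Y \<and>
       \<phi> \<in> rand (qbs_fun (tuples n X) (elts Y)) \<and>
       (\<forall>k\<in>{1..n}. (\<lambda>r. adjoint n X Y (\<phi> r) k) \<in> rand (qbs_fun (adj_dom n X Y k) (tests (X k))))}\<rparr>"

type_synonym ('a, 'd) pretest = "nat \<Rightarrow> ((nat \<Rightarrow> 'a) \<times> 'd) subprob"

definition Test :: "('c, 'd) cqbs \<Rightarrow> ((nat \<Rightarrow> 'a) \<Rightarrow> 'c) \<Rightarrow> ('a, 'd) pretest \<Rightarrow> ennreal" where
  "Test Y f \<theta> = (\<Sum>p. sint (\<theta> p) (\<lambda>(x, \<eta>). ennreal (pairing Y \<eta> (f x))))"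

definition pretests :: "nat \<Rightarrow> (nat \<Rightarrow> ('a, 'b) cqbs) \<Rightarrow> ('c, 'd) cqbs \<Rightarrow> ('a, 'd) pretest qbs" where
  "pretests n X Y = qbs_sub (qbs_prod UNIV (\<lambda>_. qbs_subprob (qbs_pair (tuples n X) (tests Y))))
     {\<theta>. \<forall>f\<in>multilinear_maps n X Y. Test Y f \<theta> \<le> 1}"

definition pretest_rel :: "nat \<Rightarrow> (nat \<Rightarrow> ('a, 'b) cqbs) \<Rightarrow> ('c, 'd) cqbs
    \<Rightarrow> (('a, 'd) pretest \<times> ('a, 'd) pretest) set" where
  "pretest_rel n X Y = {(\<theta>, \<theta>'). \<theta> \<in> points (pretests n X Y) \<and> \<theta>' \<in> points (pretests n X Y) \<and>
     (\<forall>f\<in>multilinear_maps n X Y. Test Y f \<theta> = Test Y f \<theta>')}"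

definition multilinear_cqbs :: "nat \<Rightarrow> (nat \<Rightarrow> ('a, 'b) cqbs) \<Rightarrow> ('c, 'd) cqbs
    \<Rightarrow> ((nat \<Rightarrow> 'a) \<Rightarrow> 'c, ('a, 'd) pretest set) cqbs" where
  "multilinear_cqbs n X Y = \<lparr>elts = multilinear_qbs n X Y,
     tests = qbs_quot (pretests n X Y) (pretest_rel n X Y),
     pairing = (\<lambda>c f. enn2real (the_elem (Test Y f ` c)))\<rparr>"

section \<open>Tensor powers\<close>

type_synonym 'a tens = "('a, real) pretest set"

definition tensor :: "nat \<Rightarrow> ('a, 'b) cqbs \<Rightarrow> ('a tens, (nat \<Rightarrow> 'a) \<Rightarrow> real) cqbs" where
  "tensor n X = dual (multilinear_cqbs n (\<lambda>_. X) W_cqbs)"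

definition tpure :: "nat \<Rightarrow> ('a, 'b) cqbs \<Rightarrow> (nat \<Rightarrow> 'a) \<Rightarrow> 'a tens" where
  "tpure n X x = (THE a. a \<in> points (elts (tensor n X)) \<and>
     (\<forall>f\<in>points (tests (tensor n X)). pairing (tensor n X) f a = f x))"

text \<open>The linear map out of a tensor power with prescribed values on the elements
  \<^term>\<open>tpure n X x\<close>.\<close>

definition tlift :: "nat \<Rightarrow> ('a, 'b) cqbs \<Rightarrow> ('c, 'd) cqbs \<Rightarrow> ((nat \<Rightarrow> 'a) \<Rightarrow> 'c) \<Rightarrow> 'a tens \<Rightarrow> 'c" where
  "tlift n X Z \<phi> = (THE g. g \<in> linear_maps (tensor n X) Z \<and>
     (\<forall>x\<in>points (tuples n (\<lambda>_. X)). g (tpure n X x) = \<phi> x))"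

definition tuple_perm :: "nat \<Rightarrow> (nat \<Rightarrow> nat) \<Rightarrow> (nat \<Rightarrow> 'a) \<Rightarrow> nat \<Rightarrow> 'a" where
  "tuple_perm n \<sigma> x = (\<lambda>i\<in>{1..n}. x (\<sigma> i))"

definition tperm :: "nat \<Rightarrow> ('a, 'b) cqbs \<Rightarrow> (nat \<Rightarrow> nat) \<Rightarrow> 'a tens \<Rightarrow> 'a tens" where
  "tperm n X \<sigma> = tlift n X (tensor n X) (\<lambda>x. tpure n X (tuple_perm n \<sigma> x))"

definition stensor :: "nat \<Rightarrow> ('a, 'b) cqbs \<Rightarrow> ('a tens, (nat \<Rightarrow> 'a) \<Rightarrow> real) cqbs" where
  "stensor n X = \<lparr>
     elts = qbs_sub (elts (tensor n X)) {a. \<forall>\<sigma>. \<sigma> permutes {1..n} \<longrightarrow> tperm n X \<sigma> a = a},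
     tests = qbs_sub (tests (tensor n X)) {f. \<forall>\<sigma>. \<sigma> permutes {1..n} \<longrightarrow>
       (\<forall>x\<in>points (tuples n (\<lambda>_. X)). f (tuple_perm n \<sigma> x) = f x)},
     pairing = pairing (tensor n X)\<rparr>"

section \<open>The exponential\<close>

definition rho :: "nat \<Rightarrow> real" where
  "rho m = real m ^ m * (real m + 1) / fact m"

definition J_step :: "('a, 'b) cqbs \<Rightarrow> nat \<Rightarrow> ('a \<times> real) tens \<Rightarrow> ('a \<times> real) tens" where
  "J_step X m = restrict
     (tlift (Suc m) (with_W X) (tensor m (with_W X))
        (\<lambda>y. cscale (tensor m (with_W X)) (snd (y (Suc m))) (tpure m (with_W X) (restrict y {1..m}))))
     (points (elts (stensor (Suc m) (with_W X))))"

text \<open>\<^term>\<open>J_iter X m d\<close> is the composite from degree \<open>m + d\<close> to degree \<open>m\<close>.\<close>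

primrec J_iter :: "('a, 'b) cqbs \<Rightarrow> nat \<Rightarrow> nat \<Rightarrow> ('a \<times> real) tens \<Rightarrow> ('a \<times> real) tens" where
  "J_iter X m 0 a = a"
| "J_iter X m (Suc d) a = J_iter X m d (J_step X (m + d) a)"

definition J_map :: "('a, 'b) cqbs \<Rightarrow> nat \<Rightarrow> nat \<Rightarrow> ('a \<times> real) tens \<Rightarrow> ('a \<times> real) tens" where
  "J_map X n m = J_iter X m (n - m)"

definition M_map :: "('a, 'b) cqbs \<Rightarrow> nat \<Rightarrow> nat \<Rightarrow> ('a \<times> real) tens \<Rightarrow> 'a tens" where
  "M_map X n m = restrict
     (if m \<le> n then tlift n (with_W X) (tensor m X)
        (\<lambda>y. cscale (tensor m X) (\<Prod>i\<in>{m+1..n}. snd (y i)) (tpure m X (\<lambda>i\<in>{1..m}. fst (y i))))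
      else (\<lambda>_. czero (stensor m X)))
     (points (elts (stensor n (with_W X))))"

definition N_tuple :: "('a, 'b) cqbs \<Rightarrow> nat \<Rightarrow> nat \<Rightarrow> (nat \<Rightarrow> nat) \<Rightarrow> (nat \<Rightarrow> 'a) \<Rightarrow> nat \<Rightarrow> 'a \<times> real" where
  "N_tuple X m n j x = (\<lambda>k\<in>{1..n}. if k \<in> j ` {1..m} then (x (inv_into {1..m} j k), 0) else (czero X, 1))"

text \<open>\<^term>\<open>N_mult X m p\<close> goes from degree \<open>m\<close> to degree \<open>m * p\<close>.\<close>

definition N_mult :: "('a, 'b) cqbs \<Rightarrow> nat \<Rightarrow> nat \<Rightarrow> 'a tens \<Rightarrow> ('a \<times> real) tens" where
  "N_mult X m p = restrict
     (tlift m X (tensor (m * p) (with_W X))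
        (\<lambda>x. csum (tensor (m * p) (with_W X)) {j \<in> {1..m} \<rightarrow>\<^sub>E {1..m * p}. inj_on j {1..m}}
           (\<lambda>j. cscale (tensor (m * p) (with_W X)) (1 / real m ^ m)
                  (tpure (m * p) (with_W X) (N_tuple X m (m * p) j x)))))
     (points (elts (stensor m X)))"

text \<open>An element of the zeroth symmetric power is identified with its value in \<open>[0,1]\<close> under the test
  that is constantly \<open>1\<close>; this is the scalar in the first case below.\<close>

definition N_map :: "('a, 'b) cqbs \<Rightarrow> nat \<Rightarrow> nat \<Rightarrow> 'a tens \<Rightarrow> ('a \<times> real) tens" where
  "N_map X m n a =
     (if m = 0 then
        cscale (stensor n (with_W X))
          (pairing (stensor 0 X) (\<lambda>x\<in>points (tuples 0 (\<lambda>_. X)). 1) a)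
          (tpure n (with_W X) (\<lambda>i\<in>{1..n}. (czero X, 1)))
      else let p = (LEAST p. 0 < p \<and> n \<le> m * p) in J_map X (m * p) n (N_mult X m p a))"

definition K_map :: "('a, 'b) cqbs \<Rightarrow> nat \<Rightarrow> nat \<Rightarrow> ('a \<times> real) tens \<Rightarrow> ('a \<times> real) tens" where
  "K_map X m n a = csum (stensor n (with_W X)) {0..m}
     (\<lambda>k. cscale (stensor n (with_W X))
        (1 / (real m + 1) * (real k ^ k * fact m / (fact k * real m ^ m)))
        (N_map X k n (M_map X m k a)))"

definition bang_elts :: "('a, 'b) cqbs \<Rightarrow> (nat \<Rightarrow> ('a \<times> real) tens) qbs" where
  "bang_elts X = qbs_sub (qbs_prod UNIV (\<lambda>n. elts (stensor n (with_W X))))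
     {a. \<forall>m n. m \<le> n \<longrightarrow> a m = J_map X n m (a n)}"

definition bang_sup :: "(nat \<Rightarrow> ('a \<times> real) tens \<Rightarrow> real) \<Rightarrow> (nat \<Rightarrow> ('a \<times> real) tens) \<Rightarrow> ennreal" where
  "bang_sup f a = (SUP n. ennreal (f n (a n)))"

definition bang_tests :: "('a, 'b) cqbs \<Rightarrow> (nat \<Rightarrow> ('a \<times> real) tens \<Rightarrow> real) qbs" where
  "bang_tests X = qbs_sub (qbs_prod UNIV (\<lambda>n. qbs_fun (elts (tensor n (with_W X))) nonneg_qbs))
     {f. (\<forall>n. (\<lambda>a\<in>points (elts (tensor n (with_W X))). f n a / rho n)
                 \<in> linear_maps (tensor n (with_W X)) W_cqbs) \<and>
         (\<forall>n \<sigma>. \<sigma> permutes {1..n} \<longrightarrow>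
            (\<forall>a\<in>points (elts (tensor n (with_W X))). f n (tperm n (with_W X) \<sigma> a) = f n a)) \<and>
         (\<forall>m n. m \<le> n \<longrightarrow>
            (\<forall>a\<in>points (elts (stensor m (with_W X))). f m a = rho m * f n (K_map X m n a))) \<and>
         (\<forall>a\<in>points (bang_elts X). bang_sup f a \<le> 1)}"

definition bang :: "('a, 'b) cqbs
    \<Rightarrow> (nat \<Rightarrow> ('a \<times> real) tens, nat \<Rightarrow> ('a \<times> real) tens \<Rightarrow> real) cqbs" where
  "bang X = \<lparr>elts = bang_elts X, tests = bang_tests X,
     pairing = (\<lambda>f a. enn2real (bang_sup f a))\<rparr>"

section \<open>Analytic maps\<close>

definition nabla :: "('a, 'b) cqbs \<Rightarrow> 'a \<Rightarrow> nat \<Rightarrow> ('a \<times> real) tens" where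
  "nabla X x = (\<lambda>n. tpure n (with_W X) (\<lambda>i\<in>{1..n}. (x, 1)))"

definition analytic :: "('a, 'b) cqbs \<Rightarrow> ('c, 'd) cqbs \<Rightarrow> ('a \<Rightarrow> 'c) \<Rightarrow> bool" where
  "analytic X Y f \<longleftrightarrow> f \<in> points (elts X) \<rightarrow> points (elts Y) \<and>
     (\<exists>g\<in>linear_maps (bang X) Y. \<forall>x\<in>points (elts X). f x = g (nabla X x))"

end

theory Submission
  imports Defs
begin

text \<open>A test \<open>(f n)\<close> of \<open>!X\<close> is a sequence of symmetric multilinear forms on \<open>X & W\<close>. Split every entry
  \<open>(x, r)\<close> as \<open>(x, 0) + r (0, 1)\<close>: the value of \<open>f n\<close> on the diagonal at \<open>(x, r)\<close> becomes a polynomial in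
  \<open>r\<close>, whose coefficients \<open>A n k x\<close> collect the terms with \<open>k\<close> entries \<open>(x, 0)\<close>. Evaluated on diagonal
  tensors, the condition \<open>f m = \<rho> m f n \<circ> K m n\<close> says that \<open>A m k x\<close> does not depend on \<open>m \<ge> k\<close>, so the
  test has the value \<open>\<Sum>k. A k k x\<close> on \<open>\<nabla> x\<close>. Replacing \<open>x\<close> by \<open>t x\<close> turns this sum into a power series
  in \<open>t\<close>, hence the values of the test on the image of \<open>\<nabla>\<close> determine all \<open>A k k x\<close>, therefore all \<open>f n\<close> on
  diagonal tensors, and by polarization on all tensors. Since the elements of \<open>Y\<close> are separated by tests,
  a linear map \<open>!X \<rightarrow> Y\<close> is determined by its composite with \<open>\<nabla>\<close>.

  The defining equations of \<open>J\<close>, \<open>M\<close>, \<open>N\<close>, \<open>K\<close> and of pure tensors are definite descriptions, so they say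
  nothing until existence and uniqueness of the described objects are proved; the linear maps out of tensor
  powers are obtained by pushing representing measures forward along substitutions of tuples.\<close>

text \<open>Existence is part of the definition of \<open>analytic\<close>, so only uniqueness is at
  stake. The obstacle is that X and its tensor powers have no arbitrary linear combinations:
  scalings, sums and substitutions exist only under a bound by 1 against all tests, and each of them
  has to be bounded in advance. The constants of the exponential are made for these bounds. The
  factor \<open>1 / m^m\<close> in N is that of a form evaluated at the barycentre of m points;
  since \<open>fact k\<close> injections share one image, N after M puts the coefficient
  \<open>k! / k^k\<close> on each set of k slots. The factor \<open>1 / (m + 1)\<close> in K
  averages over m + 1 degrees. Multiplication by \<open>rho m\<close> cancels all of this to exactly
  1, which is why coefficients of different degrees agree and not merely up to a scalar. The bound 1
  for tests on \<open>!X\<close> finally confines the coefficients of the power series to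
  \<open>[0, 1]\<close>, so that the series converge and can be compared for 0 < t < 1.\<close>

section \<open>Basic constructions on quasi-Borel spaces\<close>

lemma rand_in_points: "is_qbs A \<Longrightarrow> \<alpha> \<in> rand A \<Longrightarrow> \<alpha> r \<in> points A"
  unfolding is_qbs_def by blast

lemma const_rand: "is_qbs A \<Longrightarrow> a \<in> points A \<Longrightarrow> (\<lambda>_. a) \<in> rand A"
  unfolding is_qbs_def by blast

lemma rand_comp: "is_qbs A \<Longrightarrow> \<alpha> \<in> rand A \<Longrightarrow> f \<in> borel_measurable borel \<Longrightarrow> (\<lambda>r. \<alpha> (f r)) \<in> rand A"
  unfolding is_qbs_def by blast

lemma rand_piecewise:
  "is_qbs A \<Longrightarrow> P \<in> measurable borel (count_space (UNIV :: nat set)) \<Longrightarrow> (\<And>i. \<alpha> i \<in> rand A)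
    \<Longrightarrow> (\<lambda>r. \<alpha> (P r) r) \<in> rand A"
  unfolding is_qbs_def by blast

lemma points_unit_qbs [simp]: "points unit_qbs = {0..1}"
  by (simp add: std_qbs_def space_restrict_space)

lemma rand_unit_qbs: "\<alpha> \<in> rand unit_qbs \<longleftrightarrow> \<alpha> \<in> borel_measurable borel \<and> range \<alpha> \<subseteq> {0..1}"
  by (auto simp: std_qbs_def measurable_restrict_space2_iff)

lemma rand_real_qbs [simp]: "rand real_qbs = borel_measurable borel"
  by (simp add: std_qbs_def)

lemma points_real_qbs [simp]: "points real_qbs = UNIV"
  by (simp add: std_qbs_def)

lemma rand_ennreal_qbs [simp]: "rand ennreal_qbs = borel_measurable borel"
  by (simp add: std_qbs_def)

lemma points_ennreal_qbs [simp]: "points ennreal_qbs = UNIV"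
  by (simp add: std_qbs_def)

lemma points_qbs_pair [simp]: "points (qbs_pair A B) = points A \<times> points B"
  by (simp add: qbs_pair_def)

lemma rand_qbs_pair: "\<alpha> \<in> rand (qbs_pair A B) \<longleftrightarrow> (\<lambda>r. fst (\<alpha> r)) \<in> rand A \<and> (\<lambda>r. snd (\<alpha> r)) \<in> rand B"
  by (simp add: qbs_pair_def comp_def)

lemma points_qbs_prod [simp]: "points (qbs_prod I A) = (\<Pi>\<^sub>E i\<in>I. points (A i))"
  by (simp add: qbs_prod_def)

lemma rand_qbs_prod: "\<alpha> \<in> rand (qbs_prod I A) \<longleftrightarrow>
    (\<forall>r. \<alpha> r \<in> (\<Pi>\<^sub>E i\<in>I. points (A i))) \<and> (\<forall>i\<in>I. (\<lambda>r. \<alpha> r i) \<in> rand (A i))"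
  by (auto simp: qbs_prod_def)

lemma points_qbs_sub [simp]: "points (qbs_sub A P) = points A \<inter> P"
  by (simp add: qbs_sub_def)

lemma rand_qbs_sub: "\<alpha> \<in> rand (qbs_sub A P) \<longleftrightarrow> \<alpha> \<in> rand A \<and> (\<forall>r. \<alpha> r \<in> P)"
  by (auto simp: qbs_sub_def)

lemma qbs_homD: "f \<in> qbs_hom A B \<Longrightarrow> \<alpha> \<in> rand A \<Longrightarrow> (\<lambda>r. f (\<alpha> r)) \<in> rand B"
  by (auto simp: qbs_hom_def comp_def)

lemma qbs_hom_points: "f \<in> qbs_hom A B \<Longrightarrow> x \<in> points A \<Longrightarrow> f x \<in> points B"
  by (auto simp: qbs_hom_def)

lemma qbs_homI:
  assumes "\<And>x. x \<in> points A \<Longrightarrow> f x \<in> points B"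
    and "\<And>\<alpha>. \<alpha> \<in> rand A \<Longrightarrow> (\<lambda>r. f (\<alpha> r)) \<in> rand B"
  shows "f \<in> qbs_hom A B"
  using assms by (auto simp: qbs_hom_def comp_def)

lemma points_qbs_fun: "points (qbs_fun A B) = qbs_hom A B \<inter> extensional (points A)"
  by (simp add: qbs_fun_def)

lemma is_qbs_prod:
  assumes "\<And>i. i \<in> I \<Longrightarrow> is_qbs (A i)"
  shows "is_qbs (qbs_prod I A)"
  unfolding is_qbs_def
proof (intro conjI ballI allI impI)
  fix P :: "real \<Rightarrow> nat" and \<alpha> :: "nat \<Rightarrow> real \<Rightarrow> _"
  assume P: "P \<in> measurable borel (count_space UNIV)" and \<alpha>: "\<forall>i. \<alpha> i \<in> rand (qbs_prod I A)"
  have "(\<lambda>r. \<alpha> (P r) r i) \<in> rand (A i)" if "i \<in> I" for i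
    using rand_piecewise[OF assms[OF that] P, of "\<lambda>n r. \<alpha> n r i"] \<alpha> that by (simp add: rand_qbs_prod)
  then show "(\<lambda>r. \<alpha> (P r) r) \<in> rand (qbs_prod I A)"
    using \<alpha> by (auto simp: rand_qbs_prod)
next
  fix \<alpha> and f :: "real \<Rightarrow> real" assume "\<alpha> \<in> rand (qbs_prod I A)" "f \<in> borel_measurable borel"
  then show "(\<lambda>r. \<alpha> (f r)) \<in> rand (qbs_prod I A)"
    using rand_comp[OF assms, of _ "\<lambda>r. \<alpha> r _"] by (auto simp: rand_qbs_prod)
qed (use assms in \<open>auto simp: rand_qbs_prod intro!: const_rand\<close>)

lemma is_qbs_pair:
  assumes "is_qbs A" "is_qbs B"
  shows "is_qbs (qbs_pair A B)"
  unfolding is_qbs_def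
proof (intro conjI ballI allI impI)
  fix P :: "real \<Rightarrow> nat" and \<alpha> :: "nat \<Rightarrow> real \<Rightarrow> _"
  assume P: "P \<in> measurable borel (count_space UNIV)" and \<alpha>: "\<forall>i. \<alpha> i \<in> rand (qbs_pair A B)"
  have "(\<lambda>r. fst (\<alpha> (P r) r)) \<in> rand A"
    using rand_piecewise[OF assms(1) P, of "\<lambda>n r. fst (\<alpha> n r)"] \<alpha> by (simp add: rand_qbs_pair)
  moreover have "(\<lambda>r. snd (\<alpha> (P r) r)) \<in> rand B"
    using rand_piecewise[OF assms(2) P, of "\<lambda>n r. snd (\<alpha> n r)"] \<alpha> by (simp add: rand_qbs_pair)
  ultimately show "(\<lambda>r. \<alpha> (P r) r) \<in> rand (qbs_pair A B)"
    by (simp add: rand_qbs_pair)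
next
  fix \<alpha> assume "\<alpha> \<in> rand (qbs_pair A B)"
  then show "range \<alpha> \<subseteq> points (qbs_pair A B)"
    using rand_in_points[OF assms(1)] rand_in_points[OF assms(2)] by (force simp: rand_qbs_pair mem_Times_iff)
next
  fix a assume "a \<in> points (qbs_pair A B)"
  then show "(\<lambda>_. a) \<in> rand (qbs_pair A B)"
    using assms by (auto simp: rand_qbs_pair intro: const_rand)
next
  fix \<alpha> and f :: "real \<Rightarrow> real" assume "\<alpha> \<in> rand (qbs_pair A B)" "f \<in> borel_measurable borel"
  then show "(\<lambda>r. \<alpha> (f r)) \<in> rand (qbs_pair A B)"
    using rand_comp[OF assms(1), of "\<lambda>r. fst (\<alpha> r)"] rand_comp[OF assms(2), of "\<lambda>r. snd (\<alpha> r)"]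
    by (simp add: rand_qbs_pair)
qed

lemma is_qbs_sub:
  assumes "is_qbs A"
  shows "is_qbs (qbs_sub A P)"
  using assms unfolding is_qbs_def by (auto simp: rand_qbs_sub)

lemma is_qbs_std: "is_qbs (std_qbs M)"
  unfolding is_qbs_def
proof (intro conjI ballI allI impI)
  fix P :: "real \<Rightarrow> nat" and \<alpha> :: "nat \<Rightarrow> real \<Rightarrow> _"
  assume "P \<in> measurable borel (count_space UNIV)" "\<forall>i. \<alpha> i \<in> rand (std_qbs M)"
  then show "(\<lambda>r. \<alpha> (P r) r) \<in> rand (std_qbs M)"
    by (auto simp: std_qbs_def intro: measurable_compose_countable)
qed (auto simp: std_qbs_def measurable_space)

section \<open>Sub-probability measures\<close>

lemma rand_qbs_option_Some:
  assumes "\<beta> \<in> rand A" "{r. Q r} \<in> sets borel"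
  shows "(\<lambda>r. if Q r then Some (\<beta> r) else None) \<in> rand (qbs_option A)"
  using assms by (auto simp: qbs_option_def intro!: exI[of _ "{r. Q r}"])

lemma rand_qbs_option_points: "is_qbs A \<Longrightarrow> \<beta> \<in> rand (qbs_option A) \<Longrightarrow> \<beta> r \<in> points (qbs_option A)"
  by (auto simp: qbs_option_def split: if_splits dest: rand_in_points)

lemma rand_option_case_measurable:
  assumes "\<alpha> \<in> rand (qbs_option A)" "f \<in> qbs_hom A ennreal_qbs"
  shows "(\<lambda>r. case \<alpha> r of None \<Rightarrow> 0 | Some x \<Rightarrow> f x) \<in> borel_measurable borel"
proof -
  obtain U \<beta> where \<alpha>: "\<alpha> = (\<lambda>r. if r \<in> U then Some (\<beta> r) else None)"
    and U: "U \<in> sets borel" "U \<noteq> {} \<longrightarrow> \<beta> \<in> rand A"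
    using assms(1) by (auto simp: qbs_option_def)
  show ?thesis
  proof (cases "U = {}")
    case False
    then have "(\<lambda>r. f (\<beta> r)) \<in> borel_measurable borel"
      using qbs_homD[OF assms(2)] U by auto
    then have "(\<lambda>r. if r \<in> U then f (\<beta> r) else 0) \<in> borel_measurable borel"
      using U by (intro measurable_If_set) auto
    moreover have "(\<lambda>r. case \<alpha> r of None \<Rightarrow> 0 | Some x \<Rightarrow> f x) = (\<lambda>r. if r \<in> U then f (\<beta> r) else 0)"
      by (auto simp: \<alpha>)
    ultimately show ?thesis by simp
  qed (simp add: \<alpha>)
qed

lemma map_option_rand:
  assumes "\<alpha> \<in> rand (qbs_option A)" "T \<in> qbs_hom A B"
  shows "(\<lambda>r. map_option T (\<alpha> r)) \<in> rand (qbs_option B)"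
proof -
  obtain U \<beta> where \<alpha>: "\<alpha> = (\<lambda>r. if r \<in> U then Some (\<beta> r) else None)"
    and U: "U \<in> sets borel" "U \<noteq> {} \<longrightarrow> \<beta> \<in> rand A"
    using assms(1) by (auto simp: qbs_option_def)
  have "(\<lambda>r. map_option T (\<alpha> r)) = (\<lambda>r. if r \<in> U then Some (T (\<beta> r)) else None)"
    by (auto simp: \<alpha>)
  then show ?thesis
    using U qbs_homD[OF assms(2), of \<beta>]
    by (auto simp: qbs_option_def intro!: exI[of _ U] exI[of _ "\<lambda>r. T (\<beta> r)"])
qed

lemma map_option_points: "a \<in> points (qbs_option A) \<Longrightarrow> T \<in> qbs_hom A B \<Longrightarrow> map_option T a \<in> points (qbs_option B)"
  by (auto simp: qbs_option_def dest: qbs_hom_points)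

lemma rep_rand:
  assumes "(\<alpha>, \<mu>) \<in> points (subprob_reps A)"
  shows "\<alpha> \<in> rand (qbs_option A)"
  using assms qbs_homD[of \<alpha> real_qbs "qbs_option A" "\<lambda>r. r"]
  by (auto simp: subprob_reps_def qbs_fun_def)

lemma rep_prob:
  assumes "(\<alpha>, \<mu>) \<in> points (subprob_reps A)"
  shows "prob_space \<mu>" "sets \<mu> = sets borel"
  using assms by (auto simp: subprob_reps_def std_qbs_def space_prob_algebra)

lemma rep_measurable:
  assumes "(\<alpha>, \<mu>) \<in> points (subprob_reps A)" "f \<in> qbs_hom A ennreal_qbs"
  shows "(\<lambda>r. case \<alpha> r of None \<Rightarrow> 0 | Some x \<Rightarrow> f x) \<in> borel_measurable \<mu>"
  using rand_option_case_measurable[OF rep_rand[OF assms(1)] assms(2)] rep_prob(2)[OF assms(1)]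
    measurable_cong_sets by blast

text \<open>Closure under reparametrization appears as a hypothesis; it takes the place of a proof
  that \<open>qbs_option A\<close> is a QBS.\<close>

lemma repI:
  assumes "is_qbs A" "\<And>f. f \<in> borel_measurable borel \<Longrightarrow> (\<lambda>r. \<alpha> (f r)) \<in> rand (qbs_option A)"
    and "prob_space \<mu>" "sets \<mu> = sets borel"
  shows "(\<alpha>, \<mu>) \<in> points (subprob_reps A)"
proof -
  have "\<alpha> r \<in> points (qbs_option A)" for r
    using rand_qbs_option_points[OF assms(1) assms(2)[of "\<lambda>x. x"]] by simp
  then show ?thesis
    using assms by (auto simp: subprob_reps_def std_qbs_def space_prob_algebra qbs_fun_def
        comp_def intro!: qbs_homI)
qed

text \<open>Equivalent representatives agree on measurable integrands, so the image of the class is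
  a singleton. For other integrands \<open>sint\<close> may be unspecified; hence the
  \<open>qbs_hom\<close> premises of the lemmas on \<open>sint\<close>.\<close>

lemma sint_class:
  assumes "p \<in> points (subprob_reps A)" "f \<in> qbs_hom A ennreal_qbs"
  shows "sint (subprob_rel A `` {p}) f = rep_integral f p"
proof -
  have "rep_integral f ` (subprob_rel A `` {p}) = {rep_integral f p}"
    using assms by (auto simp: subprob_rel_def)
  then show ?thesis by (simp add: sint_def)
qed

lemma class_in_subprob:
  "p \<in> points (subprob_reps A) \<Longrightarrow> subprob_rel A `` {p} \<in> points (qbs_subprob A)"
  by (auto simp: qbs_subprob_def qbs_quot_def intro: quotientI)

lemma subprob_cases:
  assumes "\<mu> \<in> points (qbs_subprob A)"
  obtains p where "p \<in> points (subprob_reps A)" "\<mu> = subprob_rel A `` {p}"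
  using assms by (auto simp: qbs_subprob_def qbs_quot_def elim: quotientE)

section \<open>Push-forward and integration\<close>

definition push_rep :: "('a \<Rightarrow> 'b) \<Rightarrow> 'a subprob_rep \<Rightarrow> 'b subprob_rep" where
  "push_rep T p = (\<lambda>r. map_option T (fst p r), snd p)"

text \<open>All representatives are pushed and the resulting classes united, so that none has to be
  chosen; \<open>push_class\<close> shows that these classes coincide.\<close>

definition push :: "'b qbs \<Rightarrow> ('a \<Rightarrow> 'b) \<Rightarrow> 'a subprob \<Rightarrow> 'b subprob" where
  "push B T \<mu> = subprob_rel B `` (push_rep T ` \<mu>)"

lemma rep_integral_push_rep: "rep_integral f (push_rep T p) = rep_integral (\<lambda>x. f (T x)) p"
proof -
  have "(case map_option T y of None \<Rightarrow> 0 | Some x \<Rightarrow> f x) = (case y of None \<Rightarrow> 0 | Some x \<Rightarrow> f (T x))" for y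
    by (cases y) auto
  then show ?thesis
    by (simp add: rep_integral_def push_rep_def case_prod_beta)
qed

lemma qbs_hom_comp: "f \<in> qbs_hom B C \<Longrightarrow> T \<in> qbs_hom A B \<Longrightarrow> (\<lambda>x. f (T x)) \<in> qbs_hom A C"
  by (auto intro!: qbs_homI dest: qbs_homD qbs_hom_points)

lemma push_rep_in:
  assumes "p \<in> points (subprob_reps A)" "T \<in> qbs_hom A B"
  shows "push_rep T p \<in> points (subprob_reps B)"
proof -
  have "fst p \<in> qbs_hom real_qbs (qbs_option A)" and s: "snd p \<in> points (std_qbs (prob_algebra borel))"
    using assms(1) by (auto simp: subprob_reps_def qbs_fun_def)
  then have "(\<lambda>r. map_option T (fst p r)) \<in> qbs_hom real_qbs (qbs_option B)"
    using assms(2) by (intro qbs_homI map_option_points map_option_rand) (auto dest: qbs_homD qbs_hom_points)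
  with s show ?thesis
    by (simp add: subprob_reps_def push_rep_def points_qbs_fun)
qed

lemma push_class:
  assumes p: "p \<in> points (subprob_reps A)" and T: "T \<in> qbs_hom A B"
  shows "push B T (subprob_rel A `` {p}) = subprob_rel B `` {push_rep T p}"
proof -
  have "rep_integral f (push_rep T q) = rep_integral f (push_rep T p)"
    if "(p, q) \<in> subprob_rel A" "f \<in> qbs_hom B ennreal_qbs" for q f
    using that qbs_hom_comp[OF that(2) T] unfolding rep_integral_push_rep subprob_rel_def by auto
  moreover have "push_rep T q \<in> points (subprob_reps B)" if "(p, q) \<in> subprob_rel A" for q
    using that push_rep_in[OF _ T] unfolding subprob_rel_def by auto
  ultimately have "(push_rep T p, push_rep T q) \<in> subprob_rel B" if "(p, q) \<in> subprob_rel A" for q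
    using that push_rep_in[OF p T] by (auto simp: subprob_rel_def[of B])
  then have "subprob_rel B `` {push_rep T q} = subprob_rel B `` {push_rep T p}" if "(p, q) \<in> subprob_rel A" for q
    using that by (auto simp: subprob_rel_def[of B])
  moreover have "(p, p) \<in> subprob_rel A"
    using p by (auto simp: subprob_rel_def)
  moreover have "push B T (subprob_rel A `` {p}) = (\<Union>q\<in>subprob_rel A `` {p}. subprob_rel B `` {push_rep T q})"
    by (auto simp: push_def)
  ultimately show ?thesis
    by (metis (no_types, lifting) Image_singleton_iff SUP_eq_const empty_iff)
qed

lemma push_hom:
  assumes T: "T \<in> qbs_hom A B"
  shows "push B T \<in> qbs_hom (qbs_subprob A) (qbs_subprob B)"
proof (rule qbs_homI)
  fix \<mu> assume "\<mu> \<in> points (qbs_subprob A)"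
  then show "push B T \<mu> \<in> points (qbs_subprob B)"
    by (elim subprob_cases) (simp add: push_class T class_in_subprob push_rep_in)
next
  fix \<alpha> assume "\<alpha> \<in> rand (qbs_subprob A)"
  then obtain \<beta> where \<alpha>: "\<alpha> = (\<lambda>r. subprob_rel A `` {\<beta> r})" and \<beta>: "\<beta> \<in> rand (subprob_reps A)"
    by (auto simp: qbs_subprob_def qbs_quot_def)
  have f: "(\<lambda>r. fst (\<beta> r)) \<in> rand (qbs_fun real_qbs (qbs_option A))"
    and s: "(\<lambda>r. snd (\<beta> r)) \<in> rand (std_qbs (prob_algebra borel))"
    using \<beta> by (auto simp: subprob_reps_def rand_qbs_pair)
  have \<beta>p: "\<beta> r \<in> points (subprob_reps A)" for r
    using f s rand_in_points[OF is_qbs_std s]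
    by (auto simp: subprob_reps_def mem_Times_iff qbs_fun_def)
  have "(\<lambda>r. push_rep T (\<beta> r)) \<in> rand (subprob_reps B)"
  proof -
    have "(\<lambda>r x. map_option T (fst (\<beta> r) x)) \<in> rand (qbs_fun real_qbs (qbs_option B))"
      using f unfolding qbs_fun_def
      by (auto simp: comp_def mem_Times_iff case_prod_beta intro!: qbs_homI map_option_points[OF _ T] map_option_rand[OF _ T]
          dest: qbs_homD qbs_hom_points)
    then show ?thesis
      using s by (simp add: subprob_reps_def rand_qbs_pair push_rep_def)
  qed
  then show "(\<lambda>r. push B T (\<alpha> r)) \<in> rand (qbs_subprob B)"
    by (auto simp: \<alpha> push_class[OF \<beta>p T] qbs_subprob_def qbs_quot_def)
qed

lemma sint_push:
  assumes "\<mu> \<in> points (qbs_subprob A)" "T \<in> qbs_hom A B" "f \<in> qbs_hom B ennreal_qbs"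
  shows "sint (push B T \<mu>) f = sint \<mu> (\<lambda>x. f (T x))"
  using assms(1)
  by (elim subprob_cases)
    (simp add: push_class assms sint_class push_rep_in qbs_hom_comp[OF assms(3,2)] rep_integral_push_rep)

text \<open>Monotone convergence on a representative. Finite sums are later reduced to this form by
  padding with zeros.\<close>

lemma sint_suminf:
  fixes f :: "nat \<Rightarrow> 'a \<Rightarrow> ennreal"
  assumes \<mu>: "\<mu> \<in> points (qbs_subprob A)" and f: "\<And>i. f i \<in> qbs_hom A ennreal_qbs"
  shows "(\<Sum>i. sint \<mu> (f i)) = sint \<mu> (\<lambda>x. \<Sum>i. f i x)"
proof -
  obtain \<alpha> \<nu> where p: "(\<alpha>, \<nu>) \<in> points (subprob_reps A)" and \<mu>: "\<mu> = subprob_rel A `` {(\<alpha>, \<nu>)}"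
    using \<mu> by (elim subprob_cases) auto
  have s: "(\<lambda>x. \<Sum>i. f i x) \<in> qbs_hom A ennreal_qbs"
    using qbs_homD[OF f] by (auto intro!: qbs_homI borel_measurable_suminf)
  have "(\<integral>\<^sup>+ r. (case \<alpha> r of None \<Rightarrow> 0 | Some x \<Rightarrow> \<Sum>i. f i x) \<partial>\<nu>)
      = (\<integral>\<^sup>+ r. (\<Sum>i. case \<alpha> r of None \<Rightarrow> 0 | Some x \<Rightarrow> f i x) \<partial>\<nu>)"
    by (intro nn_integral_cong) (auto split: option.split)
  also have "\<dots> = (\<Sum>i. \<integral>\<^sup>+ r. (case \<alpha> r of None \<Rightarrow> 0 | Some x \<Rightarrow> f i x) \<partial>\<nu>)"
    by (intro nn_integral_suminf rep_measurable[OF p] f)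
  finally show ?thesis
    using sint_class[OF p s] sint_class[OF p f] by (simp add: \<mu> rep_integral_def)
qed

text \<open>Random elements take values in the points of a QBS, so integrands need to agree only
  there; this also carries measurability over from \<open>f\<close> to \<open>g\<close>.\<close>

lemma sint_cong:
  assumes \<mu>: "\<mu> \<in> points (qbs_subprob A)" and f: "f \<in> qbs_hom A ennreal_qbs" and A: "is_qbs A"
    and eq: "\<And>x. x \<in> points A \<Longrightarrow> f x = g x"
  shows "sint \<mu> f = sint \<mu> g"
proof -
  obtain \<alpha> \<nu> where p: "(\<alpha>, \<nu>) \<in> points (subprob_reps A)" and \<mu>: "\<mu> = subprob_rel A `` {(\<alpha>, \<nu>)}"
    using \<mu> by (elim subprob_cases) auto
  have g: "g \<in> qbs_hom A ennreal_qbs"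
  proof (rule qbs_homI)
    fix \<alpha> assume "\<alpha> \<in> rand A"
    then show "(\<lambda>r. g (\<alpha> r)) \<in> rand ennreal_qbs"
      using qbs_homD[OF f] eq rand_in_points[OF A] by fastforce
  qed auto
  have "\<alpha> r \<in> points (qbs_option A)" for r
    using rand_qbs_option_points[OF A rep_rand[OF p]] .
  then have "(case \<alpha> r of None \<Rightarrow> 0 | Some x \<Rightarrow> f x) = (case \<alpha> r of None \<Rightarrow> 0 | Some x \<Rightarrow> g x)" for r
    using eq by (auto split: option.split simp: qbs_option_def dest: spec[of _ r])
      (metis (no_types, lifting) imageE insertE option.distinct(1) option.inject)
  then show ?thesis
    using sint_class[OF p f] sint_class[OF p g] by (simp add: \<mu> rep_integral_def)
qed

text \<open>The random element is constant, so any probability measure on the line would do.\<close>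

definition dirac :: "'a qbs \<Rightarrow> 'a \<Rightarrow> 'a subprob" where
  "dirac A x = subprob_rel A `` {(\<lambda>_. Some x, return borel 0)}"

lemma dirac_rep:
  assumes "is_qbs A" "x \<in> points A"
  shows "(\<lambda>_. Some x, return borel 0) \<in> points (subprob_reps A)"
  using rand_qbs_option_Some[of "\<lambda>_. x" A "\<lambda>_. True"] const_rand[OF assms]
  by (intro repI assms prob_space_return) auto

lemma dirac_in: "is_qbs A \<Longrightarrow> x \<in> points A \<Longrightarrow> dirac A x \<in> points (qbs_subprob A)"
  unfolding dirac_def by (intro class_in_subprob dirac_rep)

lemma sint_dirac:
  assumes "is_qbs A" "x \<in> points A" "f \<in> qbs_hom A ennreal_qbs"
  shows "sint (dirac A x) f = f x"
  using sint_class[OF dirac_rep[OF assms(1,2)] assms(3)]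
  by (simp add: dirac_def rep_integral_def prob_space.emeasure_space_1[OF prob_space_return])

section \<open>Convex combinations and sums of tests\<close>

lemma dual_simps [simp]:
  "elts (dual X) = tests X" "tests (dual X) = elts X" "pairing (dual X) x \<eta> = pairing X \<eta> x"
  by (simp_all add: dual_def)

text \<open>The part of the axioms of a convex QBS that the construction of tensor powers uses. It is
  asymmetric: sums of tests have to be measurable, convex combinations of elements only have to exist.
  This makes it easy to transfer from \<^term>\<open>X\<close> to \<^term>\<open>with_W X\<close>.\<close>

locale tame_cqbs =
  fixes X :: "('a, 'b) cqbs"
  assumes elts_qbs: "is_qbs (elts X)" and tests_qbs: "is_qbs (tests X)"
    and pairing_hom: "(\<lambda>(\<eta>, x). pairing X \<eta> x) \<in> qbs_hom (qbs_pair (tests X) (elts X)) unit_qbs"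
    and tests_separated: "separated (dual X)"
    and tests_sums: "has_sums (dual X)"
    and zero_test_ex: "\<exists>\<eta>\<in>points (tests X). \<forall>x\<in>points (elts X). pairing X \<eta> x = 0"
    and convex_comb_ex: "finite (I :: nat set) \<Longrightarrow> (\<And>i. i \<in> I \<Longrightarrow> 0 \<le> w i \<and> x i \<in> points (elts X))
      \<Longrightarrow> sum w I \<le> 1
      \<Longrightarrow> \<exists>z\<in>points (elts X). \<forall>\<eta>\<in>points (tests X). pairing X \<eta> z = (\<Sum>i\<in>I. w i * pairing X \<eta> (x i))"
begin

lemma pairing_bounds:
  assumes "\<eta> \<in> points (tests X)" "x \<in> points (elts X)"
  shows "0 \<le> pairing X \<eta> x" "pairing X \<eta> x \<le> 1"
  using qbs_hom_points[OF pairing_hom, of "(\<eta>, x)"] assms by auto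

lemma pairing_rand:
  assumes "\<alpha> \<in> rand (tests X)" "\<beta> \<in> rand (elts X)"
  shows "(\<lambda>r. pairing X (\<alpha> r) (\<beta> r)) \<in> borel_measurable borel"
  using qbs_homD[OF pairing_hom, of "\<lambda>r. (\<alpha> r, \<beta> r)"] assms by (simp add: rand_qbs_pair rand_unit_qbs)

lemma tests_eqI:
  assumes "\<eta> \<in> points (tests X)" "\<eta>' \<in> points (tests X)"
    and "\<And>x. x \<in> points (elts X) \<Longrightarrow> pairing X \<eta> x = pairing X \<eta>' x"
  shows "\<eta> = \<eta>'"
  using tests_separated assms by (auto simp: separated_def)

lemma zero_elt_ex: "\<exists>z\<in>points (elts X). \<forall>\<eta>\<in>points (tests X). pairing X \<eta> z = 0"
  using convex_comb_ex[of "{}"] by simp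

text \<open>One operator \<open>Sum\<close> serves all families, because measurability in a
  parameter makes sense only for a fixed choice. It comes from the countable sums of tests:
  enumerate \<open>I\<close> and continue with the zero test.\<close>

lemma tests_finite_sum:
  fixes I :: "'i set"
  assumes I: "finite I"
  obtains Sum where
    "\<And>\<eta>. (\<And>i. i \<in> I \<Longrightarrow> \<eta> i \<in> points (tests X)) \<Longrightarrow>
        (\<And>x. x \<in> points (elts X) \<Longrightarrow> (\<Sum>i\<in>I. pairing X (\<eta> i) x) \<le> 1) \<Longrightarrow>
        Sum \<eta> \<in> points (tests X) \<and> (\<forall>x\<in>points (elts X). pairing X (Sum \<eta>) x = (\<Sum>i\<in>I. pairing X (\<eta> i) x))"
    "\<And>\<alpha>. (\<And>i. i \<in> I \<Longrightarrow> (\<lambda>t. \<alpha> t i) \<in> rand (tests X)) \<Longrightarrow>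
        (\<And>t x. x \<in> points (elts X) \<Longrightarrow> (\<Sum>i\<in>I. pairing X (\<alpha> t i) x) \<le> 1) \<Longrightarrow>
        (\<lambda>t. Sum (\<alpha> t)) \<in> rand (tests X)"
proof -
  obtain e where e: "bij_betw e {0..<card I} I"
    using ex_bij_betw_nat_finite[OF I] by blast
  obtain z where z: "z \<in> points (tests X)" "\<And>x. x \<in> points (elts X) \<Longrightarrow> pairing X z x = 0"
    using zero_test_ex by blast
  obtain S where S: "S \<in> qbs_hom (summable_seqs (dual X)) (tests X)"
    and S_eq: "\<And>\<eta> x. \<eta> \<in> points (summable_seqs (dual X)) \<Longrightarrow> x \<in> points (elts X) \<Longrightarrow>
      ennreal (pairing X (S \<eta>) x) = (\<Sum>n. ennreal (pairing X (\<eta> n) x))"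
    using tests_sums unfolding has_sums_def by auto
  define q where "q \<eta> = (\<lambda>n. if n < card I then \<eta> (e n) else z)" for \<eta> :: "'i \<Rightarrow> 'b"
  have eI: "e n \<in> I" if "n < card I" for n
    using e that by (auto simp: bij_betw_def)
  have q_sum: "(\<Sum>n. ennreal (pairing X (q \<eta> n) x)) = ennreal (\<Sum>i\<in>I. pairing X (\<eta> i) x)"
    if \<eta>: "\<And>i. i \<in> I \<Longrightarrow> \<eta> i \<in> points (tests X)" and x: "x \<in> points (elts X)" for \<eta> x
  proof -
    have "(\<Sum>n. ennreal (pairing X (q \<eta> n) x)) = (\<Sum>n\<in>{0..<card I}. ennreal (pairing X (q \<eta> n) x))"
      by (rule suminf_finite) (auto simp: q_def z x)
    also have "\<dots> = (\<Sum>n\<in>{0..<card I}. ennreal (pairing X (\<eta> (e n)) x))"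
      by (rule sum.cong) (auto simp: q_def)
    also have "\<dots> = (\<Sum>i\<in>I. ennreal (pairing X (\<eta> i) x))"
      by (rule sum.reindex_bij_betw[OF e])
    also have "\<dots> = ennreal (\<Sum>i\<in>I. pairing X (\<eta> i) x)"
      using pairing_bounds \<eta> x by (intro sum_ennreal) auto
    finally show ?thesis .
  qed
  have q_in: "q \<eta> \<in> points (summable_seqs (dual X))"
    if "\<And>i. i \<in> I \<Longrightarrow> \<eta> i \<in> points (tests X)"
      "\<And>x. x \<in> points (elts X) \<Longrightarrow> (\<Sum>i\<in>I. pairing X (\<eta> i) x) \<le> 1" for \<eta>
    unfolding summable_seqs_def using that
    by (auto simp: q_sum ennreal_le_1) (auto simp: q_def z eI)
  show thesis
  proof (rule that)
    fix \<eta> assume \<eta>: "\<And>i. i \<in> I \<Longrightarrow> \<eta> i \<in> points (tests X)"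
      "\<And>x. x \<in> points (elts X) \<Longrightarrow> (\<Sum>i\<in>I. pairing X (\<eta> i) x) \<le> 1"
    have S_in: "S (q \<eta>) \<in> points (tests X)"
      using qbs_hom_points[OF S q_in] \<eta> by blast
    have "pairing X (S (q \<eta>)) x = (\<Sum>i\<in>I. pairing X (\<eta> i) x)" if x: "x \<in> points (elts X)" for x
    proof -
      have "ennreal (pairing X (S (q \<eta>)) x) = ennreal (\<Sum>i\<in>I. pairing X (\<eta> i) x)"
        using S_eq[OF q_in x] q_sum[OF \<eta>(1) x] \<eta> by simp
      then show ?thesis
        using pairing_bounds S_in x \<eta> by (subst (asm) ennreal_inj) (auto intro!: sum_nonneg)
    qed
    with S_in show "S (q \<eta>) \<in> points (tests X) \<and>
        (\<forall>x\<in>points (elts X). pairing X (S (q \<eta>)) x = (\<Sum>i\<in>I. pairing X (\<eta> i) x))"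
      by blast
  next
    fix \<alpha> assume \<alpha>: "\<And>i. i \<in> I \<Longrightarrow> (\<lambda>t. \<alpha> t i) \<in> rand (tests X)"
      and b: "\<And>t x. x \<in> points (elts X) \<Longrightarrow> (\<Sum>i\<in>I. pairing X (\<alpha> t i) x) \<le> 1"
    have "\<alpha> t i \<in> points (tests X)" if "i \<in> I" for t i
      using rand_in_points[OF tests_qbs \<alpha>[OF that]] .
    then have "q (\<alpha> t) \<in> points (summable_seqs (dual X))" for t
      using b by (intro q_in)
    moreover have "(\<lambda>t. q (\<alpha> t) n) \<in> rand (tests X)" for n
      using \<alpha>[OF eI] z const_rand[OF tests_qbs] by (cases "n < card I") (auto simp: q_def)
    ultimately have "(\<lambda>t. q (\<alpha> t)) \<in> rand (summable_seqs (dual X))"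
      by (auto simp: summable_seqs_def rand_qbs_sub rand_qbs_prod)
    then show "(\<lambda>t. S (q (\<alpha> t))) \<in> rand (tests X)"
      using qbs_homD[OF S] by blast
  qed
qed

end

section \<open>Zero, scalar multiples and convex combinations from the axioms\<close>

lemma expectation_of_rep:
  assumes "has_expectation Z" "is_qbs (tests Z)" "p \<in> points (subprob_reps (elts Z))"
    and hom: "(\<lambda>(\<eta>, x). pairing Z \<eta> x) \<in> qbs_hom (qbs_pair (tests Z) (elts Z)) unit_qbs"
  shows "\<exists>z\<in>points (elts Z). \<forall>\<eta>\<in>points (tests Z).
    ennreal (pairing Z \<eta> z) = rep_integral (\<lambda>x. ennreal (pairing Z \<eta> x)) p"
proof -
  obtain E where E: "E \<in> qbs_hom (qbs_subprob (elts Z)) (elts Z)"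
    and E_eq: "\<And>\<mu> \<eta>. \<mu> \<in> points (qbs_subprob (elts Z)) \<Longrightarrow> \<eta> \<in> points (tests Z) \<Longrightarrow>
       ennreal (pairing Z \<eta> (E \<mu>)) = sint \<mu> (\<lambda>x. ennreal (pairing Z \<eta> x))"
    using assms(1) by (auto simp: has_expectation_def)
  have "(\<lambda>x. ennreal (pairing Z \<eta> x)) \<in> qbs_hom (elts Z) ennreal_qbs" if "\<eta> \<in> points (tests Z)" for \<eta>
  proof (rule qbs_homI)
    fix \<alpha> assume "\<alpha> \<in> rand (elts Z)"
    then have "(\<lambda>r. pairing Z \<eta> (\<alpha> r)) \<in> borel_measurable borel"
      using qbs_homD[OF hom, of "\<lambda>r. (\<eta>, \<alpha> r)"] that const_rand[OF assms(2)]
      by (simp add: rand_qbs_pair rand_unit_qbs)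
    then show "(\<lambda>r. ennreal (pairing Z \<eta> (\<alpha> r))) \<in> rand ennreal_qbs" by simp
  qed auto
  then show ?thesis
    using class_in_subprob[OF assms(3)] E_eq qbs_hom_points[OF E] sint_class[OF assms(3)] by metis
qed

text \<open>The zero is the barycentre of the null measure, represented by the random element that
  is undefined everywhere.\<close>

lemma zero_of_expectation:
  assumes "has_expectation Z" "is_qbs (tests Z)" "is_qbs (elts Z)"
    and hom: "(\<lambda>(\<eta>, x). pairing Z \<eta> x) \<in> qbs_hom (qbs_pair (tests Z) (elts Z)) unit_qbs"
  shows "\<exists>z\<in>points (elts Z). \<forall>\<eta>\<in>points (tests Z). pairing Z \<eta> z = 0"
proof -
  have "(\<lambda>r :: real. None) \<in> rand (qbs_option (elts Z))"
    by (auto simp: qbs_option_def intro!: exI[of _ "{}"])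
  then have "(\<lambda>_. None, return borel 0) \<in> points (subprob_reps (elts Z))"
    by (intro repI assms prob_space_return) auto
  from expectation_of_rep[OF assms(1,2) this hom]
  obtain z where z: "z \<in> points (elts Z)" "\<And>\<eta>. \<eta> \<in> points (tests Z) \<Longrightarrow> ennreal (pairing Z \<eta> z) = 0"
    by (auto simp: rep_integral_def)
  moreover have "0 \<le> pairing Z \<eta> z" if "\<eta> \<in> points (tests Z)" for \<eta>
    using qbs_hom_points[OF hom, of "(\<eta>, z)"] that z by auto
  ultimately show ?thesis
    by (metis ennreal_eq_0_iff order_antisym)
qed

lemma scale_of_expectation:
  assumes "has_expectation Z" "is_qbs (tests Z)" "is_qbs (elts Z)"
    and hom: "(\<lambda>(\<eta>, x). pairing Z \<eta> x) \<in> qbs_hom (qbs_pair (tests Z) (elts Z)) unit_qbs"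
    and x: "x \<in> points (elts Z)" and c: "0 \<le> c" "c \<le> 1"
  shows "\<exists>z\<in>points (elts Z). \<forall>\<eta>\<in>points (tests Z). pairing Z \<eta> z = c * pairing Z \<eta> x"
proof -
  \<comment> \<open>Under the uniform distribution \<open>{0..c}\<close> has probability
    \<open>c\<close>, so the random element that is \<open>x\<close> there and undefined elsewhere
    represents \<open>c\<close> times the point mass at \<open>x\<close>.\<close>
  define \<mu> :: "real measure" where "\<mu> = uniform_measure lborel {0..1}"
  have \<mu>: "prob_space \<mu>" "sets \<mu> = sets borel"
    by (auto simp: \<mu>_def intro!: prob_space_uniform_measure)
  have "(\<lambda>r. if f r \<in> {0..c} then Some x else None) \<in> rand (qbs_option (elts Z))"
    if "f \<in> borel_measurable borel" for f :: "real \<Rightarrow> real"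
  proof (rule rand_qbs_option_Some)
    have "{r \<in> space borel. f r \<in> {0..c}} \<in> sets borel"
      using that by measurable
    then show "{r. f r \<in> {0..c}} \<in> sets borel" by simp
  qed (use const_rand[OF assms(3) x] in auto)
  then have "(\<lambda>r. if r \<in> {0..c} then Some x else None, \<mu>) \<in> points (subprob_reps (elts Z))"
    using \<mu> by (intro repI assms)
  from expectation_of_rep[OF assms(1,2) this hom]
  obtain z where z: "z \<in> points (elts Z)"
    and eq: "\<And>\<eta>. \<eta> \<in> points (tests Z) \<Longrightarrow> ennreal (pairing Z \<eta> z)
      = (\<integral>\<^sup>+ r. (case if r \<in> {0..c} then Some x else None of None \<Rightarrow> 0 | Some x \<Rightarrow> ennreal (pairing Z \<eta> x)) \<partial>\<mu>)"
    by (auto simp: rep_integral_def)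
  have "pairing Z \<eta> z = c * pairing Z \<eta> x" if \<eta>: "\<eta> \<in> points (tests Z)" for \<eta>
  proof -
    have pos: "0 \<le> pairing Z \<eta> z" "0 \<le> pairing Z \<eta> x"
      using qbs_hom_points[OF hom, of "(\<eta>, z)"] qbs_hom_points[OF hom, of "(\<eta>, x)"] \<eta> z x by auto
    have "emeasure \<mu> {0..c} = ennreal c"
    proof -
      have "emeasure \<mu> {0..c} = emeasure lborel ({0..1} \<inter> {0..c}) / emeasure lborel {0..1 :: real}"
        unfolding \<mu>_def by (rule emeasure_uniform_measure) auto
      also have "{0..1} \<inter> {0..c} = {0..c}" using c by auto
      finally show ?thesis using c divide_ennreal[of c 1] by simp
    qed
    moreover have "(case if r \<in> {0..c} then Some x else None of None \<Rightarrow> 0 | Some x \<Rightarrow> ennreal (pairing Z \<eta> x))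
        = ennreal (pairing Z \<eta> x) * indicator {0..c} r" for r
      by (auto simp: indicator_def)
    ultimately have "ennreal (pairing Z \<eta> z) = ennreal (pairing Z \<eta> x) * ennreal c"
      unfolding eq[OF \<eta>] using \<mu> by (simp add: nn_integral_cmult_indicator)
    then show ?thesis
      using pos c by (simp add: ennreal_mult[symmetric] mult.commute)
  qed
  with z show ?thesis by blast
qed

text \<open>Scaling comes from expectations and addition from countable sums padded with zero. The
  zero test is the expectation of the null measure in the dual.\<close>

lemma convex_qbs_tame:
  assumes "convex_qbs X"
  shows "tame_cqbs X"
proof
  have X: "is_qbs (elts X)" "is_qbs (tests X)"
    "(\<lambda>(\<eta>, x). pairing X \<eta> x) \<in> qbs_hom (qbs_pair (tests X) (elts X)) unit_qbs"
    "separated (dual X)" "has_sums (dual X)" "has_expectation X" "has_expectation (dual X)" "has_sums X"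
    using assms by (auto simp: convex_qbs_def)
  then show "is_qbs (elts X)" "is_qbs (tests X)"
    "(\<lambda>(\<eta>, x). pairing X \<eta> x) \<in> qbs_hom (qbs_pair (tests X) (elts X)) unit_qbs"
    "separated (dual X)" "has_sums (dual X)" by auto
  have "(\<lambda>(x, \<eta>). pairing (dual X) x \<eta>) \<in> qbs_hom (qbs_pair (tests (dual X)) (elts (dual X))) unit_qbs"
  proof -
    have "(\<lambda>p. (snd p, fst p)) \<in> qbs_hom (qbs_pair (elts X) (tests X)) (qbs_pair (tests X) (elts X))"
      by (rule qbs_homI) (auto simp: rand_qbs_pair)
    from qbs_hom_comp[OF X(3) this] show ?thesis
      by (simp add: case_prod_beta')
  qed
  from zero_of_expectation[OF X(7) _ _ this]
  show "\<exists>\<eta>\<in>points (tests X). \<forall>x\<in>points (elts X). pairing X \<eta> x = 0"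
    using X by simp
  fix I :: "nat set" and w :: "nat \<Rightarrow> real" and x
  assume I: "finite I" and wx: "\<And>i. i \<in> I \<Longrightarrow> 0 \<le> w i \<and> x i \<in> points (elts X)" and le: "sum w I \<le> 1"
  have w1: "w i \<le> 1" if "i \<in> I" for i
    using member_le_sum[OF that, of w] I wx le by fastforce
  obtain z0 where z0: "z0 \<in> points (elts X)" "\<And>\<eta>. \<eta> \<in> points (tests X) \<Longrightarrow> pairing X \<eta> z0 = 0"
    using zero_of_expectation[OF X(6,2,1,3)] by blast
  have "\<exists>z\<in>points (elts X). \<forall>\<eta>\<in>points (tests X). pairing X \<eta> z = w i * pairing X \<eta> (x i)" if "i \<in> I" for i
    using scale_of_expectation[OF X(6,2,1,3)] wx w1 that by blast
  then obtain s where s: "\<And>i. i \<in> I \<Longrightarrow> s i \<in> points (elts X)"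
    "\<And>i \<eta>. i \<in> I \<Longrightarrow> \<eta> \<in> points (tests X) \<Longrightarrow> pairing X \<eta> (s i) = w i * pairing X \<eta> (x i)"
    by metis
  define q where "q n = (if n \<in> I then s n else z0)" for n
  obtain S where S: "S \<in> qbs_hom (summable_seqs X) (elts X)"
    and S_eq: "\<And>x \<eta>. x \<in> points (summable_seqs X) \<Longrightarrow> \<eta> \<in> points (tests X) \<Longrightarrow>
      ennreal (pairing X \<eta> (S x)) = (\<Sum>n. ennreal (pairing X \<eta> (x n)))"
    using X(8) unfolding has_sums_def by auto
  have bnd: "0 \<le> pairing X \<eta> y" "pairing X \<eta> y \<le> 1" if "\<eta> \<in> points (tests X)" "y \<in> points (elts X)" for \<eta> y
    using qbs_hom_points[OF X(3), of "(\<eta>, y)"] that by auto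
  have q_sum: "(\<Sum>n. ennreal (pairing X \<eta> (q n))) = ennreal (\<Sum>i\<in>I. w i * pairing X \<eta> (x i))"
    if \<eta>: "\<eta> \<in> points (tests X)" for \<eta>
  proof -
    have "(\<Sum>n. ennreal (pairing X \<eta> (q n))) = (\<Sum>n\<in>I. ennreal (pairing X \<eta> (q n)))"
      by (rule suminf_finite) (auto simp: q_def z0 \<eta> I)
    also have "\<dots> = (\<Sum>n\<in>I. ennreal (w n * pairing X \<eta> (x n)))"
      by (rule sum.cong) (auto simp: q_def s \<eta>)
    also have "\<dots> = ennreal (\<Sum>n\<in>I. w n * pairing X \<eta> (x n))"
      using bnd wx \<eta> by (intro sum_ennreal) auto
    finally show ?thesis .
  qed
  have "(\<Sum>i\<in>I. w i * pairing X \<eta> (x i)) \<le> 1" if "\<eta> \<in> points (tests X)" for \<eta>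
  proof -
    have "(\<Sum>i\<in>I. w i * pairing X \<eta> (x i)) \<le> sum w I"
      using wx bnd that by (intro sum_mono) (simp add: mult_left_le)
    with le show ?thesis by simp
  qed
  then have q: "q \<in> points (summable_seqs X)"
    unfolding summable_seqs_def by (auto simp: q_sum ennreal_le_1) (auto simp: q_def z0 s)
  have "pairing X \<eta> (S q) = (\<Sum>i\<in>I. w i * pairing X \<eta> (x i))" if "\<eta> \<in> points (tests X)" for \<eta>
  proof -
    have "0 \<le> (\<Sum>i\<in>I. w i * pairing X \<eta> (x i))"
      using wx bnd[OF that] by (auto intro!: sum_nonneg)
    then show ?thesis
      using S_eq[OF q that] q_sum[OF that] bnd[OF that qbs_hom_points[OF S q]] by simp
  qed
  then show "\<exists>z\<in>points (elts X). \<forall>\<eta>\<in>points (tests X). pairing X \<eta> z = (\<Sum>i\<in>I. w i * pairing X \<eta> (x i))"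
    using qbs_hom_points[OF S q] by blast
qed

section \<open>The product with W\<close>

lemma elts_with_W: "elts (with_W X) = qbs_pair (elts X) unit_qbs"
  by (simp add: with_W_def)

lemma pairing_with_W [simp]: "pairing (with_W X) \<eta> x = pairing X (fst \<eta>) (fst x) + snd \<eta> * snd x"
  by (simp add: with_W_def case_prod_beta)

context tame_cqbs
begin

text \<open>Since the second component is nonnegative, the bound over all \<open>r\<close> is
  attained at \<open>r = 1\<close>.\<close>

lemma test_with_W_iff:
  "\<eta> \<in> points (tests (with_W X)) \<longleftrightarrow> fst \<eta> \<in> points (tests X) \<and> snd \<eta> \<in> {0..1} \<and>
     (\<forall>x\<in>points (elts X). pairing X (fst \<eta>) x + snd \<eta> \<le> 1)"
proof -
  have "(\<forall>r\<in>{0..1}. a + s * r \<le> 1) \<longleftrightarrow> a + s \<le> 1" if "0 \<le> s" for a s :: real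
    using that mult_left_le[of _ s] by (auto dest: bspec[of _ _ 1]) (smt (verit))
  then show ?thesis
    by (cases \<eta>) (auto simp: with_W_def)
qed

lemma rand_tests_with_W:
  "\<alpha> \<in> rand (tests (with_W X)) \<longleftrightarrow> (\<lambda>t. fst (\<alpha> t)) \<in> rand (tests X) \<and> (\<lambda>t. snd (\<alpha> t)) \<in> rand unit_qbs \<and>
     (\<forall>t. \<forall>x\<in>points (elts X). pairing X (fst (\<alpha> t)) x + snd (\<alpha> t) \<le> 1)"
proof (cases "(\<lambda>t. fst (\<alpha> t)) \<in> rand (tests X) \<and> (\<lambda>t. snd (\<alpha> t)) \<in> rand unit_qbs")
  case True
  then have "fst (\<alpha> t) \<in> points (tests X)" "snd (\<alpha> t) \<in> points unit_qbs" for t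
    using rand_in_points[OF tests_qbs, of "\<lambda>t. fst (\<alpha> t)"] rand_in_points[OF is_qbs_std, of "\<lambda>t. snd (\<alpha> t)" "restrict_space borel {0..1}"]
    by auto
  then have "\<alpha> t \<in> points (tests (with_W X)) \<longleftrightarrow> (\<forall>x\<in>points (elts X). pairing X (fst (\<alpha> t)) x + snd (\<alpha> t) \<le> 1)"
    "\<alpha> t \<in> points (tests (with_W X)) \<longleftrightarrow>
      \<alpha> t \<in> {(\<eta>, s). \<forall>x\<in>points (elts X). \<forall>r\<in>{0..1}. pairing X \<eta> x + s * r \<le> 1}" for t
    by (simp add: test_with_W_iff, simp add: with_W_def mem_Times_iff)
  with True show ?thesis
    by (auto simp: with_W_def rand_qbs_sub rand_qbs_pair)
qed (auto simp: with_W_def rand_qbs_sub rand_qbs_pair)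

lemma tame_with_W: "tame_cqbs (with_W X)"
proof
  obtain z0 where z0: "z0 \<in> points (elts X)" "\<And>\<eta>. \<eta> \<in> points (tests X) \<Longrightarrow> pairing X \<eta> z0 = 0"
    using zero_elt_ex by blast
  show "is_qbs (elts (with_W X))" "is_qbs (tests (with_W X))"
    by (simp_all add: with_W_def is_qbs_pair is_qbs_sub elts_qbs tests_qbs is_qbs_std)
  show "(\<lambda>(\<eta>, x). pairing (with_W X) \<eta> x) \<in> qbs_hom (qbs_pair (tests (with_W X)) (elts (with_W X))) unit_qbs"
  proof (rule qbs_homI)
    have *: "pairing X (fst \<eta>) (fst x) + snd \<eta> * snd x \<in> {0..1}"
      if "\<eta> \<in> points (tests (with_W X))" "x \<in> points (elts (with_W X))" for \<eta> x
    proof -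
      have "snd \<eta> * snd x \<le> snd \<eta>" "0 \<le> snd \<eta> * snd x"
        using that by (auto simp: test_with_W_iff elts_with_W mult_left_le)
      moreover have "pairing X (fst \<eta>) (fst x) + snd \<eta> \<le> 1" "0 \<le> pairing X (fst \<eta>) (fst x)"
        using that pairing_bounds by (auto simp: test_with_W_iff elts_with_W)
      ultimately show ?thesis by auto
    qed
    then show "(case p of (\<eta>, x) \<Rightarrow> pairing (with_W X) \<eta> x) \<in> points unit_qbs"
      if "p \<in> points (qbs_pair (tests (with_W X)) (elts (with_W X)))" for p
      using that by (cases p) (auto simp del: atLeastAtMost_iff)
    fix \<alpha> assume \<alpha>: "\<alpha> \<in> rand (qbs_pair (tests (with_W X)) (elts (with_W X)))"
    then have "(\<lambda>t. fst (fst (\<alpha> t))) \<in> rand (tests X)" "(\<lambda>t. fst (snd (\<alpha> t))) \<in> rand (elts X)"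
      and [measurable]: "(\<lambda>t. snd (fst (\<alpha> t))) \<in> borel_measurable borel" "(\<lambda>t. snd (snd (\<alpha> t))) \<in> borel_measurable borel"
      by (auto simp: rand_qbs_pair rand_tests_with_W elts_with_W rand_unit_qbs)
    then have [measurable]: "(\<lambda>t. pairing X (fst (fst (\<alpha> t))) (fst (snd (\<alpha> t)))) \<in> borel_measurable borel"
      by (intro pairing_rand)
    have "\<alpha> t \<in> points (qbs_pair (tests (with_W X)) (elts (with_W X)))" for t
      using \<open>is_qbs (elts (with_W X))\<close> \<open>is_qbs (tests (with_W X))\<close> by (intro rand_in_points[OF is_qbs_pair] \<alpha>)
    then show "(\<lambda>r. case \<alpha> r of (\<eta>, x) \<Rightarrow> pairing (with_W X) \<eta> x) \<in> rand unit_qbs"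
      using * by (auto simp: rand_unit_qbs case_prod_beta mem_Times_iff simp del: atLeastAtMost_iff)
  qed
  show "separated (dual (with_W X))"
    unfolding separated_def
  proof (intro ballI impI)
    fix \<eta> \<eta>'
    assume "\<eta> \<in> points (elts (dual (with_W X)))" "\<eta>' \<in> points (elts (dual (with_W X)))"
      and eq: "\<forall>x\<in>points (tests (dual (with_W X))). pairing (dual (with_W X)) x \<eta> = pairing (dual (with_W X)) x \<eta>'"
    then have \<eta>: "\<eta> \<in> points (tests (with_W X))" "\<eta>' \<in> points (tests (with_W X))" by auto
    have eq': "pairing X (fst \<eta>) x + snd \<eta> * r = pairing X (fst \<eta>') x + snd \<eta>' * r"
      if "x \<in> points (elts X)" "r \<in> {0..1}" for x r
      using eq that by (auto simp: elts_with_W dest: bspec[of _ _ "(x, r)"])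
    have "fst \<eta> = fst \<eta>'"
      using \<eta> eq'[of _ 0] by (intro tests_eqI) (auto simp: test_with_W_iff)
    moreover have "snd \<eta> = snd \<eta>'"
      using eq'[of z0 1] z0 \<open>fst \<eta> = fst \<eta>'\<close> by auto
    ultimately show "\<eta> = \<eta>'" by (rule prod_eqI)
  qed
  show "\<exists>\<eta>\<in>points (tests (with_W X)). \<forall>x\<in>points (elts (with_W X)). pairing (with_W X) \<eta> x = 0"
  proof -
    obtain z where "z \<in> points (tests X)" "\<And>x. x \<in> points (elts X) \<Longrightarrow> pairing X z x = 0"
      using zero_test_ex by blast
    then show ?thesis
      by (intro bexI[of _ "(z, 0)"]) (auto simp: test_with_W_iff elts_with_W)
  qed
  show "\<exists>z\<in>points (elts (with_W X)). \<forall>\<eta>\<in>points (tests (with_W X)).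
      pairing (with_W X) \<eta> z = (\<Sum>i\<in>I. w i * pairing (with_W X) \<eta> (x i))"
    if I: "finite I" and wx: "\<And>i. i \<in> I \<Longrightarrow> 0 \<le> w i \<and> x i \<in> points (elts (with_W X))" and le: "sum w I \<le> 1"
    for I :: "nat set" and w x
  proof -
    obtain z where z: "z \<in> points (elts X)"
      "\<And>\<eta>. \<eta> \<in> points (tests X) \<Longrightarrow> pairing X \<eta> z = (\<Sum>i\<in>I. w i * pairing X \<eta> (fst (x i)))"
      using convex_comb_ex[OF I _ le, of "\<lambda>i. fst (x i)"] wx by (auto simp: elts_with_W mem_Times_iff)
    have "(\<Sum>i\<in>I. w i * snd (x i)) \<le> sum w I" "0 \<le> (\<Sum>i\<in>I. w i * snd (x i))"
      using wx by (auto simp: elts_with_W mem_Times_iff mult_left_le intro!: sum_mono sum_nonneg)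
    with le z show ?thesis
      by (intro bexI[of _ "(z, \<Sum>i\<in>I. w i * snd (x i))"])
        (auto simp: elts_with_W test_with_W_iff algebra_simps sum_distrib_left sum.distrib)
  qed
  show "has_sums (dual (with_W X))"
  proof -
    obtain S where S: "S \<in> qbs_hom (summable_seqs (dual X)) (tests X)"
      and S_eq: "\<And>\<eta> x. \<eta> \<in> points (summable_seqs (dual X)) \<Longrightarrow> x \<in> points (elts X) \<Longrightarrow>
        ennreal (pairing X (S \<eta>) x) = (\<Sum>n. ennreal (pairing X (\<eta> n) x))"
      using tests_sums unfolding has_sums_def by auto
    \<comment> \<open>The second component is a series of reals. It converges because evaluation at
      \<open>(z0, 1)\<close>, where the first components vanish, bounds it by 1.\<close>
    define S' where "S' q = (S (\<lambda>n. fst (q n)), \<Sum>n. snd (q n))" for q :: "nat \<Rightarrow> 'b \<times> real"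
    let ?D = "points (summable_seqs (dual (with_W X)))"
    have q_in: "q n \<in> points (tests (with_W X))" if "q \<in> ?D" for q n
      using that by (auto simp: summable_seqs_def PiE_iff)
    have sum_le: "(\<Sum>n. ennreal (pairing X (fst (q n)) x + snd (q n) * r)) \<le> 1"
      if "q \<in> ?D" "x \<in> points (elts X)" "r \<in> {0..1}" for q x r
      using that by (auto simp: summable_seqs_def elts_with_W)
    have fst_q: "(\<lambda>n. fst (q n)) \<in> points (summable_seqs (dual X))" if "q \<in> ?D" for q
    proof -
      have "fst (q n) \<in> points (tests X)" for n
        using q_in[OF that] by (simp add: test_with_W_iff)
      then show ?thesis
        using sum_le[OF that, of _ 0] by (simp add: summable_seqs_def PiE_iff)
    qed
    have snd_q: "(\<Sum>n. ennreal (snd (q n))) \<le> 1" if "q \<in> ?D" for q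
    proof -
      have "pairing X (fst (q n)) z0 = 0" for n
        using q_in[OF that] z0(2) by (simp add: test_with_W_iff)
      then show ?thesis
        using sum_le[OF that z0(1), of 1] by simp
    qed
    have snd_pos: "0 \<le> snd (q n)" if "q \<in> ?D" for q n
      using q_in[OF that] by (auto simp: test_with_W_iff)
    have sm: "summable (\<lambda>n. snd (q n))" if "q \<in> ?D" for q
      using snd_q[OF that] snd_pos[OF that] by (intro summable_suminf_not_top) (auto simp: top_unique)
    have S'_eq: "ennreal (pairing (with_W X) (S' q) x) = (\<Sum>n. ennreal (pairing (with_W X) (q n) x))"
      if "q \<in> ?D" "x \<in> points (elts (with_W X))" for q x
    proof -
      have x: "fst x \<in> points (elts X)" "0 \<le> snd x" "snd x \<le> 1"
        using that(2) by (auto simp: elts_with_W)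
      have f: "fst (q n) \<in> points (tests X)" for n
        using q_in[OF that(1)] by (auto simp: test_with_W_iff)
      have "(\<Sum>n. ennreal (pairing (with_W X) (q n) x))
          = (\<Sum>n. ennreal (pairing X (fst (q n)) (fst x)) + ennreal (snd (q n) * snd x))"
        using snd_pos[OF that(1)] x f pairing_bounds by (intro suminf_cong) (simp add: ennreal_plus)
      also have "\<dots> = (\<Sum>n. ennreal (pairing X (fst (q n)) (fst x))) + (\<Sum>n. ennreal (snd (q n) * snd x))"
        by (rule suminf_add[symmetric]) auto
      also have "(\<Sum>n. ennreal (snd (q n) * snd x)) = ennreal ((\<Sum>n. snd (q n)) * snd x)"
        using sm[OF that(1)] snd_pos[OF that(1)] x
        by (subst suminf_ennreal2) (auto simp: suminf_mult2 summable_mult2)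
      also have "(\<Sum>n. ennreal (pairing X (fst (q n)) (fst x))) = ennreal (pairing X (S (\<lambda>n. fst (q n))) (fst x))"
        using S_eq[OF fst_q[OF that(1)] x(1)] by simp
      finally show ?thesis
        using pairing_bounds[OF qbs_hom_points[OF S fst_q[OF that(1)]] x(1)] x
          suminf_nonneg[OF sm[OF that(1)] snd_pos[OF that(1)]]
        by (simp add: S'_def ennreal_plus)
    qed
    have S'_in: "S' q \<in> points (tests (with_W X))" if q: "q \<in> ?D" for q
    proof -
      have 0: "0 \<le> (\<Sum>n. snd (q n))"
        using suminf_nonneg[OF sm[OF q] snd_pos[OF q]] .
      have le: "pairing X (S (\<lambda>n. fst (q n))) x + (\<Sum>n. snd (q n)) \<le> 1" if x: "x \<in> points (elts X)" for x
      proof -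
        have "(x, 1) \<in> points (elts (with_W X))" using x by (simp add: elts_with_W)
        then have "(\<Sum>n. ennreal (pairing (with_W X) (q n) (x, 1))) \<le> 1"
          using q by (auto simp: summable_seqs_def)
        then have "ennreal (pairing (with_W X) (S' q) (x, 1)) \<le> 1"
          using S'_eq[OF q \<open>(x, 1) \<in> points (elts (with_W X))\<close>] by simp
        then show ?thesis by (simp add: S'_def)
      qed
      \<comment> \<open>At \<open>z0\<close> the first summand of \<open>le\<close> is 0, so the
        second component is at most 1.\<close>
      with 0 z0 le[OF z0(1)] show ?thesis
        using qbs_hom_points[OF S fst_q[OF q]] by (auto simp: test_with_W_iff S'_def)
    qed
    have "S' \<in> qbs_hom (summable_seqs (dual (with_W X))) (elts (dual (with_W X)))"
    proof (rule qbs_homI)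
      fix \<alpha> assume \<alpha>: "\<alpha> \<in> rand (summable_seqs (dual (with_W X)))"
      then have \<alpha>D: "\<alpha> t \<in> ?D" for t
        by (auto simp: summable_seqs_def rand_qbs_sub rand_qbs_prod)
      have \<alpha>n: "(\<lambda>t. \<alpha> t n) \<in> rand (tests (with_W X))" for n
        using \<alpha> by (auto simp: summable_seqs_def rand_qbs_sub rand_qbs_prod)
      have "(\<lambda>t n. fst (\<alpha> t n)) \<in> rand (summable_seqs (dual X))"
        using \<alpha>n fst_q[OF \<alpha>D] by (auto simp: summable_seqs_def rand_qbs_sub rand_qbs_prod rand_tests_with_W)
      then have "(\<lambda>t. S (\<lambda>n. fst (\<alpha> t n))) \<in> rand (tests X)"
        using qbs_homD[OF S, of "\<lambda>t n. fst (\<alpha> t n)"] by simp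
      moreover have "(\<lambda>t. \<Sum>n. snd (\<alpha> t n)) \<in> borel_measurable borel"
        using \<alpha>n by (intro borel_measurable_suminf) (auto simp: rand_tests_with_W rand_unit_qbs)
      ultimately show "(\<lambda>t. S' (\<alpha> t)) \<in> rand (elts (dual (with_W X)))"
        using S'_in[OF \<alpha>D] by (auto simp: rand_tests_with_W rand_unit_qbs S'_def test_with_W_iff)
    qed (use S'_in in auto)
    then show ?thesis
      unfolding has_sums_def using S'_eq by (intro bexI[of _ S']) auto
  qed
qed

end

declare One_nat_def [simp del]

section \<open>Random multilinear forms\<close>

abbreviation tups :: "nat set \<Rightarrow> ('a, 'b) cqbs \<Rightarrow> (nat \<Rightarrow> 'a) qbs" where
  "tups K X \<equiv> qbs_prod K (\<lambda>_. elts X)"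

abbreviation tuple_set :: "nat \<Rightarrow> ('a, 'b) cqbs \<Rightarrow> (nat \<Rightarrow> 'a) set" where
  "tuple_set n X \<equiv> {1..n} \<rightarrow>\<^sub>E points (elts X)"

text \<open>\<open>H r s x\<close> is the adjoint of the form \<open>\<phi> r\<close> in slot
  \<open>k\<close>, at the test \<open>s\<close> of W and the remaining entries \<open>x\<close>.
  Composing with random \<open>\<rho>\<close>, \<open>s\<close> and \<open>\<xi>\<close> expresses
  joint measurability; outside the relevant points \<open>H\<close> is unconstrained, so it need not
  be extensional.\<close>

definition form_adjoint :: "nat \<Rightarrow> ('a, 'b) cqbs \<Rightarrow> (real \<Rightarrow> (nat \<Rightarrow> 'a) \<Rightarrow> real) \<Rightarrow> nat
    \<Rightarrow> (real \<Rightarrow> real \<Rightarrow> (nat \<Rightarrow> 'a) \<Rightarrow> 'b) \<Rightarrow> bool" where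
  "form_adjoint n X \<phi> k H \<longleftrightarrow>
     (\<forall>\<rho>\<in>borel_measurable borel. \<forall>s\<in>rand unit_qbs. \<forall>\<xi>\<in>rand (tups ({1..n} - {k}) X).
        (\<lambda>t. H (\<rho> t) (s t) (\<xi> t)) \<in> rand (tests X)) \<and>
     (\<forall>r. \<forall>s\<in>{0..1}. \<forall>x\<in>tuple_set n X.
        s * \<phi> r x = pairing X (H r s (restrict x ({1..n} - {k}))) (x k))"

text \<open>The elements of \<^term>\<open>rand (tests (tensor n X))\<close>, described by adjoints that are jointly
  measurable in the parameter, so that no unique choice of the adjoint is involved.\<close>

definition random_form :: "nat \<Rightarrow> ('a, 'b) cqbs \<Rightarrow> (real \<Rightarrow> (nat \<Rightarrow> 'a) \<Rightarrow> real) \<Rightarrow> bool" where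
  "random_form n X \<phi> \<longleftrightarrow>
     (\<forall>r. \<phi> r \<in> extensional (tuple_set n X)) \<and>
     (\<forall>r. \<forall>x\<in>tuple_set n X. \<phi> r x \<in> {0..1}) \<and>
     (\<forall>\<rho>\<in>borel_measurable borel. \<forall>\<xi>\<in>rand (tups {1..n} X). (\<lambda>t. \<phi> (\<rho> t) (\<xi> t)) \<in> borel_measurable borel) \<and>
     (\<forall>k\<in>{1..n}. \<exists>H. form_adjoint n X \<phi> k H)"

lemma form_adjointI:
  assumes "\<And>\<rho> s \<xi>. \<rho> \<in> borel_measurable borel \<Longrightarrow> s \<in> rand unit_qbs \<Longrightarrow> \<xi> \<in> rand (tups ({1..n} - {k}) X) \<Longrightarrow>
      (\<lambda>t. H (\<rho> t) (s t) (\<xi> t)) \<in> rand (tests X)"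
    and "\<And>r s x. 0 \<le> s \<Longrightarrow> s \<le> 1 \<Longrightarrow> x \<in> tuple_set n X \<Longrightarrow>
      s * \<phi> r x = pairing X (H r s (restrict x ({1..n} - {k}))) (x k)"
  shows "form_adjoint n X \<phi> k H"
  unfolding form_adjoint_def using assms by simp

lemma form_adjoint_rand:
  "form_adjoint n X \<phi> k H \<Longrightarrow> \<rho> \<in> borel_measurable borel \<Longrightarrow> s \<in> rand unit_qbs \<Longrightarrow> \<xi> \<in> rand (tups ({1..n} - {k}) X) \<Longrightarrow>
      (\<lambda>t. H (\<rho> t) (s t) (\<xi> t)) \<in> rand (tests X)"
  unfolding form_adjoint_def by blast

lemma form_adjoint_eq:
  "form_adjoint n X \<phi> k H \<Longrightarrow> 0 \<le> s \<Longrightarrow> s \<le> 1 \<Longrightarrow> x \<in> tuple_set n X \<Longrightarrow>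
      s * \<phi> r x = pairing X (H r s (restrict x ({1..n} - {k}))) (x k)"
  unfolding form_adjoint_def by (metis atLeastAtMost_iff)

lemma random_formI:
  assumes "\<And>r. \<phi> r \<in> extensional (tuple_set n X)"
    and "\<And>r x. x \<in> tuple_set n X \<Longrightarrow> 0 \<le> \<phi> r x"
    and "\<And>r x. x \<in> tuple_set n X \<Longrightarrow> \<phi> r x \<le> 1"
    and "\<And>\<rho> \<xi>. \<rho> \<in> borel_measurable borel \<Longrightarrow> \<xi> \<in> rand (tups {1..n} X) \<Longrightarrow>
      (\<lambda>t. \<phi> (\<rho> t) (\<xi> t)) \<in> borel_measurable borel"
    and "\<And>k. k \<in> {1..n} \<Longrightarrow> \<exists>H. form_adjoint n X \<phi> k H"
  shows "random_form n X \<phi>"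
  unfolding random_form_def using assms by simp

lemma random_form_ext: "random_form n X \<phi> \<Longrightarrow> \<phi> r \<in> extensional (tuple_set n X)"
  by (simp add: random_form_def)

lemma random_form_bounds:
  assumes "random_form n X \<phi>" "x \<in> tuple_set n X"
  shows "0 \<le> \<phi> r x" "\<phi> r x \<le> 1"
  using assms by (auto simp: random_form_def)

lemma random_form_measurable:
  "random_form n X \<phi> \<Longrightarrow> \<rho> \<in> borel_measurable borel \<Longrightarrow> \<xi> \<in> rand (tups {1..n} X) \<Longrightarrow>
      (\<lambda>t. \<phi> (\<rho> t) (\<xi> t)) \<in> borel_measurable borel"
  by (simp add: random_form_def)

lemma random_form_adjoint: "random_form n X \<phi> \<Longrightarrow> k \<in> {1..n} \<Longrightarrow> \<exists>H. form_adjoint n X \<phi> k H"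
  by (simp add: random_form_def)

section \<open>Tests of tensor powers as random forms\<close>

lemma tests_tensor: "tests (tensor n X) = multilinear_qbs n (\<lambda>_. X) W_cqbs"
  by (simp add: tensor_def multilinear_cqbs_def)

lemma points_tests_tensor: "points (tests (tensor n X)) = multilinear_maps n (\<lambda>_. X) W_cqbs"
  by (simp add: tests_tensor multilinear_qbs_def)

lemma W_simps [simp]: "elts W_cqbs = unit_qbs" "tests W_cqbs = unit_qbs" "pairing W_cqbs s r = s * r"
  by (simp_all add: W_cqbs_def)

lemma points_tups_tuples [simp]: "points (tuples n (\<lambda>_. X)) = tuple_set n X"
  by (simp add: tuples_def)

context tame_cqbs
begin

lemma is_qbs_tups: "is_qbs (tups K X)"
  by (intro is_qbs_prod elts_qbs)

text \<open>The remaining entries can be completed by any \<open>v\<close> in slot \<open>k\<close>,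
  so two adjoints yield tests that agree on every element, and elements separate tests.\<close>

lemma is_adjoint_unique:
  assumes k: "k \<in> {1..n}" and h: "is_adjoint n (\<lambda>_. X) W_cqbs f k h" and h': "is_adjoint n (\<lambda>_. X) W_cqbs f k h'"
  shows "h = h'"
proof (rule extensionalityI)
  let ?A = "adj_dom n (\<lambda>_. X) W_cqbs k"
  show "h \<in> extensional (points ?A)" "h' \<in> extensional (points ?A)"
    using h h' by (auto simp: is_adjoint_def points_qbs_fun)
  fix p assume p: "p \<in> points ?A"
  obtain s x where p_eq: "p = (s, x)" and s: "s \<in> {0..1}" and x: "x \<in> ({1..n} - {k}) \<rightarrow>\<^sub>E points (elts X)"
    using p by (cases p) (auto simp: adj_dom_def)
  have "h p \<in> points (tests X)" "h' p \<in> points (tests X)"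
    using h h' p by (auto simp: is_adjoint_def points_qbs_fun dest: qbs_hom_points)
  moreover have "pairing X (h p) v = pairing X (h' p) v" if v: "v \<in> points (elts X)" for v
  proof -
    have y: "x(k := v) \<in> tuple_set n X" "restrict (x(k := v)) ({1..n} - {k}) = x"
      using x v k by (auto simp: PiE_iff extensional_def fun_eq_iff)
    then show ?thesis
      using h h' s by (auto simp: is_adjoint_def p_eq dest!: bspec[of _ _ "x(k := v)"] bspec[of _ _ s])
  qed
  ultimately show "h p = h' p" by (rule tests_eqI)
qed

lemma adjoint_eqI:
  assumes k: "k \<in> {1..n}" and h: "is_adjoint n (\<lambda>_. X) W_cqbs f k h"
  shows "adjoint n (\<lambda>_. X) W_cqbs f k = h"
  unfolding adjoint_def
  by (rule the_equality[where P = "is_adjoint n (\<lambda>_. X) W_cqbs f k", OF h]) (rule is_adjoint_unique[OF k _ h])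

text \<open>The random structure is defined through the definite description \<open>adjoint\<close>.
  By uniqueness, any jointly measurable family of adjoints, once restricted to its domain, is this
  one.\<close>

lemma rand_tests_tensor_iff: "\<phi> \<in> rand (tests (tensor n X)) \<longleftrightarrow> random_form n X \<phi>"
proof
  assume "\<phi> \<in> rand (tests (tensor n X))"
  then have ml: "\<And>r. \<phi> r \<in> multilinear_maps n (\<lambda>_. X) W_cqbs"
    and f: "\<phi> \<in> rand (qbs_fun (tups {1..n} X) unit_qbs)"
    and a: "\<And>k. k \<in> {1..n} \<Longrightarrow> (\<lambda>r. adjoint n (\<lambda>_. X) W_cqbs (\<phi> r) k)
      \<in> rand (qbs_fun (adj_dom n (\<lambda>_. X) W_cqbs k) (tests X))"
    by (auto simp: tests_tensor multilinear_qbs_def tuples_def)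
  have hom: "\<phi> r \<in> qbs_hom (tups {1..n} X) unit_qbs" "\<phi> r \<in> extensional (tuple_set n X)" for r
    using f by (auto simp: qbs_fun_def)
  show "random_form n X \<phi>"
  proof (rule random_formI)
    show "\<phi> r \<in> extensional (tuple_set n X)" for r by (rule hom)
    show "0 \<le> \<phi> r x" "\<phi> r x \<le> 1" if "x \<in> tuple_set n X" for r x
      using qbs_hom_points[OF hom(1), of x r] that by auto
    show "(\<lambda>t. \<phi> (\<rho> t) (\<xi> t)) \<in> borel_measurable borel"
      if "\<rho> \<in> borel_measurable borel" "\<xi> \<in> rand (tups {1..n} X)" for \<rho> \<xi>
    proof -
      have "(\<lambda>(r, a). \<phi> r a) \<in> qbs_hom (qbs_pair real_qbs (tups {1..n} X)) unit_qbs"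
        using f by (simp add: qbs_fun_def)
      from qbs_homD[OF this, of "\<lambda>t. (\<rho> t, \<xi> t)"] show ?thesis
        using that by (simp add: rand_qbs_pair rand_unit_qbs)
    qed
    fix k assume k: "k \<in> {1..n}"
    have adj: "is_adjoint n (\<lambda>_. X) W_cqbs (\<phi> r) k (adjoint n (\<lambda>_. X) W_cqbs (\<phi> r) k)" for r
    proof -
      obtain h where h: "is_adjoint n (\<lambda>_. X) W_cqbs (\<phi> r) k h"
        using ml[of r] k unfolding multilinear_maps_def by blast
      with adjoint_eqI[OF k h] show ?thesis by simp
    qed
    have "form_adjoint n X \<phi> k (\<lambda>r s x. adjoint n (\<lambda>_. X) W_cqbs (\<phi> r) k (s, x))"
    proof (rule form_adjointI)
      fix \<rho> s :: "real \<Rightarrow> real" and \<xi>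
      assume *: "\<rho> \<in> borel_measurable borel" "s \<in> rand unit_qbs" "\<xi> \<in> rand (tups ({1..n} - {k}) X)"
      have "(\<lambda>(r, p). adjoint n (\<lambda>_. X) W_cqbs (\<phi> r) k p)
          \<in> qbs_hom (qbs_pair real_qbs (adj_dom n (\<lambda>_. X) W_cqbs k)) (tests X)"
        using a[OF k] by (simp add: qbs_fun_def)
      from qbs_homD[OF this, of "\<lambda>t. (\<rho> t, (s t, \<xi> t))"]
      show "(\<lambda>t. adjoint n (\<lambda>_. X) W_cqbs (\<phi> (\<rho> t)) k (s t, \<xi> t)) \<in> rand (tests X)"
        using * by (simp add: rand_qbs_pair adj_dom_def)
    next
      fix r and s :: real and x assume "0 \<le> s" "s \<le> 1" "x \<in> tuple_set n X"
      then show "s * \<phi> r x = pairing X (adjoint n (\<lambda>_. X) W_cqbs (\<phi> r) k (s, restrict x ({1..n} - {k}))) (x k)"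
        using adj[of r] unfolding is_adjoint_def by simp
    qed
    then show "\<exists>H. form_adjoint n X \<phi> k H" by blast
  qed
next
  assume \<phi>: "random_form n X \<phi>"
  have hom: "\<phi> r \<in> qbs_hom (tups {1..n} X) unit_qbs" for r
  proof (rule qbs_homI)
    fix \<alpha> assume \<alpha>: "\<alpha> \<in> rand (tups {1..n} X)"
    then have "\<alpha> t \<in> tuple_set n X" for t
      using rand_in_points[OF is_qbs_tups \<alpha>] by simp
    then show "(\<lambda>t. \<phi> r (\<alpha> t)) \<in> rand unit_qbs"
      using random_form_measurable[OF \<phi> _ \<alpha>, of "\<lambda>_. r"] random_form_bounds[OF \<phi>] by (auto simp: rand_unit_qbs)
  qed (use random_form_bounds[OF \<phi>] in simp)
  have joint: "(\<lambda>(r, a). \<phi> r a) \<in> qbs_hom (qbs_pair real_qbs (tups {1..n} X)) unit_qbs"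
  proof (rule qbs_homI)
    fix \<alpha> assume "\<alpha> \<in> rand (qbs_pair real_qbs (tups {1..n} X))"
    then have *: "(\<lambda>t. fst (\<alpha> t)) \<in> borel_measurable borel" "(\<lambda>t. snd (\<alpha> t)) \<in> rand (tups {1..n} X)"
      by (auto simp: rand_qbs_pair)
    then have "snd (\<alpha> t) \<in> tuple_set n X" for t
      using rand_in_points[OF is_qbs_tups *(2)] by simp
    then show "(\<lambda>t. case \<alpha> t of (r, a) \<Rightarrow> \<phi> r a) \<in> rand unit_qbs"
      using random_form_measurable[OF \<phi> *] random_form_bounds[OF \<phi>] by (auto simp: case_prod_beta' rand_unit_qbs)
  qed (use random_form_bounds[OF \<phi>] in auto)
  have f: "\<phi> \<in> rand (qbs_fun (tups {1..n} X) unit_qbs)"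
    using hom joint random_form_ext[OF \<phi>] by (auto simp: qbs_fun_def)
  have "\<exists>g. g \<in> rand (qbs_fun (adj_dom n (\<lambda>_. X) W_cqbs k) (tests X)) \<and>
      (\<forall>r. is_adjoint n (\<lambda>_. X) W_cqbs (\<phi> r) k (g r))" if k: "k \<in> {1..n}" for k
  proof -
    obtain H where H: "form_adjoint n X \<phi> k H"
      using random_form_adjoint[OF \<phi> k] by blast
    let ?A = "adj_dom n (\<lambda>_. X) W_cqbs k"
    have A: "is_qbs ?A"
      unfolding adj_dom_def by (simp add: is_qbs_pair is_qbs_std is_qbs_tups)
    define g where "g r = restrict (\<lambda>p. H r (fst p) (snd p)) (points ?A)" for r
    have g_joint: "(\<lambda>t. g (\<rho> t) (\<alpha> t)) \<in> rand (tests X)"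
      if "\<rho> \<in> borel_measurable borel" "\<alpha> \<in> rand ?A" for \<rho> \<alpha>
    proof -
      have "(\<lambda>t. g (\<rho> t) (\<alpha> t)) = (\<lambda>t. H (\<rho> t) (fst (\<alpha> t)) (snd (\<alpha> t)))"
        using rand_in_points[OF A that(2)] by (simp add: g_def)
      then show ?thesis
        using form_adjoint_rand[OF H that(1), of "\<lambda>t. fst (\<alpha> t)" "\<lambda>t. snd (\<alpha> t)"] that(2)
        by (simp add: adj_dom_def rand_qbs_pair)
    qed
    have g_pt: "g r p \<in> points (tests X)" if "p \<in> points ?A" for r p
      using rand_in_points[OF tests_qbs g_joint[of "\<lambda>_. r" "\<lambda>_. p"]] const_rand[OF A that] by auto
    have g_hom: "g r \<in> qbs_hom ?A (tests X) \<inter> extensional (points ?A)" for r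
      using g_pt g_joint[of "\<lambda>_. r"] by (auto intro!: qbs_homI simp: g_def)
    have "(\<lambda>(r, p). g r p) \<in> qbs_hom (qbs_pair real_qbs ?A) (tests X)"
    proof (rule qbs_homI)
      fix \<alpha> assume "\<alpha> \<in> rand (qbs_pair real_qbs ?A)"
      then show "(\<lambda>t. case \<alpha> t of (r, p) \<Rightarrow> g r p) \<in> rand (tests X)"
        using g_joint[of "\<lambda>t. fst (\<alpha> t)" "\<lambda>t. snd (\<alpha> t)"] by (simp add: rand_qbs_pair case_prod_beta')
    qed (use g_pt in auto)
    then have "g \<in> rand (qbs_fun ?A (tests X))"
      using g_hom by (auto simp: qbs_fun_def)
    moreover have "is_adjoint n (\<lambda>_. X) W_cqbs (\<phi> r) k (g r)" for r
      unfolding is_adjoint_def points_qbs_fun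
      using g_hom[of r] form_adjoint_eq[OF H] by (simp add: g_def adj_dom_def PiE_iff)
    ultimately show ?thesis by blast
  qed
  then obtain g where g: "\<And>k. k \<in> {1..n} \<Longrightarrow> g k \<in> rand (qbs_fun (adj_dom n (\<lambda>_. X) W_cqbs k) (tests X))"
    "\<And>k r. k \<in> {1..n} \<Longrightarrow> is_adjoint n (\<lambda>_. X) W_cqbs (\<phi> r) k (g k r)"
    by metis
  have "adjoint n (\<lambda>_. X) W_cqbs (\<phi> r) k = g k r" if k: "k \<in> {1..n}" for k r
    by (rule adjoint_eqI[OF k g(2)[OF k]])
  then have "(\<lambda>r. adjoint n (\<lambda>_. X) W_cqbs (\<phi> r) k) \<in> rand (qbs_fun (adj_dom n (\<lambda>_. X) W_cqbs k) (tests X))"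
    if "k \<in> {1..n}" for k
    using g(1)[OF that] that by simp
  moreover have "\<phi> r \<in> multilinear_maps n (\<lambda>_. X) W_cqbs" for r
  proof -
    have "\<forall>k\<in>{1..n}. \<exists>h. is_adjoint n (\<lambda>_. X) W_cqbs (\<phi> r) k h"
      using g(2) by blast
    then show ?thesis
      using hom[of r] random_form_ext[OF \<phi>, of r]
      by (simp add: multilinear_maps_def points_qbs_fun tuples_def)
  qed
  ultimately show "\<phi> \<in> rand (tests (tensor n X))"
    using f by (auto simp: tests_tensor multilinear_qbs_def tuples_def)
qed

lemma points_tests_tensor_iff: "f \<in> points (tests (tensor n X)) \<longleftrightarrow> random_form n X (\<lambda>_. f)"
proof
  assume f: "f \<in> points (tests (tensor n X))"
  then have ml: "f \<in> multilinear_maps n (\<lambda>_. X) W_cqbs"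
    by (simp add: points_tests_tensor)
  then have f_fun: "f \<in> qbs_hom (tups {1..n} X) unit_qbs \<inter> extensional (tuple_set n X)"
    by (auto simp: multilinear_maps_def points_qbs_fun tuples_def)
  show "random_form n X (\<lambda>_. f)"
  proof (rule random_formI)
    show "f \<in> extensional (tuple_set n X)" using f_fun by simp
    show "0 \<le> f x" "f x \<le> 1" if "x \<in> tuple_set n X" for x
      using qbs_hom_points[of f "tups {1..n} X" unit_qbs x] f_fun that by auto
    show "(\<lambda>t. f (\<xi> t)) \<in> borel_measurable borel" if "\<xi> \<in> rand (tups {1..n} X)" for \<xi>
      using qbs_homD[of f "tups {1..n} X" unit_qbs \<xi>] f_fun that by (auto simp: rand_unit_qbs)
    fix k assume "k \<in> {1..n}"
    then obtain h where h: "is_adjoint n (\<lambda>_. X) W_cqbs f k h"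
      using ml unfolding multilinear_maps_def by blast
    have "form_adjoint n X (\<lambda>_. f) k (\<lambda>_ s x. h (s, x))"
    proof (rule form_adjointI)
      fix s \<xi> assume "s \<in> rand unit_qbs" "\<xi> \<in> rand (tups ({1..n} - {k}) X)"
      then show "(\<lambda>t. h (s t, \<xi> t)) \<in> rand (tests X)"
        using h qbs_homD[of h "adj_dom n (\<lambda>_. X) W_cqbs k" "tests X" "\<lambda>t. (s t, \<xi> t)"]
        by (simp add: is_adjoint_def points_qbs_fun adj_dom_def rand_qbs_pair)
    next
      fix s :: real and x assume "0 \<le> s" "s \<le> 1" "x \<in> tuple_set n X"
      then show "s * f x = pairing X (h (s, restrict x ({1..n} - {k}))) (x k)"
        using h unfolding is_adjoint_def by simp
    qed
    then show "\<exists>H. form_adjoint n X (\<lambda>_. f) k H" by blast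
  qed
next
  assume "random_form n X (\<lambda>_. f)"
  then have "(\<lambda>_. f) \<in> rand (tests (tensor n X))" by (simp add: rand_tests_tensor_iff)
  then show "f \<in> points (tests (tensor n X))"
    by (auto simp: tests_tensor multilinear_qbs_def)
qed

lemma random_form_test: "random_form n X \<phi> \<Longrightarrow> \<phi> r \<in> points (tests (tensor n X))"
  by (auto simp: rand_tests_tensor_iff[symmetric] tests_tensor multilinear_qbs_def)

text \<open>Adjoints are added by the operator of \<open>tests_finite_sum\<close>. The bound it asks
  for holds because, with \<open>v\<close> put into slot \<open>k\<close>, the sum of the pairings
  is \<open>s\<close> times the sum of the forms.\<close>

lemma random_form_sum:
  fixes I :: "'i set"
  assumes I: "finite I" and \<phi>: "\<And>i. i \<in> I \<Longrightarrow> random_form n X (\<phi> i)"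
    and le: "\<And>r x. x \<in> tuple_set n X \<Longrightarrow> (\<Sum>i\<in>I. \<phi> i r x) \<le> 1"
  shows "random_form n X (\<lambda>r. \<lambda>x\<in>tuple_set n X. \<Sum>i\<in>I. \<phi> i r x)"
proof (rule random_formI)
  have nn: "0 \<le> \<phi> i r x" if "i \<in> I" "x \<in> tuple_set n X" for i r x
    using random_form_bounds(1)[OF \<phi>[OF that(1)] that(2)] .
  show "0 \<le> (\<lambda>x\<in>tuple_set n X. \<Sum>i\<in>I. \<phi> i r x) x" "(\<lambda>x\<in>tuple_set n X. \<Sum>i\<in>I. \<phi> i r x) x \<le> 1"
    if "x \<in> tuple_set n X" for r x
    using that le nn by (simp_all add: sum_nonneg)
  show "(\<lambda>t. (\<lambda>x\<in>tuple_set n X. \<Sum>i\<in>I. \<phi> i (\<rho> t) x) (\<xi> t)) \<in> borel_measurable borel"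
    if "\<rho> \<in> borel_measurable borel" "\<xi> \<in> rand (tups {1..n} X)" for \<rho> \<xi>
    using rand_in_points[OF is_qbs_tups that(2)] random_form_measurable[OF \<phi> that] by simp
  fix k assume k: "k \<in> {1..n}"
  obtain H where H: "\<And>i. i \<in> I \<Longrightarrow> form_adjoint n X (\<phi> i) k (H i)"
    using random_form_adjoint[OF \<phi> k] by metis
  have H_pt: "H i r s x \<in> points (tests X)"
    if "i \<in> I" "0 \<le> s" "s \<le> 1" "x \<in> points (tups ({1..n} - {k}) X)" for i r s x
    using rand_in_points[OF tests_qbs form_adjoint_rand[OF H[OF that(1)], of "\<lambda>_. r" "\<lambda>_. s" "\<lambda>_. x"]] that(2,3)
      const_rand[OF is_qbs_tups that(4)] by (simp add: rand_unit_qbs image_subset_iff)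
  have H_le: "(\<Sum>i\<in>I. pairing X (H i r s x) v) \<le> 1"
    if s: "0 \<le> s" "s \<le> 1" and x: "x \<in> points (tups ({1..n} - {k}) X)" and v: "v \<in> points (elts X)" for r s x v
  proof -
    have y: "x(k := v) \<in> tuple_set n X" "restrict (x(k := v)) ({1..n} - {k}) = x"
      using x v k by (auto simp: PiE_iff extensional_def fun_eq_iff)
    have "(\<Sum>i\<in>I. pairing X (H i r s x) v) = s * (\<Sum>i\<in>I. \<phi> i r (x(k := v)))"
      unfolding sum_distrib_left using form_adjoint_eq[OF H s y(1)] y(2) by (intro sum.cong) simp_all
    also have "\<dots> \<le> 1"
      using s le[OF y(1)] nn[OF _ y(1)] by (intro mult_le_one) (simp_all add: sum_nonneg)
    finally show ?thesis .
  qed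
  obtain Sum where Sum:
    "\<And>\<eta>. (\<And>i. i \<in> I \<Longrightarrow> \<eta> i \<in> points (tests X)) \<Longrightarrow>
        (\<And>x. x \<in> points (elts X) \<Longrightarrow> (\<Sum>i\<in>I. pairing X (\<eta> i) x) \<le> 1) \<Longrightarrow>
        Sum \<eta> \<in> points (tests X) \<and> (\<forall>x\<in>points (elts X). pairing X (Sum \<eta>) x = (\<Sum>i\<in>I. pairing X (\<eta> i) x))"
    "\<And>\<alpha>. (\<And>i. i \<in> I \<Longrightarrow> (\<lambda>t. \<alpha> t i) \<in> rand (tests X)) \<Longrightarrow>
        (\<And>t x. x \<in> points (elts X) \<Longrightarrow> (\<Sum>i\<in>I. pairing X (\<alpha> t i) x) \<le> 1) \<Longrightarrow>
        (\<lambda>t. Sum (\<alpha> t)) \<in> rand (tests X)"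
    using tests_finite_sum[OF I] by blast
  have "form_adjoint n X (\<lambda>r. \<lambda>x\<in>tuple_set n X. \<Sum>i\<in>I. \<phi> i r x) k (\<lambda>r s x. Sum (\<lambda>i. H i r s x))"
  proof (rule form_adjointI)
    fix \<rho> s :: "real \<Rightarrow> real" and \<xi>
    assume *: "\<rho> \<in> borel_measurable borel" "s \<in> rand unit_qbs" "\<xi> \<in> rand (tups ({1..n} - {k}) X)"
    have s: "0 \<le> s t" "s t \<le> 1" for t
      using *(2) by (simp_all add: rand_unit_qbs image_subset_iff)
    show "(\<lambda>t. Sum (\<lambda>i. H i (\<rho> t) (s t) (\<xi> t))) \<in> rand (tests X)"
      by (intro Sum(2) form_adjoint_rand[OF H] * H_le s rand_in_points[OF is_qbs_tups *(3)])
  next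
    fix r and s :: real and x assume s: "0 \<le> s" "s \<le> 1" and x: "x \<in> tuple_set n X"
    let ?x = "restrict x ({1..n} - {k})"
    have rx: "?x \<in> points (tups ({1..n} - {k}) X)" and xk: "x k \<in> points (elts X)"
      using x k by (auto simp: PiE_iff)
    have "s * (\<Sum>i\<in>I. \<phi> i r x) = (\<Sum>i\<in>I. pairing X (H i r s ?x) (x k))"
      unfolding sum_distrib_left using form_adjoint_eq[OF H s x] by (intro sum.cong) simp_all
    also have "\<dots> = pairing X (Sum (\<lambda>i. H i r s ?x)) (x k)"
      using Sum(1)[of "\<lambda>i. H i r s ?x", OF H_pt[OF _ s rx] H_le[OF s rx]] xk by simp
    finally show "s * (\<lambda>x\<in>tuple_set n X. \<Sum>i\<in>I. \<phi> i r x) x = pairing X (Sum (\<lambda>i. H i r s ?x)) (x k)"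
      using x by simp
  qed
  then show "\<exists>H. form_adjoint n X (\<lambda>r. \<lambda>x\<in>tuple_set n X. \<Sum>i\<in>I. \<phi> i r x) k H" by blast
qed auto

end

subsection \<open>Substitution\<close>

lemma rand_unit_mult: "\<alpha> \<in> rand unit_qbs \<Longrightarrow> \<beta> \<in> rand unit_qbs \<Longrightarrow> (\<lambda>t. \<alpha> t * \<beta> t) \<in> rand unit_qbs"
  by (auto simp: rand_unit_qbs image_subset_iff intro!: mult_le_one)

definition linear_pair :: "('a, 'b) cqbs \<Rightarrow> ('c, 'd) cqbs \<Rightarrow> ('a \<Rightarrow> 'c) \<Rightarrow> ('d \<Rightarrow> 'b) \<Rightarrow> bool" where
  "linear_pair X Y f h \<longleftrightarrow> f \<in> qbs_hom (elts X) (elts Y) \<and> h \<in> qbs_hom (tests Y) (tests X) \<and>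
     (\<forall>x\<in>points (elts X). \<forall>\<eta>\<in>points (tests Y). pairing Y \<eta> (f x) = pairing X (h \<eta>) x)"

text \<open>The substitution behind all the linear maps between tensor powers: slot \<open>l \<in> L\<close> of the target
  receives the image under \<open>\<iota>\<close> of the entry \<open>u l\<close>, every other slot a constant, and every entry that is
  not used in this way contributes a scalar factor through the linear form \<open>lam\<close>.\<close>

definition subst_tuple :: "nat \<Rightarrow> nat set \<Rightarrow> (nat \<Rightarrow> nat) \<Rightarrow> ('a \<Rightarrow> 'c) \<Rightarrow> (nat \<Rightarrow> 'c) \<Rightarrow> (nat \<Rightarrow> 'a) \<Rightarrow> nat \<Rightarrow> 'c" where
  "subst_tuple m L u \<iota> d x = (\<lambda>l\<in>{1..m}. if l \<in> L then \<iota> (x (u l)) else d l)"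

definition subst_coeff :: "nat \<Rightarrow> nat set \<Rightarrow> (nat \<Rightarrow> nat) \<Rightarrow> ('a \<Rightarrow> real) \<Rightarrow> real \<Rightarrow> (nat \<Rightarrow> 'a) \<Rightarrow> real" where
  "subst_coeff n L u lam c x = c * (\<Prod>i\<in>{1..n} - u ` L. lam (x i))"

text \<open>The hypothesis on \<open>lam\<close> is conditional so that substitutions without
  left-over entries, such as permutations and insertions, need not supply a linear form.\<close>

locale tensor_subst = src: tame_cqbs X + tgt: tame_cqbs X'
  for X :: "('a, 'b) cqbs" and X' :: "('c, 'd) cqbs" +
  fixes n m :: nat and L u \<iota> \<iota>' and d :: "nat \<Rightarrow> 'c" and lam :: "'a \<Rightarrow> real" and lam' :: "real \<Rightarrow> 'b" and c :: real
  assumes L: "L \<subseteq> {1..m}" and u: "inj_on u L" "u ` L \<subseteq> {1..n}"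
    and d: "\<And>l. l \<in> {1..m} - L \<Longrightarrow> d l \<in> points (elts X')"
    and \<iota>: "linear_pair X X' \<iota> \<iota>'"
    and lam: "{1..n} - u ` L \<noteq> {} \<Longrightarrow> linear_pair X W_cqbs lam lam'"
    and c: "0 \<le> c" "c \<le> 1"
begin

lemma subst_tuple_rand:
  assumes \<xi>: "\<And>i. i \<in> u ` L \<Longrightarrow> (\<lambda>t. \<xi> t i) \<in> rand (elts X)"
  shows "(\<lambda>t. subst_tuple m L u \<iota> d (\<xi> t)) \<in> rand (tups {1..m} X')"
proof -
  have \<iota>h: "\<iota> \<in> qbs_hom (elts X) (elts X')"
    using \<iota> by (simp add: linear_pair_def)
  have *: "(\<lambda>t. subst_tuple m L u \<iota> d (\<xi> t) l) \<in> rand (elts X')" if l: "l \<in> {1..m}" for l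
  proof (cases "l \<in> L")
    case True
    then show ?thesis
      using l qbs_homD[OF \<iota>h \<xi>[of "u l"]] by (simp add: subst_tuple_def)
  next
    case False
    then show ?thesis
      using l d const_rand[OF tgt.elts_qbs] by (simp add: subst_tuple_def)
  qed
  have "subst_tuple m L u \<iota> d (\<xi> t) l \<in> points (elts X')" if "l \<in> {1..m}" for l t
    by (rule rand_in_points[OF tgt.elts_qbs *[OF that]])
  with * show ?thesis
    unfolding rand_qbs_prod by (auto simp: PiE_iff subst_tuple_def)
qed

lemma subst_tuple_in:
  assumes "\<And>i. i \<in> u ` L \<Longrightarrow> x i \<in> points (elts X)"
  shows "subst_tuple m L u \<iota> d x \<in> tuple_set m X'"
  using rand_in_points[OF tgt.is_qbs_tups subst_tuple_rand[of "\<lambda>_. x"]] assms const_rand[OF src.elts_qbs]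
  by simp

lemma lam_rand:
  assumes "i \<in> {1..n} - u ` L" "\<alpha> \<in> rand (elts X)"
  shows "(\<lambda>t. lam (\<alpha> t)) \<in> rand unit_qbs"
proof -
  have "lam \<in> qbs_hom (elts X) unit_qbs"
    using lam assms(1) by (force simp: linear_pair_def)
  from qbs_homD[OF this assms(2)] show ?thesis .
qed

lemma lam_prod_rand:
  assumes "S \<subseteq> {1..n} - u ` L" "\<And>i. i \<in> S \<Longrightarrow> (\<lambda>t. \<xi> t i) \<in> rand (elts X)" "s \<in> rand unit_qbs"
  shows "(\<lambda>t. s t * (c * (\<Prod>i\<in>S. lam (\<xi> t i)))) \<in> rand unit_qbs"
proof -
  have r: "(\<lambda>t. lam (\<xi> t i)) \<in> rand unit_qbs" if "i \<in> S" for i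
    using lam_rand[of i "\<lambda>t. \<xi> t i"] assms that by blast
  have "(\<lambda>t. s t * (c * (\<Prod>i\<in>S. lam (\<xi> t i)))) \<in> borel_measurable borel"
    using assms(3) r by (auto simp: rand_unit_qbs intro!: borel_measurable_times borel_measurable_prod)
  moreover have "0 \<le> (\<Prod>i\<in>S. lam (\<xi> t i))" "(\<Prod>i\<in>S. lam (\<xi> t i)) \<le> 1" for t
    using r by (auto simp: rand_unit_qbs image_subset_iff intro!: prod_nonneg prod_le_1)
  ultimately show ?thesis
    using assms(3) c by (auto simp: rand_unit_qbs image_subset_iff intro!: mult_le_one)
qed

lemma subst_coeff_rand:
  assumes "\<And>i. i \<in> {1..n} \<Longrightarrow> (\<lambda>t. \<xi> t i) \<in> rand (elts X)" "s \<in> rand unit_qbs"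
  shows "(\<lambda>t. s t * subst_coeff n L u lam c (\<xi> t)) \<in> rand unit_qbs"
  unfolding subst_coeff_def using assms by (intro lam_prod_rand) auto

lemma subst_coeff_bounds:
  assumes "x \<in> tuple_set n X"
  shows "0 \<le> subst_coeff n L u lam c x" "subst_coeff n L u lam c x \<le> 1"
  using subst_coeff_rand[of "\<lambda>_. x" "\<lambda>_. 1"] assms const_rand[OF src.elts_qbs]
  by (auto simp: rand_unit_qbs PiE_iff)

text \<open>The adjoint in slot \<open>k\<close> depends on the role of that entry. If it goes to
  slot \<open>l\<close>, take the adjoint of \<open>\<phi>\<close> in slot \<open>l\<close>, absorb
  the scalar factors into its test and apply \<open>\<iota>'\<close>. If it contributes a scalar,
  apply \<open>lam'\<close> to the product of everything else.\<close>

lemma random_form_subst: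
  assumes \<phi>: "random_form m X' \<phi>"
  shows "random_form n X (\<lambda>r. \<lambda>x\<in>tuple_set n X. subst_coeff n L u lam c x * \<phi> r (subst_tuple m L u \<iota> d x))"
    (is "random_form n X ?\<psi>")
proof (rule random_formI)
  have st: "subst_tuple m L u \<iota> d x \<in> tuple_set m X'" if "x \<in> tuple_set n X" for x
    using that u by (intro subst_tuple_in) auto
  show "0 \<le> ?\<psi> r x" "?\<psi> r x \<le> 1" if "x \<in> tuple_set n X" for r x
    using that subst_coeff_bounds[OF that] random_form_bounds[OF \<phi> st[OF that]] by (auto intro!: mult_le_one)
  show "(\<lambda>t. ?\<psi> (\<rho> t) (\<xi> t)) \<in> borel_measurable borel"
    if \<rho>: "\<rho> \<in> borel_measurable borel" and \<xi>: "\<xi> \<in> rand (tups {1..n} X)" for \<rho> \<xi>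
  proof -
    have \<xi>i: "(\<lambda>t. \<xi> t i) \<in> rand (elts X)" if "i \<in> {1..n}" for i
      using \<xi> that by (simp add: rand_qbs_prod)
    have "(\<lambda>t. subst_coeff n L u lam c (\<xi> t)) \<in> borel_measurable borel"
      using subst_coeff_rand[of \<xi> "\<lambda>_. 1"] \<xi>i by (simp add: rand_unit_qbs)
    moreover have "(\<lambda>t. \<phi> (\<rho> t) (subst_tuple m L u \<iota> d (\<xi> t))) \<in> borel_measurable borel"
      using \<xi>i u by (intro random_form_measurable[OF \<phi> \<rho>] subst_tuple_rand) auto
    ultimately show ?thesis
      using rand_in_points[OF src.is_qbs_tups \<xi>] by simp
  qed
  fix k assume k: "k \<in> {1..n}"
  show "\<exists>H. form_adjoint n X ?\<psi> k H"
  proof (cases "k \<in> u ` L")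
    case True
    then obtain l where l: "l \<in> L" "k = u l" by auto
    have lm: "l \<in> {1..m}" using l L by auto
    obtain H where H: "form_adjoint m X' \<phi> l H"
      using random_form_adjoint[OF \<phi> lm] by blast
    have ul: "u i \<noteq> k" if "i \<in> L" "i \<noteq> l" for i
      using that l u by (auto dest: inj_onD)
    define y where "y x = restrict (subst_tuple m L u \<iota> d x) ({1..m} - {l})" for x
    define C where "C x = c * (\<Prod>i\<in>{1..n} - u ` L. lam (x i))" for x
    \<comment> \<open>The adjoint is given the tuple without entry \<open>k\<close>; neither
      \<open>y\<close> nor \<open>C\<close> reads that entry.\<close>
    have y_restrict: "y (restrict x ({1..n} - {k})) = y x" for x
    proof
      show "y (restrict x ({1..n} - {k})) i = y x i" for i
        using ul[of i] u(2) by (auto simp: y_def subst_tuple_def)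
    qed
    have C_restrict: "C (restrict x ({1..n} - {k})) = C x" for x
      unfolding C_def using True by (intro arg_cong2[of _ _ _ _ "(*)"] prod.cong) auto
    have "form_adjoint n X ?\<psi> k (\<lambda>r s x. \<iota>' (H r (s * C x) (y x)))"
    proof (rule form_adjointI)
      fix \<rho> s :: "real \<Rightarrow> real" and \<xi>
      assume \<rho>: "\<rho> \<in> borel_measurable borel" and s: "s \<in> rand unit_qbs" and \<xi>: "\<xi> \<in> rand (tups ({1..n} - {k}) X)"
      have \<xi>i: "(\<lambda>t. \<xi> t i) \<in> rand (elts X)" if "i \<in> {1..n} - {k}" for i
        using \<xi> that by (simp add: rand_qbs_prod)
      \<comment> \<open>\<open>\<xi>\<close> has no entry \<open>k\<close>, yet
        \<open>subst_tuple\<close> reads it for slot \<open>l\<close>. Any point may be filled in,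
        because \<open>y\<close> drops slot \<open>l\<close>.\<close>
      obtain a where a: "a \<in> points (elts X)"
        using src.zero_elt_ex by blast
      define \<xi>' where "\<xi>' t = (\<xi> t)(k := a)" for t
      have \<xi>'i: "(\<lambda>t. \<xi>' t i) \<in> rand (elts X)" if "i \<in> {1..n}" for i
        using \<xi>i[of i] that const_rand[OF src.elts_qbs a] by (cases "i = k") (auto simp: \<xi>'_def)
      have res: "restrict (\<xi>' t) ({1..n} - {k}) = restrict (\<xi> t) ({1..n} - {k})" for t
        by (auto simp: \<xi>'_def)
      have "(\<lambda>t. subst_tuple m L u \<iota> d (\<xi>' t)) \<in> rand (tups {1..m} X')"
        using u \<xi>'i by (intro subst_tuple_rand) auto
      then have "(\<lambda>t. y (\<xi>' t)) \<in> rand (tups ({1..m} - {l}) X')"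
        by (auto simp: rand_qbs_prod y_def PiE_iff)
      moreover have "y (\<xi>' t) = y (\<xi> t)" for t
        using y_restrict[of "\<xi>' t"] y_restrict[of "\<xi> t"] res by metis
      moreover have "(\<lambda>t. s t * C (\<xi> t)) \<in> rand unit_qbs"
        unfolding C_def using \<xi>i True by (intro lam_prod_rand s) auto
      ultimately have "(\<lambda>t. H (\<rho> t) (s t * C (\<xi> t)) (y (\<xi> t))) \<in> rand (tests X')"
        using form_adjoint_rand[OF H \<rho>, of "\<lambda>t. s t * C (\<xi> t)" "\<lambda>t. y (\<xi> t)"] by simp
      then show "(\<lambda>t. \<iota>' (H (\<rho> t) (s t * C (\<xi> t)) (y (\<xi> t)))) \<in> rand (tests X)"
        using \<iota> qbs_homD[of \<iota>'] unfolding linear_pair_def by blast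
    next
      fix r and s :: real and x assume s: "0 \<le> s" "s \<le> 1" and x: "x \<in> tuple_set n X"
      have xk: "x k \<in> points (elts X)" using x k by auto
      have Cs: "0 \<le> s * C x" "s * C x \<le> 1"
        using subst_coeff_bounds[OF x] s by (auto simp: C_def subst_coeff_def intro!: mult_le_one)
      have yx: "y x \<in> points (tups ({1..m} - {l}) X')"
        using st[OF x] by (auto simp: y_def)
      have "(\<lambda>_. H r (s * C x) (y x)) \<in> rand (tests X')"
        using Cs const_rand[OF tgt.is_qbs_tups yx]
        by (intro form_adjoint_rand[OF H, of "\<lambda>_. r" "\<lambda>_. s * C x" "\<lambda>_. y x"]) (auto simp: rand_unit_qbs)
      from rand_in_points[OF tgt.tests_qbs this]
      have "pairing X' (H r (s * C x) (y x)) (\<iota> (x k)) = pairing X (\<iota>' (H r (s * C x) (y x))) (x k)"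
        using \<iota> xk by (simp add: linear_pair_def)
      moreover have "(s * C x) * \<phi> r (subst_tuple m L u \<iota> d x) = pairing X' (H r (s * C x) (y x)) (\<iota> (x k))"
        using form_adjoint_eq[OF H Cs st[OF x], of r] l lm by (simp add: y_def subst_tuple_def)
      ultimately show "s * ?\<psi> r x = pairing X (\<iota>' (H r (s * C (restrict x ({1..n} - {k}))) (y (restrict x ({1..n} - {k}))))) (x k)"
        using x unfolding C_restrict y_restrict by (simp add: C_def subst_coeff_def mult.assoc)
    qed
    then show ?thesis by blast
  next
    case False
    define S where "S = {1..n} - u ` L - {k}"
    have S: "{1..n} - u ` L = insert k S" "k \<notin> S" "finite S"
      using k False by (auto simp: S_def)
    have lam: "linear_pair X W_cqbs lam lam'"
      using lam S by auto
    define C where "C x = c * (\<Prod>i\<in>S. lam (x i))" for x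
    have C_restrict: "C (restrict x ({1..n} - {k})) = C x" for x
      unfolding C_def by (intro arg_cong2[of _ _ _ _ "(*)"] prod.cong) (auto simp: S_def)
    have y_restrict: "subst_tuple m L u \<iota> d (restrict x ({1..n} - {k})) = subst_tuple m L u \<iota> d x" for x
    proof -
      have "restrict x ({1..n} - {k}) (u l) = x (u l)" if "l \<in> L" for l
        using that False u(2) by auto
      then show ?thesis
        unfolding subst_tuple_def by (intro restrict_ext) auto
    qed
    have "form_adjoint n X ?\<psi> k (\<lambda>r s x. lam' (s * C x * \<phi> r (subst_tuple m L u \<iota> d x)))"
    proof (rule form_adjointI)
      fix \<rho> s :: "real \<Rightarrow> real" and \<xi>
      assume \<rho>: "\<rho> \<in> borel_measurable borel" and s: "s \<in> rand unit_qbs" and \<xi>: "\<xi> \<in> rand (tups ({1..n} - {k}) X)"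
      have \<xi>i: "(\<lambda>t. \<xi> t i) \<in> rand (elts X)" if "i \<in> {1..n} - {k}" for i
        using \<xi> that by (simp add: rand_qbs_prod)
      have y: "(\<lambda>t. subst_tuple m L u \<iota> d (\<xi> t)) \<in> rand (tups {1..m} X')"
        using u(2) False by (intro subst_tuple_rand \<xi>i) blast
      have "(\<lambda>t. s t * C (\<xi> t)) \<in> rand unit_qbs"
        unfolding C_def using \<xi>i by (intro lam_prod_rand s) (auto simp: S_def)
      moreover have "(\<lambda>t. \<phi> (\<rho> t) (subst_tuple m L u \<iota> d (\<xi> t))) \<in> rand unit_qbs"
        using random_form_measurable[OF \<phi> \<rho> y] random_form_bounds[OF \<phi>] rand_in_points[OF tgt.is_qbs_tups y]
        by (auto simp: rand_unit_qbs)
      ultimately have "(\<lambda>t. s t * C (\<xi> t) * \<phi> (\<rho> t) (subst_tuple m L u \<iota> d (\<xi> t))) \<in> rand unit_qbs"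
        by (rule rand_unit_mult)
      then show "(\<lambda>t. lam' (s t * C (\<xi> t) * \<phi> (\<rho> t) (subst_tuple m L u \<iota> d (\<xi> t)))) \<in> rand (tests X)"
        using lam qbs_homD[of lam' unit_qbs "tests X" "\<lambda>t. s t * C (\<xi> t) * \<phi> (\<rho> t) (subst_tuple m L u \<iota> d (\<xi> t))"]
        by (simp add: linear_pair_def)
    next
      fix r and s :: real and x assume s: "0 \<le> s" "s \<le> 1" and x: "x \<in> tuple_set n X"
      let ?v = "s * C x * \<phi> r (subst_tuple m L u \<iota> d x)"
      have xk: "x k \<in> points (elts X)" using x k by auto
      have "(\<lambda>_ :: real. s * C x) \<in> rand unit_qbs"
        unfolding C_def
      proof (rule lam_prod_rand)
        show "(\<lambda>_. x i) \<in> rand (elts X)" if "i \<in> S" for i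
          using that x by (intro const_rand[OF src.elts_qbs]) (auto simp: S_def)
      qed (use s in \<open>auto simp: S_def rand_unit_qbs\<close>)
      moreover have "(\<lambda>_ :: real. \<phi> r (subst_tuple m L u \<iota> d x)) \<in> rand unit_qbs"
        using random_form_bounds[OF \<phi> st[OF x]] by (simp add: rand_unit_qbs)
      ultimately have "(\<lambda>_ :: real. ?v) \<in> rand unit_qbs"
        by (rule rand_unit_mult)
      then have "?v \<in> {0..1}"
        by (simp add: rand_unit_qbs)
      then have "?v * lam (x k) = pairing X (lam' ?v) (x k)"
        using lam xk by (simp add: linear_pair_def)
      then show "s * ?\<psi> r x = pairing X (lam' (s * C (restrict x ({1..n} - {k})) * \<phi> r (subst_tuple m L u \<iota> d (restrict x ({1..n} - {k}))))) (x k)"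
        using x S unfolding C_restrict y_restrict by (simp add: C_def subst_coeff_def S(1) mult_ac)
    qed
    then show ?thesis by blast
  qed
qed auto

end

section \<open>Tensor powers\<close>

abbreviation tensor_base :: "nat \<Rightarrow> ('a, 'b) cqbs \<Rightarrow> ((nat \<Rightarrow> 'a) \<times> real) qbs" where
  "tensor_base n X \<equiv> qbs_pair (tups {1..n} X) unit_qbs"

abbreviation tpre :: "nat \<Rightarrow> ('a, 'b) cqbs \<Rightarrow> ('a, real) pretest qbs" where
  "tpre n X \<equiv> pretests n (\<lambda>_. X) W_cqbs"

abbreviation tclass :: "nat \<Rightarrow> ('a, 'b) cqbs \<Rightarrow> ('a, real) pretest \<Rightarrow> 'a tens" where
  "tclass n X \<theta> \<equiv> pretest_rel n (\<lambda>_. X) W_cqbs `` {\<theta>}"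

lemma points_tpre: "\<theta> \<in> points (tpre n X) \<longleftrightarrow> (\<forall>p. \<theta> p \<in> points (qbs_subprob (tensor_base n X))) \<and>
    (\<forall>f\<in>points (tests (tensor n X)). Test W_cqbs f \<theta> \<le> 1)"
  by (auto simp: pretests_def tuples_def points_tests_tensor PiE_iff)

lemma rand_tpre: "\<alpha> \<in> rand (tpre n X) \<longleftrightarrow>
    (\<forall>p. (\<lambda>r. \<alpha> r p) \<in> rand (qbs_subprob (tensor_base n X))) \<and> (\<forall>r. \<alpha> r \<in> points (tpre n X))"
  by (auto simp: pretests_def tuples_def rand_qbs_sub rand_qbs_prod)

lemma tensor_elt_cases:
  assumes "a \<in> points (elts (tensor n X))"
  obtains \<theta> where "\<theta> \<in> points (tpre n X)" "a = tclass n X \<theta>"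
  using assms by (auto simp: tensor_def multilinear_cqbs_def qbs_quot_def elim: quotientE)

lemma tclass_in: "\<theta> \<in> points (tpre n X) \<Longrightarrow> tclass n X \<theta> \<in> points (elts (tensor n X))"
  by (auto simp: tensor_def multilinear_cqbs_def qbs_quot_def intro: quotientI)

lemma rand_elts_tensor:
  "\<alpha> \<in> rand (elts (tensor n X)) \<longleftrightarrow> (\<exists>\<beta>\<in>rand (tpre n X). \<alpha> = (\<lambda>r. tclass n X (\<beta> r)))"
  by (auto simp: tensor_def multilinear_cqbs_def qbs_quot_def)

lemma tensor_pairing:
  assumes "\<theta> \<in> points (tpre n X)" "f \<in> points (tests (tensor n X))"
  shows "pairing (tensor n X) f (tclass n X \<theta>) = enn2real (Test W_cqbs f \<theta>)"
proof -
  have "Test W_cqbs f ` tclass n X \<theta> = {Test W_cqbs f \<theta>}"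
    using assms by (auto simp: pretest_rel_def points_tests_tensor)
  then show ?thesis by (simp add: tensor_def multilinear_cqbs_def)
qed

text \<open>Pretests have value at most 1 on every form, so nothing is lost in passing to
  reals.\<close>

lemma tensor_pairing_ennreal:
  assumes "\<theta> \<in> points (tpre n X)" "f \<in> points (tests (tensor n X))"
  shows "ennreal (pairing (tensor n X) f (tclass n X \<theta>)) = Test W_cqbs f \<theta>"
  using assms tensor_pairing[OF assms] by (auto simp: points_tpre intro!: ennreal_enn2real)
     (metis ennreal_one_less_top order_le_less_trans)

lemma tclass_eqI:
  assumes "\<theta> \<in> points (tpre n X)" "\<theta>' \<in> points (tpre n X)"
    and "\<And>f. f \<in> points (tests (tensor n X)) \<Longrightarrow> Test W_cqbs f \<theta> = Test W_cqbs f \<theta>'"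
  shows "tclass n X \<theta> = tclass n X \<theta>'"
  using assms by (auto simp: pretest_rel_def points_tests_tensor)

lemma tensor_eqI:
  assumes "a \<in> points (elts (tensor n X))" "b \<in> points (elts (tensor n X))"
    and eq: "\<And>f. f \<in> points (tests (tensor n X)) \<Longrightarrow> pairing (tensor n X) f a = pairing (tensor n X) f b"
  shows "a = b"
proof -
  obtain \<theta> \<theta>' where \<theta>: "\<theta> \<in> points (tpre n X)" "a = tclass n X \<theta>" "\<theta>' \<in> points (tpre n X)" "b = tclass n X \<theta>'"
    using assms(1,2) by (elim tensor_elt_cases)
  then have "Test W_cqbs f \<theta> = Test W_cqbs f \<theta>'" if "f \<in> points (tests (tensor n X))" for f
    using eq[OF that] tensor_pairing_ennreal[OF _ that] by metis
  then show ?thesis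
    using \<theta> tclass_eqI by metis
qed

section \<open>Pure tensors and finite combinations of them\<close>

context tame_cqbs
begin

lemma is_qbs_tensor_base: "is_qbs (tensor_base n X)"
  by (intro is_qbs_pair is_qbs_std is_qbs_tups)

lemma test_bounds:
  assumes "f \<in> points (tests (tensor n X))" "x \<in> tuple_set n X"
  shows "0 \<le> f x" "f x \<le> 1"
  using random_form_bounds[of n X "\<lambda>_. f"] assms by (auto simp: points_tests_tensor_iff)

lemma test_ext: "f \<in> points (tests (tensor n X)) \<Longrightarrow> f \<in> extensional (tuple_set n X)"
  using random_form_ext[of n X "\<lambda>_. f"] by (auto simp: points_tests_tensor_iff)

lemma test_integrand_hom:
  assumes f: "f \<in> points (tests (tensor n X))"
  shows "(\<lambda>(x, s). ennreal (pairing W_cqbs s (f x))) \<in> qbs_hom (tensor_base n X) ennreal_qbs"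
proof (rule qbs_homI)
  fix \<alpha> assume "\<alpha> \<in> rand (tensor_base n X)"
  then have \<alpha>: "(\<lambda>t. fst (\<alpha> t)) \<in> rand (tups {1..n} X)"
    and [measurable]: "(\<lambda>t. snd (\<alpha> t)) \<in> borel_measurable borel"
    by (auto simp: rand_qbs_pair rand_unit_qbs)
  have [measurable]: "(\<lambda>t. f (fst (\<alpha> t))) \<in> borel_measurable borel"
    using f random_form_measurable[of n X "\<lambda>_. f" "\<lambda>_. 0", OF _ _ \<alpha>] by (simp add: points_tests_tensor_iff)
  show "(\<lambda>t. case \<alpha> t of (x, s) \<Rightarrow> ennreal (pairing W_cqbs s (f x))) \<in> rand ennreal_qbs"
    by (simp add: case_prod_beta')
qed auto

text \<open>The combination is represented by a sequence of point masses: the coefficient sits in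
  the W-component of the point, and the sequence continues with points of coefficient 0.\<close>

lemma tensor_finite_comb:
  fixes I :: "'i set"
  assumes I: "finite I" and x: "\<And>i. i \<in> I \<Longrightarrow> x i \<in> tuple_set n X" and c: "\<And>i. i \<in> I \<Longrightarrow> c i \<in> {0..1}"
    and le: "\<And>f. f \<in> points (tests (tensor n X)) \<Longrightarrow> (\<Sum>i\<in>I. c i * f (x i)) \<le> 1"
  obtains a where "a \<in> points (elts (tensor n X))"
    "\<And>f. f \<in> points (tests (tensor n X)) \<Longrightarrow> pairing (tensor n X) f a = (\<Sum>i\<in>I. c i * f (x i))"
proof -
  obtain e where e: "bij_betw e {0..<card I} I"
    using ex_bij_betw_nat_finite[OF I] by blast
  have eI: "e p \<in> I" if "p < card I" for p
    using e that by (auto simp: bij_betw_def)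
  obtain z where z: "z \<in> points (elts X)"
    using zero_elt_ex by blast
  define y where "y p = (if p < card I then (x (e p), c (e p)) else (\<lambda>i\<in>{1..n}. z, 0))" for p
  have y: "y p \<in> points (tensor_base n X)" for p
    using x[OF eI] c[OF eI] z by (auto simp: y_def)
  define \<theta> where "\<theta> p = dirac (tensor_base n X) (y p)" for p
  have Test: "Test W_cqbs f \<theta> = ennreal (\<Sum>i\<in>I. c i * f (x i))" if f: "f \<in> points (tests (tensor n X))" for f
  proof -
    have "Test W_cqbs f \<theta> = (\<Sum>p. ennreal (snd (y p) * f (fst (y p))))"
      unfolding Test_def \<theta>_def using sint_dirac[OF is_qbs_tensor_base y test_integrand_hom[OF f]]
      by (simp add: case_prod_beta)
    also have "\<dots> = (\<Sum>p\<in>{0..<card I}. ennreal (snd (y p) * f (fst (y p))))"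
      by (rule suminf_finite) (auto simp: y_def)
    also have "\<dots> = (\<Sum>p\<in>{0..<card I}. ennreal (c (e p) * f (x (e p))))"
      by (rule sum.cong) (auto simp: y_def)
    also have "\<dots> = (\<Sum>i\<in>I. ennreal (c i * f (x i)))"
      by (rule sum.reindex_bij_betw[OF e])
    also have "\<dots> = ennreal (\<Sum>i\<in>I. c i * f (x i))"
      using test_bounds[OF f x] c by (intro sum_ennreal) auto
    finally show ?thesis .
  qed
  have \<theta>: "\<theta> \<in> points (tpre n X)"
    using Test le y by (simp add: points_tpre \<theta>_def dirac_in[OF is_qbs_tensor_base] ennreal_le_1)
  show thesis
  proof
    show "tclass n X \<theta> \<in> points (elts (tensor n X))" by (rule tclass_in[OF \<theta>])
    show "pairing (tensor n X) f (tclass n X \<theta>) = (\<Sum>i\<in>I. c i * f (x i))" if "f \<in> points (tests (tensor n X))" for f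
      using tensor_pairing[OF \<theta> that] Test[OF that] test_bounds[OF that x] c by (simp add: sum_nonneg)
  qed
qed

lemma tpure_props:
  assumes "x \<in> tuple_set n X"
  shows "tpure n X x \<in> points (elts (tensor n X)) \<and>
    (\<forall>f\<in>points (tests (tensor n X)). pairing (tensor n X) f (tpure n X x) = f x)"
proof -
  obtain a where a: "a \<in> points (elts (tensor n X))"
    "\<And>f. f \<in> points (tests (tensor n X)) \<Longrightarrow> pairing (tensor n X) f a = f x"
    by (rule tensor_finite_comb[of "{()}" "\<lambda>_. x" n "\<lambda>_. 1"]) (use assms test_bounds[OF _ assms] in auto)
  show ?thesis
    unfolding tpure_def
  proof (rule theI[where a = a])
    show "b = a" if "b \<in> points (elts (tensor n X)) \<and> (\<forall>f\<in>points (tests (tensor n X)). pairing (tensor n X) f b = f x)" for b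
      by (rule tensor_eqI[of _ n X]) (use a that in auto)
  qed (use a in blast)
qed

lemma tpure_in: "x \<in> tuple_set n X \<Longrightarrow> tpure n X x \<in> points (elts (tensor n X))"
  using tpure_props by blast

lemma pairing_tpure: "x \<in> tuple_set n X \<Longrightarrow> f \<in> points (tests (tensor n X)) \<Longrightarrow> pairing (tensor n X) f (tpure n X x) = f x"
  using tpure_props by blast

end

text \<open>A linear map out of a tensor power is induced by a finite weighted family of substitutions of
  tuples: it pushes the measures of a representing sequence forward.\<close>

locale tensor_kernel = src: tame_cqbs X + tgt: tame_cqbs X'
  for X :: "('a, 'b) cqbs" and X' :: "('c, 'd) cqbs" +
  fixes n m :: nat and I :: "'i set" and C :: "'i \<Rightarrow> (nat \<Rightarrow> 'a) \<Rightarrow> real" and \<psi> :: "'i \<Rightarrow> (nat \<Rightarrow> 'a) \<Rightarrow> nat \<Rightarrow> 'c"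
  assumes finite_I: "finite I"
    and \<psi>_rand: "\<And>i \<xi>. i \<in> I \<Longrightarrow> \<xi> \<in> rand (tups {1..n} X) \<Longrightarrow> (\<lambda>t. \<psi> i (\<xi> t)) \<in> rand (tups {1..m} X')"
    and C_rand: "\<And>i \<xi> s. i \<in> I \<Longrightarrow> \<xi> \<in> rand (tups {1..n} X) \<Longrightarrow> s \<in> rand unit_qbs \<Longrightarrow>
      (\<lambda>t. s t * C i (\<xi> t)) \<in> rand unit_qbs"
    and form: "\<And>\<phi>. random_form m X' \<phi> \<Longrightarrow> random_form n X (\<lambda>r. \<lambda>x\<in>tuple_set n X. \<Sum>i\<in>I. C i x * \<phi> r (\<psi> i x))"
begin

text \<open>The adjoint, acting on tests, of the linear map to be constructed.\<close>

definition pull :: "((nat \<Rightarrow> 'c) \<Rightarrow> real) \<Rightarrow> (nat \<Rightarrow> 'a) \<Rightarrow> real" where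
  "pull f = (\<lambda>x\<in>tuple_set n X. \<Sum>i\<in>I. C i x * f (\<psi> i x))"

lemma \<psi>_in: "i \<in> I \<Longrightarrow> x \<in> tuple_set n X \<Longrightarrow> \<psi> i x \<in> tuple_set m X'"
  using rand_in_points[OF tgt.is_qbs_tups \<psi>_rand[of i "\<lambda>_. x"]] const_rand[OF src.is_qbs_tups, of x] by simp

lemma C_bounds: "i \<in> I \<Longrightarrow> x \<in> tuple_set n X \<Longrightarrow> 0 \<le> C i x \<and> C i x \<le> 1"
  using C_rand[of i "\<lambda>_. x" "\<lambda>_. 1"] const_rand[OF src.is_qbs_tups, of x] by (auto simp: rand_unit_qbs)

lemma pull_hom: "pull \<in> qbs_hom (tests (tensor m X')) (tests (tensor n X))"
proof (rule qbs_homI)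
  show "pull f \<in> points (tests (tensor n X))" if "f \<in> points (tests (tensor m X'))" for f
    using form[of "\<lambda>_. f"] that by (simp add: src.points_tests_tensor_iff tgt.points_tests_tensor_iff pull_def)
  show "(\<lambda>r. pull (\<alpha> r)) \<in> rand (tests (tensor n X))" if "\<alpha> \<in> rand (tests (tensor m X'))" for \<alpha>
    using form[of \<alpha>] that by (simp add: src.rand_tests_tensor_iff tgt.rand_tests_tensor_iff pull_def)
qed

text \<open>Every measure of a representing sequence is pushed along every member of the family. The
  equation \<open>Test W_cqbs f (\<Theta> \<theta>) = Test W_cqbs (pull f) \<theta>\<close> does
  everything at once: it gives the bound by 1, independence of the representative, and
  \<open>pull\<close> as the adjoint.\<close>

lemma linear_map_ex:
  "\<exists>g\<in>linear_maps (tensor n X) (tensor m X'). \<forall>a\<in>points (elts (tensor n X)). \<forall>f\<in>points (tests (tensor m X')).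
     pairing (tensor m X') f (g a) = pairing (tensor n X) (pull f) a"
proof -
  obtain e where e: "bij_betw e {0..<card I} I"
    using ex_bij_betw_nat_finite[OF finite_I] by blast
  have eI: "e p \<in> I" if "p < card I" for p
    using e that by (auto simp: bij_betw_def)
  obtain z where z: "z \<in> points (elts X')"
    using tgt.zero_elt_ex by blast
  have z0: "(\<lambda>i\<in>{1..m}. z) \<in> points (tups {1..m} X')"
    using z by simp
  let ?A = "tensor_base n X" and ?B = "tensor_base m X'"
  \<comment> \<open>The weight is multiplied into the W-component. Beyond \<open>card I\<close> that
    component is 0, which turns the finite family into a sequence with the same sum.\<close>
  define T where "T q = (\<lambda>p. if q < card I then (\<psi> (e q) (fst p), snd p * C (e q) (fst p)) else (\<lambda>i\<in>{1..m}. z, 0))" for q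
  have T_rand: "(\<lambda>t. T q (\<alpha> t)) \<in> rand ?B" if "\<alpha> \<in> rand ?A" for q \<alpha>
  proof (cases "q < card I")
    case True
    with that show ?thesis
      using \<psi>_rand[OF eI[OF True], of "\<lambda>t. fst (\<alpha> t)"] C_rand[OF eI[OF True], of "\<lambda>t. fst (\<alpha> t)" "\<lambda>t. snd (\<alpha> t)"]
      by (simp add: rand_qbs_pair T_def)
  next
    case False
    then show ?thesis
      using const_rand[OF tgt.is_qbs_tups z0] by (simp add: rand_qbs_pair T_def rand_unit_qbs)
  qed
  have T: "T q \<in> qbs_hom ?A ?B" for q
  proof (rule qbs_homI)
    fix x assume "x \<in> points ?A"
    from rand_in_points[OF tgt.is_qbs_tensor_base T_rand[OF const_rand[OF src.is_qbs_tensor_base this]]]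
    show "T q x \<in> points ?B" by simp
  qed (rule T_rand)
  \<comment> \<open>A pretest is a single sequence, so the measures indexed by pairs are listed
    through \<open>prod_decode\<close>; the order is immaterial for sums in
    \<open>ennreal\<close>.\<close>
  define \<Theta> where "\<Theta> \<theta> = (\<lambda>N. push ?B (T (snd (prod_decode N))) (\<theta> (fst (prod_decode N))))"
    for \<theta> :: "('a, real) pretest"
  have Test: "Test W_cqbs f (\<Theta> \<theta>) = Test W_cqbs (pull f) \<theta>"
    if \<theta>: "\<theta> \<in> points (tpre n X)" and f: "f \<in> points (tests (tensor m X'))" for f \<theta>
  proof -
    let ?F = "\<lambda>(x, s). ennreal (pairing W_cqbs s (f x))"
    have F: "?F \<in> qbs_hom ?B ennreal_qbs" by (rule tgt.test_integrand_hom[OF f])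
    have \<theta>p: "\<theta> p \<in> points (qbs_subprob ?A)" for p
      using \<theta> by (simp add: points_tpre)
    have G: "(\<lambda>(x, s). ennreal (pairing W_cqbs s (pull f x))) \<in> qbs_hom ?A ennreal_qbs"
      by (rule src.test_integrand_hom[OF qbs_hom_points[OF pull_hom f]])
    have sum_T: "(\<Sum>q. ?F (T q xs)) = (\<lambda>(x, s). ennreal (pairing W_cqbs s (pull f x))) xs" if xsA: "xs \<in> points ?A" for xs
    proof -
      obtain x s where xs: "xs = (x, s)" "x \<in> tuple_set n X" "0 \<le> s" "s \<le> 1"
        using xsA by (cases xs) auto
      have "(\<Sum>q. ?F (T q xs)) = (\<Sum>q\<in>{0..<card I}. ?F (T q xs))"
        by (rule suminf_finite) (auto simp: T_def)
      also have "\<dots> = (\<Sum>q\<in>{0..<card I}. ennreal (s * C (e q) x * f (\<psi> (e q) x)))"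
        by (rule sum.cong) (auto simp: T_def xs)
      also have "\<dots> = (\<Sum>i\<in>I. ennreal (s * C i x * f (\<psi> i x)))"
        by (rule sum.reindex_bij_betw[OF e])
      also have "\<dots> = ennreal (\<Sum>i\<in>I. s * C i x * f (\<psi> i x))"
        using xs C_bounds tgt.test_bounds[OF f \<psi>_in] by (intro sum_ennreal) auto
      finally show ?thesis
        using xs by (simp add: pull_def sum_distrib_left mult.assoc)
    qed
    have "Test W_cqbs f (\<Theta> \<theta>) = (\<Sum>N. (\<lambda>(p, q). sint (push ?B (T q) (\<theta> p)) ?F) (prod_decode N))"
      by (simp add: Test_def \<Theta>_def case_prod_beta)
    also have "\<dots> = (\<Sum>p. \<Sum>q. sint (push ?B (T q) (\<theta> p)) ?F)"
      by (rule suminf_ennreal_2dimen) simp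
    also have "\<dots> = (\<Sum>p. \<Sum>q. sint (\<theta> p) (\<lambda>xs. ?F (T q xs)))"
      by (simp only: sint_push[OF \<theta>p T F])
    also have "\<dots> = (\<Sum>p. sint (\<theta> p) (\<lambda>xs. \<Sum>q. ?F (T q xs)))"
      by (intro suminf_cong sint_suminf[OF \<theta>p] qbs_hom_comp[OF F T])
    also have "\<dots> = (\<Sum>p. sint (\<theta> p) (\<lambda>(x, s). ennreal (pairing W_cqbs s (pull f x))))"
      by (intro suminf_cong sint_cong[OF \<theta>p G src.is_qbs_tensor_base, symmetric] sum_T[symmetric])
    finally show ?thesis by (simp only: Test_def)
  qed
  have \<Theta>_in: "\<Theta> \<theta> \<in> points (tpre m X')" if \<theta>: "\<theta> \<in> points (tpre n X)" for \<theta>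
  proof -
    have "\<Theta> \<theta> N \<in> points (qbs_subprob ?B)" for N
      unfolding \<Theta>_def using \<theta> by (intro qbs_hom_points[OF push_hom[OF T]]) (simp add: points_tpre)
    then show ?thesis
      using \<theta> Test[OF \<theta>] qbs_hom_points[OF pull_hom] by (simp add: points_tpre)
  qed
  \<comment> \<open>Again the union over all representatives replaces a choice.\<close>
  define g where "g = (\<lambda>a\<in>points (elts (tensor n X)). \<Union>\<theta>\<in>a. tclass m X' (\<Theta> \<theta>))"
  have g_class: "g (tclass n X \<theta>) = tclass m X' (\<Theta> \<theta>)" if \<theta>: "\<theta> \<in> points (tpre n X)" for \<theta>
  proof -
    have "tclass m X' (\<Theta> \<theta>') = tclass m X' (\<Theta> \<theta>)" if "\<theta>' \<in> tclass n X \<theta>" for \<theta>'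
    proof -
      have \<theta>': "\<theta>' \<in> points (tpre n X)"
        and eq: "\<And>f. f \<in> points (tests (tensor n X)) \<Longrightarrow> Test W_cqbs f \<theta> = Test W_cqbs f \<theta>'"
        using that by (auto simp: pretest_rel_def points_tests_tensor)
      show ?thesis
        by (rule tclass_eqI) (simp_all add: \<Theta>_in \<theta> \<theta>' Test eq qbs_hom_points[OF pull_hom])
    qed
    moreover have "\<theta> \<in> tclass n X \<theta>"
      using \<theta> by (simp add: pretest_rel_def)
    ultimately have "(\<Union>\<theta>'\<in>tclass n X \<theta>. tclass m X' (\<Theta> \<theta>')) = tclass m X' (\<Theta> \<theta>)"
      by (metis (no_types, lifting) SUP_eq_const empty_iff)
    then show ?thesis
      using tclass_in[OF \<theta>] by (simp add: g_def)
  qed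
  have g_in: "g a \<in> points (elts (tensor m X'))" if "a \<in> points (elts (tensor n X))" for a
    using that by (elim tensor_elt_cases) (simp add: g_class tclass_in \<Theta>_in)
  have "(\<lambda>r. g (\<alpha> r)) \<in> rand (elts (tensor m X'))" if "\<alpha> \<in> rand (elts (tensor n X))" for \<alpha>
  proof -
    obtain \<beta> where \<beta>: "\<beta> \<in> rand (tpre n X)" and \<alpha>: "\<alpha> = (\<lambda>r. tclass n X (\<beta> r))"
      using \<open>\<alpha> \<in> rand (elts (tensor n X))\<close> unfolding rand_elts_tensor by blast
    have \<beta>r: "\<beta> r \<in> points (tpre n X)" for r
      using \<beta> by (simp add: rand_tpre)
    have "(\<lambda>r. \<Theta> (\<beta> r) N) \<in> rand (qbs_subprob ?B)" for N
      unfolding \<Theta>_def using \<beta> by (intro qbs_homD[OF push_hom[OF T]]) (simp add: rand_tpre)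
    then have "(\<lambda>r. \<Theta> (\<beta> r)) \<in> rand (tpre m X')"
      by (simp add: rand_tpre \<Theta>_in \<beta>r)
    then show ?thesis
      by (auto simp: rand_elts_tensor \<alpha> g_class \<beta>r)
  qed
  with g_in have "g \<in> qbs_hom (elts (tensor n X)) (elts (tensor m X'))"
    by (intro qbs_homI)
  moreover have "pairing (tensor m X') f (g a) = pairing (tensor n X) (pull f) a"
    if "a \<in> points (elts (tensor n X))" "f \<in> points (tests (tensor m X'))" for a f
    using that(1) by (elim tensor_elt_cases)
      (simp add: g_class tensor_pairing \<Theta>_in that(2) Test qbs_hom_points[OF pull_hom])
  ultimately show ?thesis
    using pull_hom by (intro bexI[of _ g]) (auto simp: linear_maps_def points_qbs_fun g_def)
qed

end

section \<open>Uniqueness of linear maps out of tensor powers\<close>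

text \<open>A test of the tensor power is a function on tuples, and pairing with a pure tensor
  evaluates it at the tuple. Agreement on pure tensors therefore forces the adjoints to coincide,
  and these determine the maps because tests separate tensors.\<close>

lemma linear_map_tensor_unique:
  assumes "tame_cqbs X"
    and g: "g \<in> linear_maps (tensor n X) (tensor m X')" and g': "g' \<in> linear_maps (tensor n X) (tensor m X')"
    and eq: "\<And>x. x \<in> tuple_set n X \<Longrightarrow> g (tpure n X x) = g' (tpure n X x)"
  shows "g = g'"
proof (rule extensionalityI)
  interpret tame_cqbs X by fact
  show "g \<in> extensional (points (elts (tensor n X)))" "g' \<in> extensional (points (elts (tensor n X)))"
    using g g' by (auto simp: linear_maps_def points_qbs_fun)
  obtain h where h: "h \<in> qbs_hom (tests (tensor m X')) (tests (tensor n X))"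
    "\<And>a f. a \<in> points (elts (tensor n X)) \<Longrightarrow> f \<in> points (tests (tensor m X')) \<Longrightarrow>
      pairing (tensor m X') f (g a) = pairing (tensor n X) (h f) a"
    using g by (auto simp: linear_maps_def)
  obtain h' where h': "h' \<in> qbs_hom (tests (tensor m X')) (tests (tensor n X))"
    "\<And>a f. a \<in> points (elts (tensor n X)) \<Longrightarrow> f \<in> points (tests (tensor m X')) \<Longrightarrow>
      pairing (tensor m X') f (g' a) = pairing (tensor n X) (h' f) a"
    using g' by (auto simp: linear_maps_def)
  have hh: "h f = h' f" if f: "f \<in> points (tests (tensor m X'))" for f
  proof (rule extensionalityI)
    show "h f \<in> extensional (tuple_set n X)" "h' f \<in> extensional (tuple_set n X)"
      using qbs_hom_points[OF h(1) f] qbs_hom_points[OF h'(1) f] by (auto intro: test_ext)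
    show "h f x = h' f x" if "x \<in> tuple_set n X" for x
      using h(2)[OF tpure_in[OF that] f] h'(2)[OF tpure_in[OF that] f] eq[OF that]
        pairing_tpure[OF that qbs_hom_points[OF h(1) f]] pairing_tpure[OF that qbs_hom_points[OF h'(1) f]] by simp
  qed
  fix a assume a: "a \<in> points (elts (tensor n X))"
  show "g a = g' a"
  proof (rule tensor_eqI)
    show "g a \<in> points (elts (tensor m X'))" "g' a \<in> points (elts (tensor m X'))"
      using g g' a by (auto simp: linear_maps_def points_qbs_fun dest: qbs_hom_points)
  qed (use h(2) h'(2) a hh in simp)
qed

context tensor_kernel
begin

text \<open>Resolves the definite description in \<open>tlift\<close>; from here on a linear map
  given by its values on pure tensors is handled through \<open>pull\<close> alone.\<close>

lemma tlift_props:
  assumes \<zeta>: "\<And>x. x \<in> tuple_set n X \<Longrightarrow> \<zeta> x \<in> points (elts (tensor m X'))"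
    and \<zeta>_eq: "\<And>x f. x \<in> tuple_set n X \<Longrightarrow> f \<in> points (tests (tensor m X')) \<Longrightarrow>
      pairing (tensor m X') f (\<zeta> x) = (\<Sum>i\<in>I. C i x * f (\<psi> i x))"
    and a: "a \<in> points (elts (tensor n X))"
  shows "tlift n X (tensor m X') \<zeta> a \<in> points (elts (tensor m X')) \<and> (\<forall>f\<in>points (tests (tensor m X')).
     pairing (tensor m X') f (tlift n X (tensor m X') \<zeta> a) = pairing (tensor n X) (pull f) a)"
proof -
  obtain g where g: "g \<in> linear_maps (tensor n X) (tensor m X')"
    and g_eq: "\<And>a f. a \<in> points (elts (tensor n X)) \<Longrightarrow> f \<in> points (tests (tensor m X')) \<Longrightarrow>
      pairing (tensor m X') f (g a) = pairing (tensor n X) (pull f) a"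
    using linear_map_ex by blast
  have g_in: "g a \<in> points (elts (tensor m X'))" if "a \<in> points (elts (tensor n X))" for a
    using g that by (auto simp: linear_maps_def points_qbs_fun dest: qbs_hom_points)
  have g_pure: "g (tpure n X x) = \<zeta> x" if x: "x \<in> tuple_set n X" for x
  proof (rule tensor_eqI[OF g_in[OF src.tpure_in[OF x]] \<zeta>[OF x]])
    fix f assume f: "f \<in> points (tests (tensor m X'))"
    show "pairing (tensor m X') f (g (tpure n X x)) = pairing (tensor m X') f (\<zeta> x)"
      using g_eq[OF src.tpure_in[OF x] f] src.pairing_tpure[OF x qbs_hom_points[OF pull_hom f]] \<zeta>_eq[OF x f] x
      by (simp add: pull_def)
  qed
  have "tlift n X (tensor m X') \<zeta> = g"
    unfolding tlift_def
  proof (rule the_equality)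
    show "g \<in> linear_maps (tensor n X) (tensor m X') \<and> (\<forall>x\<in>points (tuples n (\<lambda>_. X)). g (tpure n X x) = \<zeta> x)"
      using g g_pure by simp
    show "g' = g" if "g' \<in> linear_maps (tensor n X) (tensor m X') \<and>
        (\<forall>x\<in>points (tuples n (\<lambda>_. X)). g' (tpure n X x) = \<zeta> x)" for g'
      using that g g_pure by (intro linear_map_tensor_unique[OF src.tame_cqbs_axioms]) auto
  qed
  then show ?thesis using g_in[OF a] g_eq[OF a] by simp
qed

end

lemma (in tensor_subst) single_kernel:
  "tensor_kernel X X' n m {()} (\<lambda>_. subst_coeff n L u lam c) (\<lambda>_. subst_tuple m L u \<iota> d)"
proof
  fix \<xi> assume \<xi>: "\<xi> \<in> rand (tups {1..n} X)"
  then have \<xi>i: "(\<lambda>t. \<xi> t i) \<in> rand (elts X)" if "i \<in> {1..n}" for i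
    using that by (simp add: rand_qbs_prod)
  show "(\<lambda>t. subst_tuple m L u \<iota> d (\<xi> t)) \<in> rand (tups {1..m} X')"
    using \<xi>i u by (intro subst_tuple_rand) auto
  show "(\<lambda>t. s t * subst_coeff n L u lam c (\<xi> t)) \<in> rand unit_qbs" if "s \<in> rand unit_qbs" for s
    using \<xi>i that by (intro subst_coeff_rand) auto
qed (use random_form_subst in auto)

subsection \<open>Expansion of multilinear forms\<close>

lemma sum_PiE_insert:
  assumes "k \<notin> K"
  shows "(\<Sum>c\<in>insert k K \<rightarrow>\<^sub>E I. g c) = (\<Sum>i\<in>I. \<Sum>c\<in>K \<rightarrow>\<^sub>E I. g (c(k := i)))"
  unfolding PiE_insert_eq
  by (subst sum.reindex[OF inj_combinator[OF assms]])
    (simp add: sum.cartesian_product case_prod_beta)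

context tame_cqbs
begin

text \<open>With the other entries frozen, the adjoint at the scalar 1 is a test of X whose value at
  \<open>y\<close> is \<open>f (x(k := y))\<close>. A linear relation seen by all tests of X thus
  passes to the slot, even if the sum is not formed in X.\<close>

lemma test_slot:
  assumes f: "f \<in> points (tests (tensor n X))" and x: "x \<in> tuple_set n X" and k: "k \<in> {1..n}"
    and z: "z \<in> points (elts X)" and v: "\<And>i. i \<in> I \<Longrightarrow> v i \<in> points (elts X)"
    and eq: "\<And>\<eta>. \<eta> \<in> points (tests X) \<Longrightarrow> pairing X \<eta> z = (\<Sum>i\<in>I. w i * pairing X \<eta> (v i))"
  shows "f (x(k := z)) = (\<Sum>i\<in>I. w i * f (x(k := v i)))"
proof -
  have "random_form n X (\<lambda>_. f)"
    using f by (simp add: points_tests_tensor_iff)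
  then obtain H where H: "form_adjoint n X (\<lambda>_. f) k H"
    using random_form_adjoint k by blast
  let ?x = "restrict x ({1..n} - {k})"
  define \<eta> where "\<eta> = H 0 1 ?x"
  have val: "f (x(k := y)) = pairing X \<eta> y" if "y \<in> points (elts X)" for y
  proof -
    have "x(k := y) \<in> tuple_set n X" "restrict (x(k := y)) ({1..n} - {k}) = ?x"
      using x that k by (auto simp: PiE_iff extensional_def fun_eq_iff)
    then show ?thesis
      using form_adjoint_eq[OF H, of 1 "x(k := y)" 0] by (simp add: \<eta>_def)
  qed
  have "?x \<in> points (tups ({1..n} - {k}) X)"
    using x by auto
  from const_rand[OF is_qbs_tups this] have "(\<lambda>_. \<eta>) \<in> rand (tests X)"
    unfolding \<eta>_def using form_adjoint_rand[OF H, of "\<lambda>_. 0" "\<lambda>_. 1" "\<lambda>_. ?x"] by (simp add: rand_unit_qbs)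
  then have "\<eta> \<in> points (tests X)"
    using rand_in_points[OF tests_qbs] by blast
  from eq[OF this] show ?thesis
    using val z v by simp
qed

text \<open>Multilinear expansion of all slots at once; \<open>c\<close> records which summand each
  slot takes.\<close>

lemma test_expand:
  assumes f: "f \<in> points (tests (tensor n X))" and I: "finite I"
    and y: "\<And>k. k \<in> {1..n} \<Longrightarrow> y k \<in> points (elts X)"
    and v: "\<And>k i. k \<in> {1..n} \<Longrightarrow> i \<in> I \<Longrightarrow> v k i \<in> points (elts X)"
    and eq: "\<And>\<eta> k. \<eta> \<in> points (tests X) \<Longrightarrow> k \<in> {1..n} \<Longrightarrow> pairing X \<eta> (y k) = (\<Sum>i\<in>I. w k i * pairing X \<eta> (v k i))"
  shows "f (\<lambda>k\<in>{1..n}. y k) = (\<Sum>c\<in>{1..n} \<rightarrow>\<^sub>E I. (\<Prod>k\<in>{1..n}. w k (c k)) * f (\<lambda>k\<in>{1..n}. v k (c k)))"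
proof -
  \<comment> \<open>Induction over the set \<open>K\<close> of slots already expanded; the others
    still hold \<open>y k\<close>.\<close>
  have "f (\<lambda>k\<in>{1..n}. y k) = (\<Sum>c\<in>K \<rightarrow>\<^sub>E I. (\<Prod>k\<in>K. w k (c k)) * f (\<lambda>k\<in>{1..n}. if k \<in> K then v k (c k) else y k))"
    if "finite K" "K \<subseteq> {1..n}" for K
    using that
  proof (induction K rule: finite_induct)
    case empty
    then show ?case by simp
  next
    case (insert k K)
    have k: "k \<in> {1..n}" and K: "K \<subseteq> {1..n}"
      using insert by auto
    define x where "x c = (\<lambda>q\<in>{1..n}. if q \<in> K then v q (c q) else y q)" for c
    have x_in: "x c \<in> tuple_set n X" if "c \<in> K \<rightarrow>\<^sub>E I" for c
      using that v y K by (auto simp: x_def PiE_iff)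
    have "f (x c) = (\<Sum>i\<in>I. w k i * f ((x c)(k := v k i)))" if c: "c \<in> K \<rightarrow>\<^sub>E I" for c
    proof -
      have "(x c)(k := y k) = x c"
        using insert.hyps k by (auto simp: x_def)
      then show ?thesis
        using test_slot[OF f x_in[OF c] k y[OF k] v[OF k] eq[OF _ k]] by simp
    qed
    note slot = this
    have "f (\<lambda>k\<in>{1..n}. y k) = (\<Sum>c\<in>K \<rightarrow>\<^sub>E I. (\<Prod>q\<in>K. w q (c q)) * f (x c))"
      unfolding x_def by (rule insert.IH[OF K])
    also have "\<dots> = (\<Sum>c\<in>K \<rightarrow>\<^sub>E I. (\<Prod>q\<in>K. w q (c q)) * (\<Sum>i\<in>I. w k i * f ((x c)(k := v k i))))"
      by (intro sum.cong refl arg_cong2[of _ _ _ _ "(*)"] slot)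
    also have "\<dots> = (\<Sum>i\<in>I. \<Sum>c\<in>K \<rightarrow>\<^sub>E I. (\<Prod>q\<in>K. w q (c q)) * (w k i * f ((x c)(k := v k i))))"
      unfolding sum_distrib_left by (rule sum.swap)
    also have "\<dots> = (\<Sum>i\<in>I. \<Sum>c\<in>K \<rightarrow>\<^sub>E I. (\<Prod>q\<in>insert k K. w q ((c(k := i)) q))
        * f (\<lambda>q\<in>{1..n}. if q \<in> insert k K then v q ((c(k := i)) q) else y q))"
    proof (intro sum.cong refl)
      fix i c
      have "(\<Prod>q\<in>K. w q ((c(k := i)) q)) = (\<Prod>q\<in>K. w q (c q))"
        using insert.hyps by (intro prod.cong) auto
      moreover have "(x c)(k := v k i) = (\<lambda>q\<in>{1..n}. if q \<in> insert k K then v q ((c(k := i)) q) else y q)"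
        using insert.hyps k by (auto simp: x_def)
      ultimately show "(\<Prod>q\<in>K. w q (c q)) * (w k i * f ((x c)(k := v k i))) = (\<Prod>q\<in>insert k K. w q ((c(k := i)) q))
        * f (\<lambda>q\<in>{1..n}. if q \<in> insert k K then v q ((c(k := i)) q) else y q)"
        using insert.hyps by simp
    qed
    finally show ?case
      unfolding sum_PiE_insert[OF insert.hyps(2)] .
  qed
  from this[of "{1..n}"] show ?thesis
    by (simp cong: restrict_cong)
qed

lemma tensor_pairing_sum:
  assumes I: "finite I" and f: "\<And>i. i \<in> I \<Longrightarrow> f i \<in> points (tests (tensor n X))"
    and g: "g \<in> points (tests (tensor n X))" and g_eq: "\<And>x. x \<in> tuple_set n X \<Longrightarrow> g x = (\<Sum>i\<in>I. f i x)"
    and a: "a \<in> points (elts (tensor n X))"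
  shows "pairing (tensor n X) g a = (\<Sum>i\<in>I. pairing (tensor n X) (f i) a)"
proof -
  obtain \<theta> where \<theta>: "\<theta> \<in> points (tpre n X)" and a_eq: "a = tclass n X \<theta>"
    using a by (elim tensor_elt_cases)
  have \<theta>p: "\<theta> p \<in> points (qbs_subprob (tensor_base n X))" for p
    using \<theta> by (simp add: points_tpre)
  let ?F = "\<lambda>f (x, s). ennreal (pairing W_cqbs s (f x))"
  have "sint (\<theta> p) (?F g) = (\<Sum>i\<in>I. sint (\<theta> p) (?F (f i)))" for p
  proof -
    obtain e where e: "bij_betw e {0..<card I} I"
      using ex_bij_betw_nat_finite[OF I] by blast
    have eI: "e q \<in> I" if "q < card I" for q
      using e that by (auto simp: bij_betw_def)
    \<comment> \<open>Continued by zero functions, the finite sum becomes a series and passes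
      through the integral by \<open>sint_suminf\<close>.\<close>
    define G where "G q = (if q < card I then ?F (f (e q)) else (\<lambda>_. 0))" for q
    have G: "G q \<in> qbs_hom (tensor_base n X) ennreal_qbs" for q
      using test_integrand_hom[OF f[OF eI]] by (cases "q < card I") (auto simp: G_def intro: qbs_homI)
    have "(\<Sum>q. G q xs) = ?F g xs" if xs: "xs \<in> points (tensor_base n X)" for xs
    proof -
      obtain x s where xs: "xs = (x, s)" "x \<in> tuple_set n X" "0 \<le> s" "s \<le> 1"
        using xs by (cases xs) auto
      have "(\<Sum>q. G q xs) = (\<Sum>q\<in>{0..<card I}. G q xs)"
        by (rule suminf_finite) (auto simp: G_def)
      also have "\<dots> = (\<Sum>q\<in>{0..<card I}. ennreal (s * f (e q) x))"
        by (rule sum.cong) (auto simp: G_def xs)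
      also have "\<dots> = (\<Sum>i\<in>I. ennreal (s * f i x))"
        by (rule sum.reindex_bij_betw[OF e])
      also have "\<dots> = ennreal (\<Sum>i\<in>I. s * f i x)"
        using xs test_bounds[OF f] by (intro sum_ennreal) auto
      finally show ?thesis
        using xs g_eq by (simp add: sum_distrib_left)
    qed
    then have "sint (\<theta> p) (?F g) = sint (\<theta> p) (\<lambda>xs. \<Sum>q. G q xs)"
      by (intro sint_cong[OF \<theta>p test_integrand_hom[OF g] is_qbs_tensor_base]) simp
    also have "\<dots> = (\<Sum>q. sint (\<theta> p) (G q))"
      by (rule sint_suminf[OF \<theta>p G, symmetric])
    also have "\<dots> = (\<Sum>q\<in>{0..<card I}. sint (\<theta> p) (G q))"
    proof (rule suminf_finite)
      have "sint (\<theta> p) (\<lambda>_. 0) = 0"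
        using \<theta>p[of p]
      proof (elim subprob_cases)
        fix q assume q: "q \<in> points (subprob_reps (tensor_base n X))" "\<theta> p = subprob_rel (tensor_base n X) `` {q}"
        have "(\<lambda>r. case fst q r of None \<Rightarrow> 0 | Some _ \<Rightarrow> 0) = (\<lambda>_. 0 :: ennreal)"
          by (auto split: option.split)
        then show ?thesis
          using q by (simp add: sint_class qbs_homI rep_integral_def case_prod_beta)
      qed
      then show "sint (\<theta> p) (G q) = 0" if "q \<notin> {0..<card I}" for q
        using that by (simp add: G_def)
    qed simp
    also have "\<dots> = (\<Sum>q\<in>{0..<card I}. sint (\<theta> p) (?F (f (e q))))"
      by (rule sum.cong) (auto simp: G_def)
    also have "\<dots> = (\<Sum>i\<in>I. sint (\<theta> p) (?F (f i)))"
      by (rule sum.reindex_bij_betw[OF e])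
    finally show ?thesis .
  qed
  then have "Test W_cqbs g \<theta> = (\<Sum>i\<in>I. Test W_cqbs (f i) \<theta>)"
    unfolding Test_def by (simp add: suminf_sum)
  moreover have "Test W_cqbs (f i) \<theta> \<noteq> \<top>" if "i \<in> I" for i
    using \<theta> f[OF that] by (auto simp: points_tpre top_unique dest!: bspec[of _ _ "f i"])
  ultimately show ?thesis
    using \<theta> f g by (simp add: a_eq tensor_pairing enn2real_sum less_top)
qed

end

subsection \<open>Permutations and symmetric tensors\<close>

lemma linear_pair_id: "linear_pair X X (\<lambda>x. x) (\<lambda>\<eta>. \<eta>)"
  by (auto simp: linear_pair_def intro: qbs_homI)

lemma tuple_perm_in: "\<sigma> permutes {1..n} \<Longrightarrow> x \<in> tuple_set n X \<Longrightarrow> tuple_perm n \<sigma> x \<in> tuple_set n X"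
  by (auto simp: tuple_perm_def permutes_in_image PiE_iff simp del: atLeastAtMost_iff)

lemma tuple_perm_comp: "\<sigma> permutes {1..n} \<Longrightarrow> tuple_perm n \<sigma> (tuple_perm n \<tau> x) = tuple_perm n (\<tau> \<circ> \<sigma>) x"
  by (auto simp: tuple_perm_def permutes_in_image fun_eq_iff simp del: atLeastAtMost_iff)

definition perm_test :: "nat \<Rightarrow> ('a, 'b) cqbs \<Rightarrow> (nat \<Rightarrow> nat) \<Rightarrow> ((nat \<Rightarrow> 'a) \<Rightarrow> real) \<Rightarrow> (nat \<Rightarrow> 'a) \<Rightarrow> real" where
  "perm_test n X \<sigma> f = (\<lambda>x\<in>tuple_set n X. f (tuple_perm n \<sigma> x))"

abbreviation symmetric_tests :: "nat \<Rightarrow> ('a, 'b) cqbs \<Rightarrow> ((nat \<Rightarrow> 'a) \<Rightarrow> real) set" where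
  "symmetric_tests n X \<equiv> points (tests (stensor n X))"

lemma symmetric_tests_iff: "f \<in> symmetric_tests n X \<longleftrightarrow> f \<in> points (tests (tensor n X)) \<and>
    (\<forall>\<sigma>. \<sigma> permutes {1..n} \<longrightarrow> (\<forall>x\<in>tuple_set n X. f (tuple_perm n \<sigma> x) = f x))"
  by (simp add: stensor_def)

lemma pairing_stensor [simp]: "pairing (stensor n X) = pairing (tensor n X)"
  by (simp add: stensor_def)

context tame_cqbs
begin

lemma perm_subst:
  assumes "\<sigma> permutes {1..n}" "0 \<le> c" "c \<le> 1"
  shows "tensor_subst X X n n {1..n} \<sigma> (\<lambda>x. x) (\<lambda>\<eta>. \<eta>) d lam lam' c"
  using assms linear_pair_id by unfold_locales (auto simp: permutes_inj_on permutes_image)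

lemma perm_subst_simps:
  assumes "\<sigma> permutes {1..n}"
  shows "subst_tuple n {1..n} \<sigma> (\<lambda>x. x) d = tuple_perm n \<sigma>" "subst_coeff n {1..n} \<sigma> lam c = (\<lambda>_. c)"
  using assms by (auto simp: fun_eq_iff subst_tuple_def tuple_perm_def subst_coeff_def permutes_image)

lemma scaled_perm_test:
  assumes \<sigma>: "\<sigma> permutes {1..n}" and c: "0 \<le> c" "c \<le> 1" and f: "f \<in> points (tests (tensor n X))"
  shows "(\<lambda>x\<in>tuple_set n X. c * f (tuple_perm n \<sigma> x)) \<in> points (tests (tensor n X))"
proof -
  \<comment> \<open>Every slot is filled by an entry and no entry is left over, so the constants and
    the linear form are never consulted.\<close>
  interpret tensor_subst X X n n "{1..n}" \<sigma> "\<lambda>x. x" "\<lambda>\<eta>. \<eta>" undefined undefined undefined c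
    using perm_subst[OF \<sigma> c] .
  show ?thesis
    using random_form_subst[of "\<lambda>_. f"] f by (simp add: points_tests_tensor_iff perm_subst_simps[OF \<sigma>])
qed

lemma scaled_test:
  assumes c: "0 \<le> c" "c \<le> 1" and f: "f \<in> points (tests (tensor n X))"
  shows "(\<lambda>x\<in>tuple_set n X. c * f x) \<in> points (tests (tensor n X))"
proof -
  have "tuple_perm n id x = x" if "x \<in> tuple_set n X" for x
    using that by (auto simp: tuple_perm_def fun_eq_iff PiE_iff extensional_def)
  then show ?thesis
    using scaled_perm_test[OF permutes_id c f] by (simp cong: restrict_cong)
qed

lemma perm_test_in: "\<sigma> permutes {1..n} \<Longrightarrow> f \<in> points (tests (tensor n X)) \<Longrightarrow> perm_test n X \<sigma> f \<in> points (tests (tensor n X))"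
  using scaled_perm_test[of \<sigma> n 1 f] by (simp add: perm_test_def)

lemma tperm_props:
  assumes \<sigma>: "\<sigma> permutes {1..n}" and a: "a \<in> points (elts (tensor n X))"
  shows "tperm n X \<sigma> a \<in> points (elts (tensor n X))"
    and "f \<in> points (tests (tensor n X)) \<Longrightarrow> pairing (tensor n X) f (tperm n X \<sigma> a) = pairing (tensor n X) (perm_test n X \<sigma> f) a"
proof -
  interpret tensor_subst X X n n "{1..n}" \<sigma> "\<lambda>x. x" "\<lambda>\<eta>. \<eta>" undefined undefined undefined 1
    using perm_subst[OF \<sigma>] by simp
  interpret k: tensor_kernel X X n n "{()}" "\<lambda>_. subst_coeff n {1..n} \<sigma> undefined 1" "\<lambda>_. subst_tuple n {1..n} \<sigma> (\<lambda>x. x) undefined"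
    by (rule single_kernel)
  have "tperm n X \<sigma> a \<in> points (elts (tensor n X)) \<and> (\<forall>f\<in>points (tests (tensor n X)).
      pairing (tensor n X) f (tperm n X \<sigma> a) = pairing (tensor n X) (k.pull f) a)"
    unfolding tperm_def
    by (rule k.tlift_props) (simp_all add: tpure_in pairing_tpure tuple_perm_in[OF \<sigma>] perm_subst_simps[OF \<sigma>] a)
  moreover have "k.pull f = perm_test n X \<sigma> f" for f
    unfolding k.pull_def perm_test_def by (simp add: perm_subst_simps[OF \<sigma>])
  ultimately show "tperm n X \<sigma> a \<in> points (elts (tensor n X))"
    "f \<in> points (tests (tensor n X)) \<Longrightarrow> pairing (tensor n X) f (tperm n X \<sigma> a) = pairing (tensor n X) (perm_test n X \<sigma> f) a"
    by auto
qed

lemma points_stensor_iff: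
  "a \<in> points (elts (stensor n X)) \<longleftrightarrow> a \<in> points (elts (tensor n X)) \<and>
    (\<forall>\<sigma>. \<sigma> permutes {1..n} \<longrightarrow> (\<forall>f\<in>points (tests (tensor n X)).
       pairing (tensor n X) (perm_test n X \<sigma> f) a = pairing (tensor n X) f a))"
proof -
  have "tperm n X \<sigma> a = a \<longleftrightarrow> (\<forall>f\<in>points (tests (tensor n X)).
       pairing (tensor n X) (perm_test n X \<sigma> f) a = pairing (tensor n X) f a)"
    if \<sigma>: "\<sigma> permutes {1..n}" and a: "a \<in> points (elts (tensor n X))" for \<sigma>
  proof
    assume "tperm n X \<sigma> a = a"
    then show "\<forall>f\<in>points (tests (tensor n X)). pairing (tensor n X) (perm_test n X \<sigma> f) a = pairing (tensor n X) f a"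
      using tperm_props(2)[OF \<sigma> a] by simp
  next
    assume "\<forall>f\<in>points (tests (tensor n X)). pairing (tensor n X) (perm_test n X \<sigma> f) a = pairing (tensor n X) f a"
    then show "tperm n X \<sigma> a = a"
      using tperm_props[OF \<sigma> a] a by (intro tensor_eqI[of _ n X]) auto
  qed
  then show ?thesis
    by (auto simp: stensor_def)
qed

text \<open>Symmetric tests separate symmetric tensors because a test and its average over all permutations
  agree on them.\<close>

lemma stensor_eqI:
  assumes a: "a \<in> points (elts (stensor n X))" and b: "b \<in> points (elts (stensor n X))"
    and eq: "\<And>f. f \<in> symmetric_tests n X \<Longrightarrow> pairing (tensor n X) f a = pairing (tensor n X) f b"
  shows "a = b"
proof (rule tensor_eqI)
  show "a \<in> points (elts (tensor n X))" "b \<in> points (elts (tensor n X))"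
    using a b by (auto simp: points_stensor_iff)
  fix f assume f: "f \<in> points (tests (tensor n X))"
  let ?P = "{\<sigma>. \<sigma> permutes {1..n}}"
  have P: "finite ?P" "card ?P = fact n"
    by (auto simp: finite_permutations card_permutations)
  \<comment> \<open>Dividing by \<open>fact n\<close> before summing keeps the average, bounded by
    1, within the forms that are tests.\<close>
  define h where "h = (\<lambda>x\<in>tuple_set n X. 1 / fact n * f x)"
  have h: "h \<in> points (tests (tensor n X))"
    unfolding h_def by (rule scaled_test[OF _ _ f]) auto
  define avg where "avg = (\<lambda>x\<in>tuple_set n X. \<Sum>\<sigma>\<in>?P. perm_test n X \<sigma> h x)"
  have pt: "perm_test n X \<sigma> h x = 1 / fact n * f (tuple_perm n \<sigma> x)" if "\<sigma> permutes {1..n}" "x \<in> tuple_set n X" for \<sigma> x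
    using that by (simp add: perm_test_def h_def tuple_perm_in)
  have "(\<Sum>\<sigma>\<in>?P. perm_test n X \<sigma> h x) \<le> 1" if x: "x \<in> tuple_set n X" for x
  proof -
    have "(\<Sum>\<sigma>\<in>?P. perm_test n X \<sigma> h x) \<le> (\<Sum>\<sigma>\<in>?P. 1 / fact n)"
      using test_bounds(2)[OF f tuple_perm_in[OF _ x]] by (intro sum_mono) (simp add: pt x divide_right_mono)
    also have "\<dots> = 1" using P by simp
    finally show ?thesis .
  qed
  then have avg: "avg \<in> points (tests (tensor n X))"
    using random_form_sum[OF P(1), of n "\<lambda>\<sigma> _. perm_test n X \<sigma> h"] perm_test_in h
    by (simp add: avg_def points_tests_tensor_iff)
  have "avg (tuple_perm n \<tau> x) = avg x" if \<tau>: "\<tau> permutes {1..n}" and x: "x \<in> tuple_set n X" for \<tau> x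
  proof -
    have "avg (tuple_perm n \<tau> x) = (\<Sum>\<sigma>\<in>?P. 1 / fact n * f (tuple_perm n (\<tau> \<circ> \<sigma>) x))"
      using x \<tau> by (simp add: avg_def pt tuple_perm_in tuple_perm_comp)
    also have "\<dots> = (\<Sum>\<sigma>\<in>?P. 1 / fact n * f (tuple_perm n \<sigma> x))"
      by (rule setum_permutations_compose_left[OF \<tau>, symmetric])
    also have "\<dots> = avg x"
      using x by (simp add: avg_def pt)
    finally show ?thesis .
  qed
  then have avg_sym: "avg \<in> symmetric_tests n X"
    using avg by (simp add: symmetric_tests_iff)
  have "pairing (tensor n X) f c = pairing (tensor n X) avg c" if c: "c \<in> points (elts (stensor n X))" for c
  proof -
    have c': "c \<in> points (elts (tensor n X))"
      using c by (simp add: points_stensor_iff)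
    \<comment> \<open>Here \<open>f\<close> is read as the sum of \<open>fact n\<close> copies of
      \<open>h\<close>.\<close>
    have "pairing (tensor n X) f c = (\<Sum>\<sigma>\<in>?P. pairing (tensor n X) h c)"
      by (rule tensor_pairing_sum[OF P(1) h f _ c']) (simp add: h_def P(2))
    also have "\<dots> = (\<Sum>\<sigma>\<in>?P. pairing (tensor n X) (perm_test n X \<sigma> h) c)"
      using c h by (intro sum.cong) (auto simp: points_stensor_iff)
    also have "\<dots> = pairing (tensor n X) avg c"
      by (rule tensor_pairing_sum[OF P(1) _ avg _ c', symmetric]) (use h perm_test_in in \<open>auto simp: avg_def\<close>)
    finally show ?thesis .
  qed
  with eq[OF avg_sym] a b show "pairing (tensor n X) f a = pairing (tensor n X) f b"
    by simp
qed

lemma cscale_tensor: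
  assumes "z \<in> points (elts (tensor n X))"
    and "\<And>f. f \<in> points (tests (tensor n X)) \<Longrightarrow> pairing (tensor n X) f z = c * pairing (tensor n X) f a"
  shows "cscale (tensor n X) c a = z"
  unfolding cscale_def by (rule the_equality) (use assms in blast, rule tensor_eqI[of _ n X], use assms in auto)

lemma csum_tensor:
  assumes "z \<in> points (elts (tensor n X))"
    and "\<And>f. f \<in> points (tests (tensor n X)) \<Longrightarrow> pairing (tensor n X) f z = (\<Sum>i\<in>I. pairing (tensor n X) f (a i))"
  shows "csum (tensor n X) I a = z"
  unfolding csum_def by (rule the_equality) (use assms in blast, rule tensor_eqI[of _ n X], use assms in auto)

lemma cscale_stensor:
  assumes "z \<in> points (elts (stensor n X))"
    and "\<And>f. f \<in> symmetric_tests n X \<Longrightarrow> pairing (tensor n X) f z = c * pairing (tensor n X) f a"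
  shows "cscale (stensor n X) c a = z"
  unfolding cscale_def by (rule the_equality) (use assms in simp, rule stensor_eqI, use assms in auto)

lemma csum_stensor:
  assumes "z \<in> points (elts (stensor n X))"
    and "\<And>f. f \<in> symmetric_tests n X \<Longrightarrow> pairing (tensor n X) f z = (\<Sum>i\<in>I. pairing (tensor n X) f (a i))"
  shows "csum (stensor n X) I a = z"
  unfolding csum_def by (rule the_equality) (use assms in simp, rule stensor_eqI, use assms in auto)

lemma scaled_tpure:
  assumes "x \<in> tuple_set n X" "0 \<le> c" "c \<le> 1"
  shows "cscale (tensor n X) c (tpure n X x) \<in> points (elts (tensor n X))"
    and "f \<in> points (tests (tensor n X)) \<Longrightarrow> pairing (tensor n X) f (cscale (tensor n X) c (tpure n X x)) = c * f x"
proof -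
  obtain a where a: "a \<in> points (elts (tensor n X))"
    "\<And>f. f \<in> points (tests (tensor n X)) \<Longrightarrow> pairing (tensor n X) f a = c * f x"
    by (rule tensor_finite_comb[of "{()}" "\<lambda>_. x" n "\<lambda>_. c"])
      (use assms test_bounds[OF _ assms(1)] in \<open>auto intro: mult_le_one\<close>)
  have "cscale (tensor n X) c (tpure n X x) = a"
    using a by (intro cscale_tensor) (auto simp: pairing_tpure assms)
  with a show "cscale (tensor n X) c (tpure n X x) \<in> points (elts (tensor n X))"
    "f \<in> points (tests (tensor n X)) \<Longrightarrow> pairing (tensor n X) f (cscale (tensor n X) c (tpure n X x)) = c * f x"
    by auto
qed

lemma tpure_const_stensor:
  assumes "x \<in> points (elts X)"
  shows "tpure n X (\<lambda>i\<in>{1..n}. x) \<in> points (elts (stensor n X))"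
proof -
  have x: "(\<lambda>i\<in>{1..n}. x) \<in> tuple_set n X" using assms by auto
  have "tuple_perm n \<sigma> (\<lambda>i\<in>{1..n}. x) = (\<lambda>i\<in>{1..n}. x)" if "\<sigma> permutes {1..n}" for \<sigma>
    using that by (auto simp: tuple_perm_def permutes_in_image fun_eq_iff simp del: atLeastAtMost_iff)
  then show ?thesis
    using x by (simp add: points_stensor_iff tpure_in pairing_tpure perm_test_in) (simp add: perm_test_def)
qed

end

section \<open>The maps of the exponential on diagonal tensors\<close>

text \<open>For a fixed enumeration \<open>b\<close> of \<open>S\<close>, the injections with image
  \<open>S\<close> are \<open>b\<close> composed with the permutations of
  \<open>{1..k}\<close>.\<close>

lemma card_injections_onto:
  fixes n k :: nat
  assumes S: "S \<subseteq> {1..n}" "card S = k"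
  shows "card {j \<in> {j \<in> {1..k} \<rightarrow>\<^sub>E {1..n}. inj_on j {1..k}}. j ` {1..k} = S} = fact k"
proof -
  have fS: "finite S" by (rule finite_subset[OF S(1)]) simp
  obtain b where b: "bij_betw b {1..k} S"
    using ex_bij_betw_nat_finite_1[OF fS] S(2) by auto
  let ?P = "{p. p permutes {1..k}}"
  let ?J = "{j \<in> {j \<in> {1..k} \<rightarrow>\<^sub>E {1..n}. inj_on j {1..k}}. j ` {1..k} = S}"
  define \<Phi> where "\<Phi> p = restrict (b \<circ> p) {1..k}" for p :: "nat \<Rightarrow> nat"
  have "bij_betw \<Phi> ?P ?J"
  proof (rule bij_betw_imageI)
    show "inj_on \<Phi> ?P"
    proof (rule inj_onI)
      fix p q assume p: "p \<in> ?P" and q: "q \<in> ?P" and eq: "\<Phi> p = \<Phi> q"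
      show "p = q"
      proof
        fix i
        show "p i = q i"
        proof (cases "i \<in> {1..k}")
          case True
          then have "b (p i) = b (q i)"
            using fun_cong[OF eq, of i] by (simp add: \<Phi>_def)
          moreover have "p i \<in> {1..k}" "q i \<in> {1..k}"
            using p q True by (simp_all add: permutes_in_image del: atLeastAtMost_iff)
          ultimately show ?thesis
            using inj_on_eq_iff[OF bij_betw_imp_inj_on[OF b], of "p i" "q i"] by blast
        next
          case False
          then show ?thesis
            using p q by (metis mem_Collect_eq permutes_not_in)
        qed
      qed
    qed
    show "\<Phi> ` ?P = ?J"
    proof (intro equalityI subsetI)
      fix j assume "j \<in> \<Phi> ` ?P"
      then obtain p where p: "p permutes {1..k}" and j: "j = \<Phi> p" by auto
      have "bij_betw (b \<circ> p) {1..k} S"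
        using permutes_imp_bij[OF p] b by (rule bij_betw_trans)
      then have jb: "bij_betw j {1..k} S"
        unfolding j \<Phi>_def by (subst bij_betw_cong[of _ _ "b \<circ> p"]) auto
      have "\<forall>i\<in>{1..k}. j i \<in> {1..n}"
        using bij_betwE[OF jb] S(1) by blast
      moreover have "j \<in> extensional {1..k}"
        by (simp add: j \<Phi>_def)
      ultimately show "j \<in> ?J"
        using jb by (simp add: bij_betw_def PiE_iff del: atLeastAtMost_iff)
    next
      fix j assume "j \<in> ?J"
      then have j: "bij_betw j {1..k} S" "j \<in> extensional {1..k}"
        by (auto simp: bij_betw_def PiE_iff)
      define p where "p i = (if i \<in> {1..k} then inv_into {1..k} b (j i) else i)" for i
      have "bij_betw (inv_into {1..k} b \<circ> j) {1..k} {1..k}"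
        using j(1) bij_betw_inv_into[OF b] by (rule bij_betw_trans)
      then have "bij_betw p {1..k} {1..k}"
        by (subst bij_betw_cong[of _ _ "inv_into {1..k} b \<circ> j"]) (auto simp: p_def)
      then have "p permutes {1..k}"
        by (rule bij_imp_permutes) (auto simp: p_def)
      moreover have "b (inv_into {1..k} b (j i)) = j i" if "i \<in> {1..k}" for i
        using b j(1) that by (intro f_inv_into_f) (auto simp: bij_betw_def)
      then have "\<Phi> p = j"
        using j(2) by (intro extensionalityI[of _ "{1..k}"]) (auto simp: \<Phi>_def p_def)
      ultimately show "j \<in> \<Phi> ` ?P" by blast
    qed
  qed
  then have "card ?J = card ?P"
    by (rule bij_betw_same_card[symmetric])
  also have "\<dots> = fact k"
    by (subst card_permutations) auto
  finally show ?thesis .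
qed

text \<open>Injections are grouped by their image; this is where the factor \<open>fact k\<close> of
  \<open>NM_coeff\<close> originates.\<close>

lemma sum_injections:
  fixes g :: "nat set \<Rightarrow> real" and n k :: nat
  shows "(\<Sum>j\<in>{j \<in> {1..k} \<rightarrow>\<^sub>E {1..n}. inj_on j {1..k}}. g (j ` {1..k}))
    = (\<Sum>S\<in>Pow {1..n}. (if card S = k then fact k else 0) * g S)"
proof -
  let ?J = "{j \<in> {1..k} \<rightarrow>\<^sub>E {1..n}. inj_on j {1..k}}"
  have fin: "finite ?J"
    by (rule finite_subset[of _ "{1..k} \<rightarrow>\<^sub>E {1..n}"]) (auto intro!: finite_PiE)
  have "(\<Sum>j\<in>?J. g (j ` {1..k})) = (\<Sum>S\<in>Pow {1..n}. \<Sum>j\<in>{j \<in> ?J. j ` {1..k} = S}. g (j ` {1..k}))"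
    by (rule sum.group[symmetric, OF fin]) auto
  also have "\<dots> = (\<Sum>S\<in>Pow {1..n}. (if card S = k then fact k else 0) * g S)"
  proof (rule sum.cong[OF refl])
    fix S assume S: "S \<in> Pow {1..n}"
    have "(\<Sum>j\<in>{j \<in> ?J. j ` {1..k} = S}. g (j ` {1..k})) = (\<Sum>j\<in>{j \<in> ?J. j ` {1..k} = S}. g S)"
      by (rule sum.cong) auto
    also have "\<dots> = real (card {j \<in> ?J. j ` {1..k} = S}) * g S"
      by simp
    also have "card {j \<in> ?J. j ` {1..k} = S} = (if card S = k then fact k else 0)"
    proof (cases "card S = k")
      case True
      then show ?thesis using card_injections_onto[of S n k] S by simp
    next
      case False
      then have "{j \<in> ?J. j ` {1..k} = S} = {}"
        using card_image[of _ "{1..k}"] by fastforce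
      then show ?thesis using False by (metis card.empty)
    qed
    finally show "(\<Sum>j\<in>{j \<in> ?J. j ` {1..k} = S}. g (j ` {1..k})) = (if card S = k then fact k else 0) * g S"
      by (simp only: of_nat_fact of_nat_0 if_distrib[of real])
  qed
  finally show ?thesis .
qed

section \<open>Estimates for the constants\<close>

text \<open>In other words, \<open>m^m / m!\<close> is nondecreasing in \<open>m\<close>; this
  bounds the weights in \<open>K_map\<close>.\<close>

lemma power_self_fact_mono:
  assumes "k \<le> m"
  shows "real k ^ k * fact m \<le> fact k * real m ^ m"
  using assms
proof (induction m rule: dec_induct)
  case (step m)
  have "real k ^ k * fact (Suc m) = real (Suc m) * (real k ^ k * fact m)"
    by (simp add: algebra_simps)
  also have "\<dots> \<le> real (Suc m) * (fact k * real m ^ m)"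
    by (rule mult_left_mono[OF step.IH]) simp
  also have "\<dots> \<le> real (Suc m) * (fact k * real (Suc m) ^ m)"
    by (intro mult_left_mono power_mono) auto
  finally show ?case by (simp add: algebra_simps)
qed simp

text \<open>Includes \<open>0 ^ 0 = 1\<close>, so division by \<open>real k ^ k\<close> is harmless
  in degree 0.\<close>

lemma self_power_ge_1: "1 \<le> real k ^ k"
  by (cases "k = 0") (auto intro!: one_le_power)

lemma self_power_pos: "0 < real k ^ k"
  using self_power_ge_1[of k] by linarith

lemma fact_le_self_power: "fact k / real k ^ k \<le> 1"
  using fact_le_power[where 'a = real, of k] self_power_pos[of k] by (simp add: divide_le_eq)

text \<open>Separation of elements turns the definite description \<open>czero X\<close> into an
  actual zero. For \<open>with_W X\<close> the tame axioms suffice, since its elements enter only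
  through tests.\<close>

locale separated_cqbs = tame_cqbs X for X :: "('a, 'b) cqbs" +
  assumes elts_separated: "separated X"
begin

sublocale W: tame_cqbs "with_W X"
  by (rule tame_with_W)

abbreviation XW :: "('a \<times> real, 'b \<times> real) cqbs" where
  "XW \<equiv> with_W X"

lemma czero_props: "czero X \<in> points (elts X) \<and> (\<forall>\<eta>\<in>points (tests X). pairing X \<eta> (czero X) = 0)"
proof -
  obtain z where z: "z \<in> points (elts X)" "\<forall>\<eta>\<in>points (tests X). pairing X \<eta> z = 0"
    using zero_elt_ex by blast
  have "czero X = z"
    unfolding czero_def by (rule the_equality) (use z elts_separated in \<open>auto simp: separated_def\<close>)
  with z show ?thesis by simp
qed

lemma czero_in: "czero X \<in> points (elts X)"
  using czero_props by blast

lemma pairing_czero: "\<eta> \<in> points (tests X) \<Longrightarrow> pairing X \<eta> (czero X) = 0"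
  using czero_props by blast

lemma elt_with_W: "(x, r) \<in> points (elts XW) \<longleftrightarrow> x \<in> points (elts X) \<and> 0 \<le> r \<and> r \<le> 1"
  by (simp add: elts_with_W)

lemma linear_pair_snd: "\<exists>lam'. linear_pair XW W_cqbs snd lam'"
proof -
  obtain z where z: "z \<in> points (tests X)" "\<And>x. x \<in> points (elts X) \<Longrightarrow> pairing X z x = 0"
    using zero_test_ex by blast
  have "linear_pair XW W_cqbs snd (\<lambda>s. (z, s))"
    unfolding linear_pair_def
  proof (intro conjI ballI)
    show "snd \<in> qbs_hom (elts XW) (elts W_cqbs)"
      by (rule qbs_homI) (auto simp: elts_with_W rand_qbs_pair)
    show "(\<lambda>s. (z, s)) \<in> qbs_hom (tests W_cqbs) (tests XW)"
      using z const_rand[OF tests_qbs z(1)]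
      by (intro qbs_homI) (auto simp: test_with_W_iff rand_tests_with_W, auto simp: rand_unit_qbs image_subset_iff)
  qed (use z in \<open>auto simp: elts_with_W\<close>)
  then show ?thesis by blast
qed

lemma linear_pair_fst: "linear_pair XW X fst (\<lambda>\<eta>. (\<eta>, 0))"
  unfolding linear_pair_def
proof (intro conjI ballI)
  show "fst \<in> qbs_hom (elts XW) (elts X)"
    by (rule qbs_homI) (auto simp: elts_with_W rand_qbs_pair)
  show "(\<lambda>\<eta>. (\<eta>, 0)) \<in> qbs_hom (tests X) (tests XW)"
    using pairing_bounds rand_in_points[OF tests_qbs]
    by (intro qbs_homI) (auto simp: test_with_W_iff rand_tests_with_W rand_unit_qbs)
qed simp

lemma linear_pair_incl: "linear_pair X XW (\<lambda>x. (x, 0)) fst"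
  unfolding linear_pair_def
proof (intro conjI ballI)
  show "(\<lambda>x. (x, 0)) \<in> qbs_hom (elts X) (elts XW)"
    by (rule qbs_homI) (auto simp: elts_with_W rand_qbs_pair rand_unit_qbs)
  show "fst \<in> qbs_hom (tests XW) (tests X)"
    by (rule qbs_homI) (auto simp: test_with_W_iff rand_tests_with_W)
qed simp

abbreviation diag :: "nat \<Rightarrow> 'a \<Rightarrow> real \<Rightarrow> nat \<Rightarrow> 'a \<times> real" where
  "diag n x r \<equiv> \<lambda>i\<in>{1..n}. (x, r)"

lemma diag_in: "x \<in> points (elts X) \<Longrightarrow> 0 \<le> r \<Longrightarrow> r \<le> 1 \<Longrightarrow> diag n x r \<in> tuple_set n XW"
  by (auto simp: elt_with_W)

subsection \<open>Restriction maps and the diagonal\<close>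

lemma J_step_diag:
  assumes x: "x \<in> points (elts X)"
  shows "J_step X m (tpure (Suc m) XW (diag (Suc m) x 1)) = tpure m XW (diag m x 1)"
proof -
  obtain lam' where lam': "linear_pair XW W_cqbs snd lam'"
    using linear_pair_snd by blast
  interpret s: tensor_subst XW XW "Suc m" m "{1..m}" "\<lambda>i. i" "\<lambda>x. x" "\<lambda>\<eta>. \<eta>" undefined snd lam' 1
    using lam' linear_pair_id by unfold_locales auto
  let ?C = "subst_coeff (Suc m) {1..m} (\<lambda>i. i) snd 1" and ?\<psi> = "subst_tuple m {1..m} (\<lambda>i. i) (\<lambda>x. x) undefined"
  interpret k: tensor_kernel XW XW "Suc m" m "{()}" "\<lambda>_. ?C" "\<lambda>_. ?\<psi>"
    by (rule s.single_kernel)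
  have "{1..Suc m} - (\<lambda>i. i) ` {1..m} = {Suc m}" by auto
  then have C: "?C y = snd (y (Suc m))" for y :: "nat \<Rightarrow> 'a \<times> real"
    unfolding subst_coeff_def by simp
  have \<psi>: "?\<psi> y = restrict y {1..m}" for y :: "nat \<Rightarrow> 'a \<times> real"
    unfolding subst_tuple_def by (auto intro!: restrict_ext)
  let ?\<zeta> = "\<lambda>y. cscale (tensor m XW) (snd (y (Suc m))) (tpure m XW (restrict y {1..m}))"
  let ?a = "tpure (Suc m) XW (diag (Suc m) x 1)"
  have d: "diag (Suc m) x 1 \<in> tuple_set (Suc m) XW" "diag m x 1 \<in> tuple_set m XW"
    by (rule diag_in; use x in simp)+
  have y: "restrict y {1..m} \<in> tuple_set m XW" "0 \<le> snd (y (Suc m))" "snd (y (Suc m)) \<le> 1"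
    if "y \<in> tuple_set (Suc m) XW" for y
  proof -
    have "y (Suc m) \<in> points (elts XW)" using that by (rule PiE_mem) simp
    then show "0 \<le> snd (y (Suc m))" "snd (y (Suc m)) \<le> 1" by (auto simp: elts_with_W)
  qed (use that in \<open>auto simp: PiE_iff\<close>)
  have "tlift (Suc m) XW (tensor m XW) ?\<zeta> ?a \<in> points (elts (tensor m XW)) \<and> (\<forall>f\<in>points (tests (tensor m XW)).
      pairing (tensor m XW) f (tlift (Suc m) XW (tensor m XW) ?\<zeta> ?a) = pairing (tensor (Suc m) XW) (k.pull f) ?a)"
  proof (rule k.tlift_props)
    show "?\<zeta> y \<in> points (elts (tensor m XW))" if "y \<in> tuple_set (Suc m) XW" for y
      using W.scaled_tpure(1)[OF y[OF that]] .
    show "pairing (tensor m XW) f (?\<zeta> y) = (\<Sum>i\<in>{()}. ?C y * f (?\<psi> y))"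
      if "y \<in> tuple_set (Suc m) XW" "f \<in> points (tests (tensor m XW))" for y f
      using W.scaled_tpure(2)[OF y[OF that(1)] that(2)] by (simp add: C \<psi>)
  qed (rule W.tpure_in[OF d(1)])
  moreover have "pairing (tensor (Suc m) XW) (k.pull f) ?a = f (diag m x 1)" if f: "f \<in> points (tests (tensor m XW))" for f
  proof -
    have "restrict (diag (Suc m) x 1) {1..m} = diag m x 1"
      by (auto simp: fun_eq_iff)
    then show ?thesis
      using W.pairing_tpure[OF d(1) qbs_hom_points[OF k.pull_hom f]] d(1)
      unfolding k.pull_def C \<psi> by simp
  qed
  ultimately have "tlift (Suc m) XW (tensor m XW) ?\<zeta> ?a = tpure m XW (diag m x 1)"
    using W.tpure_in[OF d(2)] W.pairing_tpure[OF d(2)] by (intro tensor_eqI[of _ m XW]) auto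
  then show ?thesis
    using W.tpure_const_stensor[of "(x, 1)" "Suc m"] x by (simp add: J_step_def elt_with_W)
qed

lemma nabla_in:
  assumes x: "x \<in> points (elts X)"
  shows "nabla X x \<in> points (bang_elts X)"
proof -
  have "J_iter X m d (nabla X x (m + d)) = nabla X x m" for m d
    by (induction d) (simp_all add: nabla_def J_step_diag[OF x])
  then have "nabla X x m = J_map X n m (nabla X x n)" if "m \<le> n" for m n
    using that by (simp add: J_map_def) (metis le_add_diff_inverse)
  moreover have "nabla X x n \<in> points (elts (stensor n XW))" for n
    unfolding nabla_def using x by (intro W.tpure_const_stensor) (simp add: elt_with_W)
  ultimately show ?thesis
    by (simp add: bang_elts_def PiE_iff)
qed

text \<open>Each of the \<open>m - k\<close> dropped entries contributes a factor \<open>r\<close>.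
  The result is a multiple of a diagonal tensor and hence symmetric.\<close>

lemma M_map_diag:
  assumes x: "x \<in> points (elts X)" and r: "0 \<le> r" "r \<le> 1" and km: "k \<le> m"
  defines "b \<equiv> M_map X m k (tpure m XW (diag m x r))"
  shows "b \<in> points (elts (stensor k X))"
    and "\<And>f. f \<in> points (tests (tensor k X)) \<Longrightarrow> pairing (tensor k X) f b = r ^ (m - k) * f (\<lambda>i\<in>{1..k}. x)"
proof -
  obtain lam' where lam': "linear_pair XW W_cqbs snd lam'"
    using linear_pair_snd by blast
  interpret s: tensor_subst XW X m k "{1..k}" "\<lambda>i. i" fst "\<lambda>\<eta>. (\<eta>, 0)" undefined snd lam' 1
    using lam' linear_pair_fst km by unfold_locales auto
  let ?C = "subst_coeff m {1..k} (\<lambda>i. i) snd 1" and ?\<psi> = "subst_tuple k {1..k} (\<lambda>i. i) fst undefined"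
  interpret k: tensor_kernel XW X m k "{()}" "\<lambda>_. ?C" "\<lambda>_. ?\<psi>"
    by (rule s.single_kernel)
  have "{1..m} - (\<lambda>i. i) ` {1..k} = {k+1..m}" by auto
  then have C: "?C y = (\<Prod>i\<in>{k+1..m}. snd (y i))" for y :: "nat \<Rightarrow> 'a \<times> real"
    unfolding subst_coeff_def by simp
  have \<psi>: "?\<psi> y = (\<lambda>i\<in>{1..k}. fst (y i))" for y :: "nat \<Rightarrow> 'a \<times> real"
    unfolding subst_tuple_def by (auto intro!: restrict_ext)
  let ?\<zeta> = "\<lambda>y. cscale (tensor k X) (\<Prod>i\<in>{k+1..m}. snd (y i)) (tpure k X (\<lambda>i\<in>{1..k}. fst (y i)))"
  let ?a = "tpure m XW (diag m x r)"
  have d: "diag m x r \<in> tuple_set m XW"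
    using x r by (rule diag_in)
  have y: "(\<lambda>i\<in>{1..k}. fst (y i)) \<in> tuple_set k X" "0 \<le> (\<Prod>i\<in>{k+1..m}. snd (y i))" "(\<Prod>i\<in>{k+1..m}. snd (y i)) \<le> 1"
    if "y \<in> tuple_set m XW" for y
    using that km by (auto simp: PiE_iff elts_with_W mem_Times_iff intro!: prod_nonneg prod_le_1)
  have lift: "tlift m XW (tensor k X) ?\<zeta> ?a \<in> points (elts (tensor k X)) \<and> (\<forall>f\<in>points (tests (tensor k X)).
      pairing (tensor k X) f (tlift m XW (tensor k X) ?\<zeta> ?a) = pairing (tensor m XW) (k.pull f) ?a)"
  proof (rule k.tlift_props)
    show "?\<zeta> y \<in> points (elts (tensor k X))" if "y \<in> tuple_set m XW" for y
      using scaled_tpure(1)[OF y[OF that]] .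
    show "pairing (tensor k X) f (?\<zeta> y) = (\<Sum>i\<in>{()}. ?C y * f (?\<psi> y))"
      if "y \<in> tuple_set m XW" "f \<in> points (tests (tensor k X))" for y f
      using scaled_tpure(2)[OF y[OF that(1)] that(2)] by (simp add: C \<psi>)
  qed (rule W.tpure_in[OF d])
  have b: "b = tlift m XW (tensor k X) ?\<zeta> ?a"
    using W.tpure_const_stensor[of "(x, r)" m] x r km by (simp add: b_def M_map_def elt_with_W)
  show val: "pairing (tensor k X) f b = r ^ (m - k) * f (\<lambda>i\<in>{1..k}. x)" if f: "f \<in> points (tests (tensor k X))" for f
  proof -
    have "(\<Prod>i\<in>{k+1..m}. snd (diag m x r i)) = (\<Prod>i\<in>{k+1..m}. r)"
      by (rule prod.cong) auto
    moreover have "(\<lambda>i\<in>{1..k}. fst (diag m x r i)) = (\<lambda>i\<in>{1..k}. x)"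
      using km by (intro restrict_ext) auto
    moreover have "pairing (tensor k X) f b = k.pull f (diag m x r)"
      unfolding b using lift f W.pairing_tpure[OF d qbs_hom_points[OF k.pull_hom f]] by simp
    moreover have "k.pull f (diag m x r) = (\<Prod>i\<in>{k+1..m}. snd (diag m x r i)) * f (\<lambda>i\<in>{1..k}. fst (diag m x r i))"
      unfolding k.pull_def C \<psi> using d by (subst restrict_apply') simp_all
    ultimately show ?thesis by simp
  qed
  have xk: "(\<lambda>i\<in>{1..k}. x) \<in> tuple_set k X"
    using x by auto
  have pt: "perm_test k X \<sigma> f (\<lambda>i\<in>{1..k}. x) = f (\<lambda>i\<in>{1..k}. x)" if \<sigma>: "\<sigma> permutes {1..k}" for \<sigma> f
  proof -
    have "tuple_perm k \<sigma> (\<lambda>i\<in>{1..k}. x) = (\<lambda>i\<in>{1..k}. x)"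
      using \<sigma> by (auto simp: tuple_perm_def permutes_in_image fun_eq_iff simp del: atLeastAtMost_iff)
    then show ?thesis
      using xk by (simp add: perm_test_def)
  qed
  have "b \<in> points (elts (tensor k X))"
    using lift b by blast
  then show "b \<in> points (elts (stensor k X))"
    by (simp add: points_stensor_iff val perm_test_in pt)
qed

subsection \<open>Insertion maps\<close>

abbreviation Inj :: "nat \<Rightarrow> nat \<Rightarrow> (nat \<Rightarrow> nat) set" where
  "Inj k n \<equiv> {j \<in> {1..k} \<rightarrow>\<^sub>E {1..n}. inj_on j {1..k}}"

lemma finite_Inj: "finite (Inj k n)"
  by (rule finite_subset[of _ "{1..k} \<rightarrow>\<^sub>E {1..n}"]) (auto intro!: finite_PiE)

lemma N_tuple_in:
  assumes "j \<in> Inj k n" "x \<in> tuple_set k X"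
  shows "N_tuple X k n j x \<in> tuple_set n XW"
  using assms czero_in by (auto simp: N_tuple_def elt_with_W intro!: PiE_mem[OF assms(2)] inv_into_into)

text \<open>Evaluate the form on the diagonal at the barycentre of the \<open>x i\<close> together with the scalar 1:
  the sum on the left is part of the resulting expansion.\<close>

lemma N_sum_le:
  assumes f: "f \<in> points (tests (tensor n XW))" and x: "x \<in> tuple_set k X"
  shows "(\<Sum>j\<in>Inj k n. 1 / real k ^ k * f (N_tuple X k n j x)) \<le> 1"
proof -
  \<comment> \<open>The barycentre of the \<open>x i\<close>; for \<open>k = 0\<close> the family is
    empty and \<open>z\<close> is a zero.\<close>
  obtain z where z: "z \<in> points (elts X)"
    "\<And>\<eta>. \<eta> \<in> points (tests X) \<Longrightarrow> pairing X \<eta> z = (\<Sum>i\<in>{1..k}. 1 / real k * pairing X \<eta> (x i))"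
    using convex_comb_ex[of "{1..k}" "\<lambda>_. 1 / real k" x] x by (cases "k = 0") (auto simp: PiE_iff)
  \<comment> \<open>Index 0 stands for the pair of zero and 1, index \<open>i > 0\<close> for
    \<open>(x i, 0)\<close> with the weight of the barycentre.\<close>
  define w :: "nat \<Rightarrow> real" where "w i = (if i = 0 then 1 else 1 / real k)" for i
  define v where "v i = (if i = 0 then (czero X, 1) else (x i, 0 :: real))" for i
  have I: "{0..k} = insert 0 {1..k}" by auto
  have v_in: "v i \<in> points (elts XW)" if "i \<in> {0..k}" for i
    using that x czero_in by (auto simp: v_def elt_with_W PiE_iff)
  have "pairing XW \<eta> (z, 1) = (\<Sum>i\<in>{0..k}. w i * pairing XW \<eta> (v i))" if \<eta>: "\<eta> \<in> points (tests XW)" for \<eta>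
  proof -
    have "(\<Sum>i\<in>{1..k}. w i * pairing XW \<eta> (v i)) = (\<Sum>i\<in>{1..k}. 1 / real k * pairing X (fst \<eta>) (x i))"
      by (rule sum.cong) (auto simp: w_def v_def)
    then show ?thesis
      using \<eta> z(2)[of "fst \<eta>"] pairing_czero[of "fst \<eta>"] unfolding I
      by (simp add: test_with_W_iff) (simp add: w_def v_def)
  qed
  then have expand: "f (\<lambda>q\<in>{1..n}. (z, 1)) = (\<Sum>c\<in>{1..n} \<rightarrow>\<^sub>E {0..k}. (\<Prod>q\<in>{1..n}. w (c q)) * f (\<lambda>q\<in>{1..n}. v (c q)))"
    using z(1) v_in by (intro W.test_expand[OF f]) (auto simp: elt_with_W)
  \<comment> \<open>The term of the expansion that equals the summand of \<open>j\<close>: slot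
    \<open>j i\<close> takes index \<open>i\<close>, every other slot index 0. Distinct injections
    give distinct terms, and the terms not reached are nonnegative.\<close>
  define c where "c j = (\<lambda>q\<in>{1..n}. if q \<in> j ` {1..k} then inv_into {1..k} j q else 0)" for j
  have c_in: "c j \<in> {1..n} \<rightarrow>\<^sub>E {0..k}" if "j \<in> Inj k n" for j
    using inv_into_into[of _ j "{1..k}"] by (force simp: c_def PiE_iff)
  have c_j: "c j (j i) = i" if "j \<in> Inj k n" "i \<in> {1..k}" for i j
    using that by (auto simp: c_def PiE_iff)
  have inj: "inj_on c (Inj k n)"
  proof (rule inj_onI)
    fix j j' assume j: "j \<in> Inj k n" and j': "j' \<in> Inj k n" and eq: "c j = c j'"
    show "j = j'"
    proof (rule extensionalityI[of _ "{1..k}"])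
      show "j \<in> extensional {1..k}" "j' \<in> extensional {1..k}" using j j' by (auto simp: PiE_iff)
      fix i assume i: "i \<in> {1..k}"
      then have ji: "j i \<in> {1..n}" using j by auto
      have ci: "c j' (j i) = i" using c_j[OF j i] eq by simp
      then have "j i \<in> j' ` {1..k}"
        using i ji by (auto simp: c_def split: if_splits)
      moreover from this have "inv_into {1..k} j' (j i) = i"
        using ci ji by (simp add: c_def)
      ultimately show "j i = j' i"
        using f_inv_into_f by metis
    qed
  qed
  have summand: "(\<Prod>q\<in>{1..n}. w (c j q)) * f (\<lambda>q\<in>{1..n}. v (c j q)) = 1 / real k ^ k * f (N_tuple X k n j x)"
    if j: "j \<in> Inj k n" for j
  proof -
    have sub: "j ` {1..k} \<subseteq> {1..n}" using j by auto
    have pos: "inv_into {1..k} j q \<noteq> 0" if "q \<in> j ` {1..k}" for q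
      using inv_into_into[OF that] by auto
    have "(\<Prod>q\<in>{1..n}. w (c j q)) = (\<Prod>q\<in>j ` {1..k}. w (c j q))"
      using sub by (intro prod.mono_neutral_right) (auto simp: c_def w_def)
    also have "\<dots> = (\<Prod>q\<in>j ` {1..k}. 1 / real k)"
    proof (rule prod.cong[OF refl])
      fix q assume q: "q \<in> j ` {1..k}"
      then have "c j q = inv_into {1..k} j q" using sub by (auto simp: c_def)
      with pos[OF q] show "w (c j q) = 1 / real k" by (simp add: w_def)
    qed
    also have "\<dots> = 1 / real k ^ k"
      using j by (simp add: card_image power_one_over)
    finally have "(\<Prod>q\<in>{1..n}. w (c j q)) = 1 / real k ^ k" .
    moreover have "(\<lambda>q\<in>{1..n}. v (c j q)) = N_tuple X k n j x"
      unfolding N_tuple_def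
    proof (rule restrict_ext)
      fix q assume q: "q \<in> {1..n}"
      show "v (c j q) = (if q \<in> j ` {1..k} then (x (inv_into {1..k} j q), 0) else (czero X, 1))"
        using q pos[of q] by (cases "q \<in> j ` {1..k}") (simp_all add: c_def v_def)
    qed
    ultimately show ?thesis by simp
  qed
  have "(\<Sum>j\<in>Inj k n. 1 / real k ^ k * f (N_tuple X k n j x))
      = (\<Sum>j\<in>Inj k n. (\<Prod>q\<in>{1..n}. w (c j q)) * f (\<lambda>q\<in>{1..n}. v (c j q)))"
    by (rule sum.cong) (simp_all add: summand)
  also have "\<dots> = (\<Sum>c\<in>c ` Inj k n. (\<Prod>q\<in>{1..n}. w (c q)) * f (\<lambda>q\<in>{1..n}. v (c q)))"
    by (simp add: sum.reindex[OF inj])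
  also have "\<dots> \<le> (\<Sum>c\<in>{1..n} \<rightarrow>\<^sub>E {0..k}. (\<Prod>q\<in>{1..n}. w (c q)) * f (\<lambda>q\<in>{1..n}. v (c q)))"
  proof (rule sum_mono2)
    fix d assume "d \<in> ({1..n} \<rightarrow>\<^sub>E {0..k}) - c ` Inj k n"
    then have "(\<lambda>q\<in>{1..n}. v (d q)) \<in> tuple_set n XW"
      using v_in by (auto simp: PiE_iff)
    then show "0 \<le> (\<Prod>q\<in>{1..n}. w (d q)) * f (\<lambda>q\<in>{1..n}. v (d q))"
      using W.test_bounds(1)[OF f] by (intro mult_nonneg_nonneg prod_nonneg) (auto simp: w_def)
  qed (use c_in in \<open>auto intro: finite_PiE\<close>)
  also have "\<dots> = f (\<lambda>q\<in>{1..n}. (z, 1))"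
    by (rule expand[symmetric])
  also have "\<dots> \<le> 1"
    using z(1) by (intro W.test_bounds(2)[OF f] diag_in) auto
  finally show ?thesis .
qed

lemma N_subst:
  assumes j: "j \<in> Inj k n"
  shows "tensor_subst X XW k n (j ` {1..k}) (inv_into {1..k} j) (\<lambda>x. (x, 0)) fst (\<lambda>_. (czero X, 1)) lam lam' (1 / real k ^ k)"
proof
  have "inv_into {1..k} j ` j ` {1..k} = {1..k}"
    using j by (auto simp: inv_into_image_cancel)
  then show "inv_into {1..k} j ` j ` {1..k} \<subseteq> {1..k}"
    "{1..k} - inv_into {1..k} j ` j ` {1..k} \<noteq> {} \<Longrightarrow> linear_pair X W_cqbs lam lam'" by auto
  show "1 / real k ^ k \<le> 1"
    using self_power_ge_1[of k] self_power_pos[of k] by (simp add: divide_le_eq)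
qed (use j czero_in linear_pair_incl in \<open>auto simp: elt_with_W inj_on_inv_into\<close>)

lemma N_subst_simps:
  assumes j: "j \<in> Inj k n"
  shows "subst_tuple n (j ` {1..k}) (inv_into {1..k} j) (\<lambda>x. (x, 0)) (\<lambda>_. (czero X, 1)) = N_tuple X k n j"
    and "subst_coeff k (j ` {1..k}) (inv_into {1..k} j) lam c = (\<lambda>_. c)"
  using j by (auto simp: fun_eq_iff subst_tuple_def N_tuple_def subst_coeff_def inv_into_image_cancel)

text \<open>One substitution per injection, with slots read through the inverse of \<open>j\<close>.
  Termwise bounds would not keep the sum below 1; \<open>N_sum_le\<close> does.\<close>

lemma N_kernel: "tensor_kernel X XW k n (Inj k n) (\<lambda>_ _. 1 / real k ^ k) (\<lambda>j. N_tuple X k n j)"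
proof
  fix j assume j: "j \<in> Inj k n"
  interpret s: tensor_subst X XW k n "j ` {1..k}" "inv_into {1..k} j" "\<lambda>x. (x, 0)" fst "\<lambda>_. (czero X, 1)" undefined undefined "1 / real k ^ k"
    by (rule N_subst[OF j])
  fix \<xi> assume \<xi>: "\<xi> \<in> rand (tups {1..k} X)"
  then have \<xi>i: "(\<lambda>t. \<xi> t i) \<in> rand (elts X)" if "i \<in> {1..k}" for i
    using that by (simp add: rand_qbs_prod)
  show "(\<lambda>t. N_tuple X k n j (\<xi> t)) \<in> rand (tups {1..n} XW)"
    using s.subst_tuple_rand[of \<xi>] \<xi>i s.u(2) unfolding N_subst_simps[OF j] by blast
  show "(\<lambda>t. s t * (1 / real k ^ k)) \<in> rand unit_qbs" if "s \<in> rand unit_qbs" for s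
    using s.subst_coeff_rand[of \<xi> s] \<xi>i that unfolding N_subst_simps[OF j] by blast
next
  fix \<phi> assume \<phi>: "random_form n XW \<phi>"
  have "random_form k X (\<lambda>r. \<lambda>x\<in>tuple_set k X. 1 / real k ^ k * \<phi> r (N_tuple X k n j x))" if j: "j \<in> Inj k n" for j
  proof -
    interpret s: tensor_subst X XW k n "j ` {1..k}" "inv_into {1..k} j" "\<lambda>x. (x, 0)" fst "\<lambda>_. (czero X, 1)" undefined undefined "1 / real k ^ k"
      by (rule N_subst[OF j])
    show ?thesis
      using s.random_form_subst[OF \<phi>] unfolding N_subst_simps[OF j] .
  qed
  from random_form_sum[OF finite_Inj this]
  show "random_form k X (\<lambda>r. \<lambda>x\<in>tuple_set k X. \<Sum>j\<in>Inj k n. 1 / real k ^ k * \<phi> r (N_tuple X k n j x))"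
    using N_sum_le[OF W.random_form_test[OF \<phi>]] by (simp cong: restrict_cong)
qed (rule finite_Inj)

lemma N_mult_props:
  assumes a: "a \<in> points (elts (stensor k X))"
  shows "N_mult X k p a \<in> points (elts (tensor (k * p) XW))"
    and "f \<in> points (tests (tensor (k * p) XW)) \<Longrightarrow> pairing (tensor (k * p) XW) f (N_mult X k p a) =
      pairing (tensor k X) (\<lambda>x\<in>tuple_set k X. \<Sum>j\<in>Inj k (k * p). 1 / real k ^ k * f (N_tuple X k (k * p) j x)) a"
    and "f \<in> points (tests (tensor (k * p) XW)) \<Longrightarrow>
      (\<lambda>x\<in>tuple_set k X. \<Sum>j\<in>Inj k (k * p). 1 / real k ^ k * f (N_tuple X k (k * p) j x)) \<in> points (tests (tensor k X))"
proof -
  let ?n = "k * p"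
  interpret k: tensor_kernel X XW k ?n "Inj k ?n" "\<lambda>_ _. 1 / real k ^ k" "\<lambda>j. N_tuple X k ?n j"
    by (rule N_kernel)
  let ?\<zeta> = "\<lambda>x. csum (tensor ?n XW) (Inj k ?n) (\<lambda>j. cscale (tensor ?n XW) (1 / real k ^ k) (tpure ?n XW (N_tuple X k ?n j x)))"
  have c: "0 \<le> 1 / real k ^ k" "1 / real k ^ k \<le> 1"
    using self_power_ge_1[of k] self_power_pos[of k] by (simp_all add: divide_le_eq)
  have \<zeta>: "?\<zeta> x \<in> points (elts (tensor ?n XW)) \<and> (\<forall>f\<in>points (tests (tensor ?n XW)).
      pairing (tensor ?n XW) f (?\<zeta> x) = (\<Sum>j\<in>Inj k ?n. 1 / real k ^ k * f (N_tuple X k ?n j x)))"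
    if x: "x \<in> tuple_set k X" for x
  proof -
    obtain z where z: "z \<in> points (elts (tensor ?n XW))"
      "\<And>f. f \<in> points (tests (tensor ?n XW)) \<Longrightarrow> pairing (tensor ?n XW) f z = (\<Sum>j\<in>Inj k ?n. 1 / real k ^ k * f (N_tuple X k ?n j x))"
    proof (rule W.tensor_finite_comb[OF finite_Inj, of k ?n "\<lambda>j. N_tuple X k ?n j x" ?n "\<lambda>_. 1 / real k ^ k"])
      show "N_tuple X k ?n j x \<in> tuple_set ?n XW" if "j \<in> Inj k ?n" for j
        by (rule N_tuple_in[OF that x])
      show "1 / real k ^ k \<in> {0..1}"
        using c by simp
      show "(\<Sum>j\<in>Inj k ?n. 1 / real k ^ k * f (N_tuple X k ?n j x)) \<le> 1" if "f \<in> points (tests (tensor ?n XW))" for f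
        by (rule N_sum_le[OF that x])
    qed (rule that)
    have "?\<zeta> x = z"
    proof (rule W.csum_tensor[OF z(1)])
      fix f assume f: "f \<in> points (tests (tensor ?n XW))"
      show "pairing (tensor ?n XW) f z = (\<Sum>j\<in>Inj k ?n. pairing (tensor ?n XW) f (cscale (tensor ?n XW) (1 / real k ^ k) (tpure ?n XW (N_tuple X k ?n j x))))"
        unfolding z(2)[OF f] by (rule sum.cong) (simp_all only: W.scaled_tpure(2)[OF N_tuple_in[OF _ x] c f])
    qed
    with z show ?thesis by simp
  qed
  have a': "a \<in> points (elts (tensor k X))"
    using a by (simp add: points_stensor_iff)
  have "tlift k X (tensor ?n XW) ?\<zeta> a \<in> points (elts (tensor ?n XW)) \<and> (\<forall>f\<in>points (tests (tensor ?n XW)).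
     pairing (tensor ?n XW) f (tlift k X (tensor ?n XW) ?\<zeta> a) = pairing (tensor k X) (k.pull f) a)"
    using \<zeta> by (intro k.tlift_props a') blast+
  moreover have "N_mult X k p a = tlift k X (tensor ?n XW) ?\<zeta> a"
    using a by (simp add: N_mult_def)
  ultimately show "N_mult X k p a \<in> points (elts (tensor ?n XW))"
    "f \<in> points (tests (tensor (k * p) XW)) \<Longrightarrow> pairing (tensor (k * p) XW) f (N_mult X k p a) =
      pairing (tensor k X) (\<lambda>x\<in>tuple_set k X. \<Sum>j\<in>Inj k (k * p). 1 / real k ^ k * f (N_tuple X k (k * p) j x)) a"
    by (simp_all add: k.pull_def)
  show "f \<in> points (tests (tensor (k * p) XW)) \<Longrightarrow>
      (\<lambda>x\<in>tuple_set k X. \<Sum>j\<in>Inj k (k * p). 1 / real k ^ k * f (N_tuple X k (k * p) j x)) \<in> points (tests (tensor k X))"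
    using qbs_hom_points[OF k.pull_hom, of f] by (simp add: k.pull_def)
qed

end

subsection \<open>The comparison maps\<close>

context separated_cqbs
begin

definition slots :: "nat \<Rightarrow> 'a \<Rightarrow> nat set \<Rightarrow> nat \<Rightarrow> 'a \<times> real" where
  "slots n x S = (\<lambda>q\<in>{1..n}. if q \<in> S then (x, 0) else (czero X, 1))"

lemma slots_in: "x \<in> points (elts X) \<Longrightarrow> slots n x S \<in> tuple_set n XW"
  using czero_in by (auto simp: slots_def elt_with_W)

text \<open>On a constant tuple only the image of \<open>j\<close> matters, so sums over injections
  become sums over subsets.\<close>

lemma N_tuple_const:
  "N_tuple X k n j (\<lambda>i\<in>{1..k}. x) = slots n x (j ` {1..k})"
  unfolding N_tuple_def slots_def
proof (rule restrict_ext)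
  fix q
  show "(if q \<in> j ` {1..k} then ((\<lambda>i\<in>{1..k}. x) (inv_into {1..k} j q), 0) else (czero X, 1)) =
      (if q \<in> j ` {1..k} then (x, 0) else (czero X, 1))"
    using inv_into_into[of q j "{1..k}"] by simp
qed

lemma slots_perm:
  assumes \<sigma>: "\<sigma> permutes {1..n}"
  shows "tuple_perm n \<sigma> (slots n x S) = slots n x (inv \<sigma> ` S)"
  unfolding tuple_perm_def
proof (subst slots_def, rule restrict_ext)
  fix i assume i: "i \<in> {1..n}"
  have "i \<in> inv \<sigma> ` S \<longleftrightarrow> \<sigma> i \<in> S"
    using permutes_inverses[OF \<sigma>] by (metis image_iff)
  moreover have "\<sigma> i \<in> {1..n}"
    using i \<sigma> by (simp add: permutes_in_image del: atLeastAtMost_iff)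
  ultimately show "slots n x S (\<sigma> i) = (if i \<in> inv \<sigma> ` S then (x, 0) else (czero X, 1))"
    by (simp add: slots_def)
qed

text \<open>Permuting the slots permutes the subsets of \<open>{1..n}\<close> and preserves their
  size, on which alone the coefficients depend.\<close>

lemma size_comb_symmetric:
  assumes x: "x \<in> points (elts X)" and z: "z \<in> points (elts (tensor n XW))"
    and eq: "\<And>f. f \<in> points (tests (tensor n XW)) \<Longrightarrow>
      pairing (tensor n XW) f z = (\<Sum>S\<in>Pow {1..n}. \<gamma> (card S) * f (slots n x S))"
  shows "z \<in> points (elts (stensor n XW))"
  unfolding W.points_stensor_iff
proof (intro conjI allI impI ballI z)
  fix \<sigma> f assume \<sigma>: "\<sigma> permutes {1..n}" and f: "f \<in> points (tests (tensor n XW))"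
  have bij: "bij_betw ((`) (inv \<sigma>)) (Pow {1..n}) (Pow {1..n})"
    by (rule bij_betw_Pow[OF permutes_imp_bij[OF permutes_inv[OF \<sigma>]]])
  have "pairing (tensor n XW) (perm_test n XW \<sigma> f) z
      = (\<Sum>S\<in>Pow {1..n}. \<gamma> (card (inv \<sigma> ` S)) * f (slots n x (inv \<sigma> ` S)))"
    unfolding eq[OF W.perm_test_in[OF \<sigma> f]]
  proof (rule sum.cong[OF refl])
    fix S
    have "card (inv \<sigma> ` S) = card S"
      using permutes_inj_on[OF permutes_inv[OF \<sigma>]] by (rule card_image)
    then show "\<gamma> (card S) * perm_test n XW \<sigma> f (slots n x S) = \<gamma> (card (inv \<sigma> ` S)) * f (slots n x (inv \<sigma> ` S))"
      using slots_in[OF x, of n S] by (simp add: perm_test_def slots_perm[OF \<sigma>])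
  qed
  also have "\<dots> = (\<Sum>S\<in>Pow {1..n}. \<gamma> (card S) * f (slots n x S))"
    by (rule sum.reindex_bij_betw[OF bij])
  finally show "pairing (tensor n XW) (perm_test n XW \<sigma> f) z = pairing (tensor n XW) f z"
    using eq[OF f] by simp
qed

lemma size_comb_ex:
  assumes x: "x \<in> points (elts X)" and \<gamma>: "\<And>c. 0 \<le> \<gamma> c \<and> \<gamma> c \<le> 1"
    and le: "\<And>f. f \<in> points (tests (tensor n XW)) \<Longrightarrow> (\<Sum>S\<in>Pow {1..n}. \<gamma> (card S) * f (slots n x S)) \<le> 1"
  obtains z where "z \<in> points (elts (stensor n XW))"
    "\<And>f. f \<in> points (tests (tensor n XW)) \<Longrightarrow>
      pairing (tensor n XW) f z = (\<Sum>S\<in>Pow {1..n}. \<gamma> (card S) * f (slots n x S))"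
proof -
  obtain z where z: "z \<in> points (elts (tensor n XW))"
    "\<And>f. f \<in> points (tests (tensor n XW)) \<Longrightarrow>
      pairing (tensor n XW) f z = (\<Sum>S\<in>Pow {1..n}. \<gamma> (card S) * f (slots n x S))"
  proof (rule W.tensor_finite_comb[of "Pow {1..n}" "slots n x" n "\<lambda>S. \<gamma> (card S)"])
    show "slots n x S \<in> tuple_set n XW" for S by (rule slots_in[OF x])
    show "\<gamma> (card S) \<in> {0..1}" for S :: "nat set" using \<gamma> by simp
  qed (use le that in auto)
  from size_comb_symmetric[OF x z] z(2) show thesis by (rule that)
qed

text \<open>Coefficient of \<open>slots n x S\<close>, for \<open>card S = c\<close>, in
  \<open>N_map X k n\<close> after \<open>M_map X m k\<close> at the diagonal tensor of
  \<open>(x, r)\<close>: the power of \<open>r\<close> comes from the entries dropped by M,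
  \<open>fact k\<close> counts the injections with image \<open>S\<close>, and
  \<open>1 / real k ^ k\<close> is the weight in N.\<close>

definition NM_coeff :: "nat \<Rightarrow> nat \<Rightarrow> real \<Rightarrow> nat \<Rightarrow> real" where
  "NM_coeff m k r c = r ^ (m - k) * (if c = k then fact k / real k ^ k else 0)"

lemma NM_coeff_bounds:
  assumes "0 \<le> r" "r \<le> 1"
  shows "0 \<le> NM_coeff m k r c" "NM_coeff m k r c \<le> 1"
proof -
  define q where "q = (if c = k then fact k / real k ^ k else 0)"
  have "0 \<le> q" "q \<le> 1"
    using fact_le_self_power[of k] by (auto simp: q_def)
  then show "0 \<le> NM_coeff m k r c" "NM_coeff m k r c \<le> 1"
    unfolding NM_coeff_def q_def[symmetric] using assms by (auto intro!: mult_le_one power_le_one)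
qed

lemma NM_diag:
  assumes x: "x \<in> points (elts X)" and r: "0 \<le> r" "r \<le> 1" and km: "k \<le> m"
    and dvd: "k > 0 \<Longrightarrow> k dvd n \<and> n > 0"
  defines "b \<equiv> N_map X k n (M_map X m k (tpure m XW (diag m x r)))"
  shows "b \<in> points (elts (stensor n XW))"
    and "\<And>f. f \<in> symmetric_tests n XW \<Longrightarrow>
      pairing (tensor n XW) f b = (\<Sum>S\<in>Pow {1..n}. NM_coeff m k r (card S) * f (slots n x S))"
proof -
  define a where "a = M_map X m k (tpure m XW (diag m x r))"
  note a = M_map_diag[OF x r km, folded a_def]
  have "b \<in> points (elts (stensor n XW)) \<and> (\<forall>f\<in>symmetric_tests n XW.
      pairing (tensor n XW) f b = (\<Sum>S\<in>Pow {1..n}. NM_coeff m k r (card S) * f (slots n x S)))"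
  proof (cases "k = 0")
    case True
    have sum0: "(\<Sum>S\<in>Pow {1..n}. NM_coeff m k r (card S) * f (slots n x S)) = r ^ m * f (slots n x {})" for f
    proof -
      have "(\<Sum>S\<in>Pow {1..n}. NM_coeff m k r (card S) * f (slots n x S))
          = (\<Sum>S\<in>{{}}. NM_coeff m k r (card S) * f (slots n x S))"
      proof (rule sum.mono_neutral_right)
        show "\<forall>S\<in>Pow {1..n} - {{}}. NM_coeff m k r (card S) * f (slots n x S) = 0"
        proof
          fix S assume "S \<in> Pow {1..n} - {{}}"
          then have "card S \<noteq> 0"
            using finite_subset[of S "{1..n}"] by auto
          then show "NM_coeff m k r (card S) * f (slots n x S) = 0"
            using True by (simp add: NM_coeff_def)
        qed
      qed auto
      then show ?thesis using True by (simp add: NM_coeff_def)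
    qed
    have slots0: "slots n x {} = (\<lambda>i\<in>{1..n}. (czero X, 1))"
      by (simp add: slots_def)
    obtain z where z: "z \<in> points (elts (stensor n XW))"
      "\<And>f. f \<in> points (tests (tensor n XW)) \<Longrightarrow>
        pairing (tensor n XW) f z = (\<Sum>S\<in>Pow {1..n}. NM_coeff m k r (card S) * f (slots n x S))"
    proof (rule size_comb_ex[OF x, of "NM_coeff m k r" n])
      show "0 \<le> NM_coeff m k r c \<and> NM_coeff m k r c \<le> 1" for c
        using NM_coeff_bounds[OF r] by blast
      show "(\<Sum>S\<in>Pow {1..n}. NM_coeff m k r (card S) * f (slots n x S)) \<le> 1" if "f \<in> points (tests (tensor n XW))" for f
        unfolding sum0 using r W.test_bounds[OF that slots_in[OF x]] by (auto intro!: mult_le_one power_le_one)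
    qed (rule that)
    \<comment> \<open>The form through which \<open>N_map\<close> reads a tensor of degree 0 as a
      scalar; here the scalar is \<open>r ^ m\<close>.\<close>
    have "random_form 0 X (\<lambda>_. \<lambda>x\<in>tuple_set 0 X. 1)"
      by (rule random_formI) (auto simp: rand_qbs_prod)
    then have one: "(\<lambda>x\<in>points (tuples 0 (\<lambda>_. X)). 1) \<in> points (tests (tensor k X))"
      using True by (simp add: points_tests_tensor_iff)
    have "pairing (tensor k X) (\<lambda>x\<in>points (tuples 0 (\<lambda>_. X)). 1) a = r ^ m"
    proof -
      have "(\<lambda>i\<in>{1..k}. x) \<in> points (tuples 0 (\<lambda>_. X))"
        using True by (auto simp: fun_eq_iff)
      from a(2)[OF one] show ?thesis
        unfolding restrict_apply'[OF \<open>(\<lambda>i\<in>{1..k}. x) \<in> points (tuples 0 (\<lambda>_. X))\<close>] using True by simp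
    qed
    then have "b = cscale (stensor n XW) (r ^ m) (tpure n XW (\<lambda>i\<in>{1..n}. (czero X, 1)))"
      using True by (simp add: b_def N_map_def a_def)
    also have "\<dots> = z"
    proof (rule W.cscale_stensor[OF z(1)])
      fix f assume "f \<in> symmetric_tests n XW"
      then have f: "f \<in> points (tests (tensor n XW))"
        by (simp add: symmetric_tests_iff)
      show "pairing (tensor n XW) f z = r ^ m * pairing (tensor n XW) f (tpure n XW (\<lambda>i\<in>{1..n}. (czero X, 1)))"
        using z(2)[OF f] sum0 W.pairing_tpure[OF slots_in[OF x] f, of "{}"] by (simp add: slots0)
    qed
    finally show ?thesis
      using z by (simp add: symmetric_tests_iff)
  next
    case False
    define p where "p = n div k"
    have n: "k * p = n" "0 < p" using dvd False by (auto simp: p_def)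
    \<comment> \<open>As \<open>k\<close> divides \<open>n\<close>, the least multiplier is the
      exact quotient, and the J that follows is the identity.\<close>
    have "(LEAST p. 0 < p \<and> n \<le> k * p) = p"
    proof (rule Least_equality)
      show "p \<le> q" if "0 < q \<and> n \<le> k * q" for q
        using that n False by (metis mult_le_cancel1 not_gr_zero)
    qed (use n in auto)
    then have b: "b = N_mult X k p a"
      using False n by (simp add: b_def N_map_def a_def J_map_def)
    note N = N_mult_props[OF a(1), where p = p, unfolded n(1), folded b]
    have xk: "(\<lambda>i\<in>{1..k}. x) \<in> tuple_set k X"
      using x by auto
    have val: "pairing (tensor n XW) f b = (\<Sum>S\<in>Pow {1..n}. NM_coeff m k r (card S) * f (slots n x S))"
      if f: "f \<in> points (tests (tensor n XW))" for f
    proof -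
      have "pairing (tensor n XW) f b = r ^ (m - k) * (\<Sum>j\<in>Inj k n. 1 / real k ^ k * f (slots n x (j ` {1..k})))"
        unfolding N(2)[OF f] a(2)[OF N(3)[OF f]] using xk by (simp add: N_tuple_const)
      also have "(\<Sum>j\<in>Inj k n. 1 / real k ^ k * f (slots n x (j ` {1..k})))
          = (\<Sum>S\<in>Pow {1..n}. (if card S = k then fact k else 0) * (1 / real k ^ k * f (slots n x S)))"
        by (rule sum_injections[where g = "\<lambda>S. 1 / real k ^ k * f (slots n x S)"])
      also have "r ^ (m - k) * \<dots> = (\<Sum>S\<in>Pow {1..n}. NM_coeff m k r (card S) * f (slots n x S))"
        unfolding sum_distrib_left by (rule sum.cong) (auto simp: NM_coeff_def)
      finally show ?thesis .
    qed
    show ?thesis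
      using size_comb_symmetric[OF x N(1) val] val by (simp add: symmetric_tests_iff)
  qed
  then show "b \<in> points (elts (stensor n XW))"
    "\<And>f. f \<in> symmetric_tests n XW \<Longrightarrow>
      pairing (tensor n XW) f b = (\<Sum>S\<in>Pow {1..n}. NM_coeff m k r (card S) * f (slots n x S))"
    by blast+
qed

section \<open>Weights of the comparison maps\<close>

definition K_weight :: "nat \<Rightarrow> nat \<Rightarrow> real" where
  "K_weight m k = 1 / (real m + 1) * (real k ^ k * fact m / (fact k * real m ^ m))"

lemma K_weight_bounds:
  assumes "k \<le> m"
  shows "0 \<le> K_weight m k" "K_weight m k \<le> 1 / (real m + 1)"
proof -
  show "0 \<le> K_weight m k" by (simp add: K_weight_def)
  have "real k ^ k * fact m / (fact k * real m ^ m) \<le> 1"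
    using power_self_fact_mono[OF assms] self_power_pos[of m] by (subst divide_le_eq_1_pos) simp_all
  then have "1 / (real m + 1) * (real k ^ k * fact m / (fact k * real m ^ m)) \<le> 1 / (real m + 1) * 1"
    by (rule mult_left_mono) simp
  then show "K_weight m k \<le> 1 / (real m + 1)"
    by (simp add: K_weight_def)
qed

text \<open>There are \<open>m + 1\<close> weights, each at most \<open>1 / (m + 1)\<close>: the
  average keeps \<open>K_map\<close> within the bound 1.\<close>

lemma sum_K_weight: "(\<Sum>k\<in>{0..m}. K_weight m k) \<le> 1"
proof -
  have "(\<Sum>k\<in>{0..m}. K_weight m k) \<le> (\<Sum>k\<in>{0..m}. 1 / (real m + 1))"
    using K_weight_bounds by (intro sum_mono) auto
  also have "\<dots> = 1" by simp
  finally show ?thesis .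
qed

text \<open>Only \<open>k = c\<close> contributes, and there the constants cancel completely:
  \<open>rho m\<close>, the weight in K and \<open>fact c / real c ^ c\<close> multiply to
  1.\<close>

lemma rho_K_NM: "rho m * (\<Sum>k\<in>{0..m}. K_weight m k * NM_coeff m k r c) = (if c \<le> m then r ^ (m - c) else 0)"
proof (cases "c \<le> m")
  case True
  have "(\<Sum>k\<in>{0..m}. K_weight m k * NM_coeff m k r c) = (\<Sum>k\<in>{0..m}. if c = k then K_weight m k * (r ^ (m - k) * (fact k / real k ^ k)) else 0)"
    by (rule sum.cong) (auto simp: NM_coeff_def)
  also have "\<dots> = K_weight m c * (r ^ (m - c) * (fact c / real c ^ c))"
    using True by simp
  also have "rho m * \<dots> = r ^ (m - c)"
  proof -
    \<comment> \<open>Independent nonzero symbols for the powers and factorials make this a pure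
      cancellation.\<close>
    have "A * M / F * (1 / M * (B * F / (G * A)) * (R * (G / B))) = R"
      if "A \<noteq> 0" "B \<noteq> 0" "F \<noteq> 0" "G \<noteq> 0" "M \<noteq> 0" for A B F G M R :: real
      using that by (simp add: field_simps)
    from this[of "real m ^ m" "real c ^ c" "fact m" "fact c" "real m + 1" "r ^ (m - c)"] show ?thesis
      using self_power_pos[of m] self_power_pos[of c] unfolding rho_def K_weight_def by simp
  qed
  finally show ?thesis using True by simp
next
  case False
  then have "(\<Sum>k\<in>{0..m}. K_weight m k * NM_coeff m k r c) = 0"
    by (intro sum.neutral) (auto simp: NM_coeff_def)
  with False show ?thesis by simp
qed

text \<open>Scalings and sums in \<open>K_map\<close> are definite descriptions over symmetric
  tensors. At each stage a symmetric tensor with the required pairings is therefore produced first;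
  \<open>N_sum_le\<close> and \<open>sum_K_weight\<close> supply the bounds for its
  existence.\<close>

lemma K_map_diag:
  assumes x: "x \<in> points (elts X)" and r: "0 \<le> r" "r \<le> 1"
    and dvd: "\<And>k. 0 < k \<Longrightarrow> k \<le> m \<Longrightarrow> k dvd n \<and> n > 0"
  defines "z \<equiv> K_map X m n (tpure m XW (diag m x r))"
  shows "z \<in> points (elts (stensor n XW))"
    and "f \<in> symmetric_tests n XW \<Longrightarrow> rho m * pairing (tensor n XW) f z =
      (\<Sum>S\<in>Pow {1..n}. (if card S \<le> m then r ^ (m - card S) else 0) * f (slots n x S))"
proof -
  define b where "b k = N_map X k n (M_map X m k (tpure m XW (diag m x r)))" for k
  have b: "b k \<in> points (elts (stensor n XW))"
    "\<And>f. f \<in> symmetric_tests n XW \<Longrightarrow>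
      pairing (tensor n XW) f (b k) = (\<Sum>S\<in>Pow {1..n}. NM_coeff m k r (card S) * f (slots n x S))" if "k \<le> m" for k
    unfolding b_def using NM_diag[OF x r that] dvd that by blast+
  have NM_le: "(\<Sum>S\<in>Pow {1..n}. NM_coeff m k r (card S) * f (slots n x S)) \<le> 1"
    and NM_nonneg: "0 \<le> (\<Sum>S\<in>Pow {1..n}. NM_coeff m k r (card S) * f (slots n x S))"
    if k: "k \<le> m" and f: "f \<in> points (tests (tensor n XW))" for k f
  proof -
    have "(\<Sum>S\<in>Pow {1..n}. NM_coeff m k r (card S) * f (slots n x S))
        = r ^ (m - k) * (\<Sum>S\<in>Pow {1..n}. (if card S = k then fact k else 0) * (1 / real k ^ k * f (slots n x S)))"
      unfolding sum_distrib_left by (rule sum.cong) (auto simp: NM_coeff_def)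
    also have "(\<Sum>S\<in>Pow {1..n}. (if card S = k then fact k else 0) * (1 / real k ^ k * f (slots n x S)))
        = (\<Sum>j\<in>Inj k n. 1 / real k ^ k * f (N_tuple X k n j (\<lambda>i\<in>{1..k}. x)))"
      unfolding N_tuple_const by (rule sum_injections[symmetric, where g = "\<lambda>S. 1 / real k ^ k * f (slots n x S)"])
    finally have eq: "(\<Sum>S\<in>Pow {1..n}. NM_coeff m k r (card S) * f (slots n x S))
        = r ^ (m - k) * (\<Sum>j\<in>Inj k n. 1 / real k ^ k * f (N_tuple X k n j (\<lambda>i\<in>{1..k}. x)))" .
    have "0 \<le> (\<Sum>j\<in>Inj k n. 1 / real k ^ k * f (N_tuple X k n j (\<lambda>i\<in>{1..k}. x)))"
      unfolding N_tuple_const using W.test_bounds(1)[OF f slots_in[OF x]] by (intro sum_nonneg) simp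
    moreover have "(\<Sum>j\<in>Inj k n. 1 / real k ^ k * f (N_tuple X k n j (\<lambda>i\<in>{1..k}. x))) \<le> 1"
      using x by (intro N_sum_le[OF f]) auto
    ultimately show "(\<Sum>S\<in>Pow {1..n}. NM_coeff m k r (card S) * f (slots n x S)) \<le> 1"
      "0 \<le> (\<Sum>S\<in>Pow {1..n}. NM_coeff m k r (card S) * f (slots n x S))"
      unfolding eq using r by (auto intro!: mult_le_one power_le_one mult_nonneg_nonneg)
  qed
  have w1: "K_weight m k \<le> 1" if "k \<le> m" for k
    using K_weight_bounds(2)[OF that] by (rule order_trans) simp
  have scaled: "\<exists>y. y \<in> points (elts (stensor n XW)) \<and> cscale (stensor n XW) (K_weight m k) (b k) = y \<and>
      (\<forall>f\<in>symmetric_tests n XW. pairing (tensor n XW) f y = K_weight m k * (\<Sum>S\<in>Pow {1..n}. NM_coeff m k r (card S) * f (slots n x S)))"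
    if k: "k \<le> m" for k
  proof -
    have sum_eq: "(\<Sum>S\<in>Pow {1..n}. K_weight m k * NM_coeff m k r (card S) * f (slots n x S))
        = K_weight m k * (\<Sum>S\<in>Pow {1..n}. NM_coeff m k r (card S) * f (slots n x S))" for f
      unfolding sum_distrib_left by (simp add: mult.assoc)
    obtain y where y: "y \<in> points (elts (stensor n XW))"
      "\<And>f. f \<in> points (tests (tensor n XW)) \<Longrightarrow>
        pairing (tensor n XW) f y = (\<Sum>S\<in>Pow {1..n}. K_weight m k * NM_coeff m k r (card S) * f (slots n x S))"
    proof (rule size_comb_ex[OF x, of "\<lambda>c. K_weight m k * NM_coeff m k r c" n])
      show "0 \<le> K_weight m k * NM_coeff m k r c \<and> K_weight m k * NM_coeff m k r c \<le> 1" for c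
        using K_weight_bounds(1)[OF k] w1[OF k] NM_coeff_bounds[OF r, of m k c] by (auto intro!: mult_le_one)
      show "(\<Sum>S\<in>Pow {1..n}. K_weight m k * NM_coeff m k r (card S) * f (slots n x S)) \<le> 1"
        if "f \<in> points (tests (tensor n XW))" for f
        unfolding sum_eq using K_weight_bounds(1)[OF k] w1[OF k] NM_le[OF k that] NM_nonneg[OF k that]
        by (intro mult_le_one)
    qed (rule that)
    have "cscale (stensor n XW) (K_weight m k) (b k) = y"
      using y(2) b(2)[OF k] by (intro W.cscale_stensor[OF y(1)]) (simp add: sum_eq symmetric_tests_iff)
    with y show ?thesis
      by (intro exI[of _ y]) (simp add: sum_eq symmetric_tests_iff)
  qed
  \<comment> \<open>After interchanging the sums, the coefficient of \<open>slots n x S\<close>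
    still depends only on the size of \<open>S\<close>.\<close>
  define \<gamma> where "\<gamma> c = (\<Sum>k\<in>{0..m}. K_weight m k * NM_coeff m k r c)" for c
  have \<gamma>_sum: "(\<Sum>S\<in>Pow {1..n}. \<gamma> (card S) * f (slots n x S))
      = (\<Sum>k\<in>{0..m}. K_weight m k * (\<Sum>S\<in>Pow {1..n}. NM_coeff m k r (card S) * f (slots n x S)))" for f
    unfolding \<gamma>_def sum_distrib_right sum_distrib_left by (subst sum.swap) (simp add: mult.assoc)
  obtain y where y: "y \<in> points (elts (stensor n XW))"
    "\<And>f. f \<in> points (tests (tensor n XW)) \<Longrightarrow>
      pairing (tensor n XW) f y = (\<Sum>S\<in>Pow {1..n}. \<gamma> (card S) * f (slots n x S))"
  proof (rule size_comb_ex[OF x, of \<gamma> n])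
    have le: "(\<Sum>k\<in>{0..m}. K_weight m k * u k) \<le> 1" if "\<And>k. k \<le> m \<Longrightarrow> u k \<le> 1" for u
    proof -
      have "(\<Sum>k\<in>{0..m}. K_weight m k * u k) \<le> (\<Sum>k\<in>{0..m}. K_weight m k)"
        using that K_weight_bounds(1) by (intro sum_mono mult_left_le) auto
      with sum_K_weight[of m] show ?thesis by linarith
    qed
    show "0 \<le> \<gamma> c \<and> \<gamma> c \<le> 1" for c
      unfolding \<gamma>_def using NM_coeff_bounds[OF r] K_weight_bounds(1) le[of "\<lambda>k. NM_coeff m k r c"]
      by (auto intro!: sum_nonneg)
    show "(\<Sum>S\<in>Pow {1..n}. \<gamma> (card S) * f (slots n x S)) \<le> 1" if "f \<in> points (tests (tensor n XW))" for f
      unfolding \<gamma>_sum by (rule le) (rule NM_le[OF _ that])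
  qed (rule that)
  have "z = csum (stensor n XW) {0..m} (\<lambda>k. cscale (stensor n XW) (K_weight m k) (b k))"
    by (simp add: z_def K_map_def b_def K_weight_def)
  also have "\<dots> = y"
  proof (rule W.csum_stensor[OF y(1)])
    fix f assume f: "f \<in> symmetric_tests n XW"
    have "pairing (tensor n XW) f y = (\<Sum>k\<in>{0..m}. K_weight m k * (\<Sum>S\<in>Pow {1..n}. NM_coeff m k r (card S) * f (slots n x S)))"
      using y(2)[of f] f by (simp add: \<gamma>_sum symmetric_tests_iff)
    also have "\<dots> = (\<Sum>k\<in>{0..m}. pairing (tensor n XW) f (cscale (stensor n XW) (K_weight m k) (b k)))"
    proof (rule sum.cong[OF refl])
      fix k assume "k \<in> {0..m}"
      then have "k \<le> m" by simp
      from scaled[OF this] f show "K_weight m k * (\<Sum>S\<in>Pow {1..n}. NM_coeff m k r (card S) * f (slots n x S)) =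
          pairing (tensor n XW) f (cscale (stensor n XW) (K_weight m k) (b k))" by auto
    qed
    finally show "pairing (tensor n XW) f y = (\<Sum>k\<in>{0..m}. pairing (tensor n XW) f (cscale (stensor n XW) (K_weight m k) (b k)))" .
  qed
  finally have zy: "z = y" .
  show "z \<in> points (elts (stensor n XW))" using zy y by simp
  show "rho m * pairing (tensor n XW) f z =
      (\<Sum>S\<in>Pow {1..n}. (if card S \<le> m then r ^ (m - card S) else 0) * f (slots n x S))" if "f \<in> symmetric_tests n XW"
  proof -
    have "rho m * pairing (tensor n XW) f z = (\<Sum>S\<in>Pow {1..n}. (rho m * \<gamma> (card S)) * f (slots n x S))"
      using y(2)[of f] that zy by (simp add: symmetric_tests_iff sum_distrib_left mult.assoc)
    then show ?thesis
      unfolding \<gamma>_def rho_K_NM .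
  qed
qed

end

section \<open>Tests of the exponential\<close>

subsection \<open>Polarization\<close>

text \<open>Polarization without negative coefficients in X: the points \<open>y s\<close> are
  partial sums of the \<open>x i\<close>, scaled by \<open>1 / n\<close> so that they exist, and the
  signs are applied to the values of the form. The signed sum over the cube is a positive multiple
  of the value at \<open>x\<close>.\<close>

lemma (in tame_cqbs) symmetric_test_diagonal_eqI:
  assumes f: "f \<in> symmetric_tests n X" and g: "g \<in> symmetric_tests n X"
    and eq: "\<And>y. y \<in> points (elts X) \<Longrightarrow> f (\<lambda>i\<in>{1..n}. y) = g (\<lambda>i\<in>{1..n}. y)"
  shows "f = g"
proof (rule extensionalityI)
  have ft: "f \<in> points (tests (tensor n X))" and gt: "g \<in> points (tests (tensor n X))"
    using f g by (auto simp: symmetric_tests_iff)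
  show "f \<in> extensional (tuple_set n X)" "g \<in> extensional (tuple_set n X)"
    using test_ext[OF ft] test_ext[OF gt] .
  fix x assume x: "x \<in> tuple_set n X"
  let ?N = "{1..n}"
  let ?B = "?N \<rightarrow>\<^sub>E {0, 1 :: real}"
  let ?surj = "{c \<in> ?N \<rightarrow>\<^sub>E ?N. c ` ?N = ?N}"
  have "\<exists>y. y \<in> points (elts X) \<and> (\<forall>\<eta>\<in>points (tests X). pairing X \<eta> y = (\<Sum>i\<in>?N. s i / real n * pairing X \<eta> (x i)))"
    if s: "s \<in> ?B" for s
  proof -
    have s01: "0 \<le> s i" "s i \<le> 1" if "i \<in> ?N" for i
      using PiE_mem[OF s that] by auto
    have "(\<Sum>i\<in>?N. s i / real n) \<le> (\<Sum>i\<in>?N. 1 / real n)"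
      using s01 by (intro sum_mono divide_right_mono) auto
    also have "\<dots> \<le> 1" by simp
    finally show ?thesis
      using convex_comb_ex[of ?N "\<lambda>i. s i / real n" x] s01 PiE_mem[OF x] by auto
  qed
  then have "\<forall>s\<in>?B. \<exists>y. y \<in> points (elts X) \<and>
      (\<forall>\<eta>\<in>points (tests X). pairing X \<eta> y = (\<Sum>i\<in>?N. s i / real n * pairing X \<eta> (x i)))"
    by blast
  from bchoice[OF this] obtain y where y: "\<And>s. s \<in> ?B \<Longrightarrow> y s \<in> points (elts X)"
    "\<And>s \<eta>. s \<in> ?B \<Longrightarrow> \<eta> \<in> points (tests X) \<Longrightarrow> pairing X \<eta> (y s) = (\<Sum>i\<in>?N. s i / real n * pairing X \<eta> (x i))"
    by blast
  define wt where "wt s = (\<Prod>i\<in>?N. 2 * s i - 1)" for s :: "nat \<Rightarrow> real"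
  \<comment> \<open>Weighting the vertices of the cube with signs kills every \<open>c\<close> that misses an index.\<close>
  have cube: "(\<Sum>s\<in>?B. wt s * (\<Prod>k\<in>?N. s (c k) / real n)) = (if c \<in> ?surj then 1 / real n ^ n else 0)"
    if c: "c \<in> ?N \<rightarrow>\<^sub>E ?N" for c
  proof -
    \<comment> \<open>As \<open>s\<close> takes only the values 0 and 1, repeated factors collapse
      and the product depends only on the image of \<open>c\<close>; the sum over the cube then
      factors index by index.\<close>
    have step: "(\<Prod>k\<in>?N. s (c k)) = (\<Prod>i\<in>?N. if i \<in> c ` ?N then s i else 1)" if s: "s \<in> ?B" for s
    proof (cases "\<forall>i\<in>c ` ?N. s i = 1")
      case True
      then have "(\<Prod>k\<in>?N. s (c k)) = 1" "(\<Prod>i\<in>?N. if i \<in> c ` ?N then s i else 1) = 1"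
        by (auto intro!: prod.neutral)
      then show ?thesis by simp
    next
      case False
      then obtain k where k: "k \<in> ?N" "s (c k) \<noteq> 1" by auto
      then have ck: "c k \<in> ?N" "s (c k) = 0"
        using PiE_mem[OF c k(1)] PiE_mem[OF s, of "c k"] by auto
      have "(\<Prod>k\<in>?N. s (c k)) = 0"
        using k(1) ck(2) by (intro prod_zero) auto
      moreover have "(\<Prod>i\<in>?N. if i \<in> c ` ?N then s i else 1) = 0"
        using k(1) ck by (intro prod_zero bexI[of _ "c k"]) auto
      ultimately show ?thesis by (simp only:)
    qed
    have "(\<Sum>s\<in>?B. wt s * (\<Prod>k\<in>?N. s (c k) / real n)) =
        (\<Sum>s\<in>?B. (\<Prod>i\<in>?N. (2 * s i - 1) * (if i \<in> c ` ?N then s i else 1)) / real n ^ n)"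
    proof (rule sum.cong[OF refl])
      fix s assume s: "s \<in> ?B"
      show "wt s * (\<Prod>k\<in>?N. s (c k) / real n) = (\<Prod>i\<in>?N. (2 * s i - 1) * (if i \<in> c ` ?N then s i else 1)) / real n ^ n"
        unfolding prod_dividef prod.distrib step[OF s] wt_def by simp
    qed
    also have "\<dots> = (\<Sum>s\<in>?B. \<Prod>i\<in>?N. (2 * s i - 1) * (if i \<in> c ` ?N then s i else 1)) / real n ^ n"
      by (simp add: sum_divide_distrib)
    also have "(\<Sum>s\<in>?B. \<Prod>i\<in>?N. (2 * s i - 1) * (if i \<in> c ` ?N then s i else 1))
        = (\<Prod>i\<in>?N. \<Sum>v\<in>{0, 1}. (2 * v - 1) * (if i \<in> c ` ?N then v else 1))"
      by (rule prod_sum_PiE[symmetric]) auto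
    \<comment> \<open>An index hit by \<open>c\<close> contributes \<open>(-1) * 0 + 1 * 1\<close>,
      a missed one \<open>-1 + 1\<close>.\<close>
    also have "\<dots> = (\<Prod>i\<in>?N. if i \<in> c ` ?N then 1 else 0)"
      by (rule prod.cong) auto
    also have "\<dots> = (if c \<in> ?surj then 1 else 0)"
    proof (cases "c ` ?N = ?N")
      case True
      then show ?thesis using c by (simp add: prod.neutral)
    next
      case False
      then obtain i where "i \<in> ?N" "i \<notin> c ` ?N"
        using PiE_mem[OF c] by blast
      then have "(\<Prod>i\<in>?N. if i \<in> c ` ?N then 1 else 0 :: real) = 0"
        by (intro prod_zero bexI[of _ i]) auto
      with False show ?thesis by simp
    qed
    finally show ?thesis by simp
  qed
  have main: "(\<Sum>s\<in>?B. wt s * h (\<lambda>i\<in>?N. y s)) = real (card ?surj) / real n ^ n * h x"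
    if h: "h \<in> symmetric_tests n X" for h
  proof -
    have ht: "h \<in> points (tests (tensor n X))"
      using h by (simp add: symmetric_tests_iff)
    have "(\<Sum>s\<in>?B. wt s * h (\<lambda>i\<in>?N. y s)) =
        (\<Sum>s\<in>?B. wt s * (\<Sum>c\<in>?N \<rightarrow>\<^sub>E ?N. (\<Prod>k\<in>?N. s (c k) / real n) * h (\<lambda>k\<in>?N. x (c k))))"
    proof (rule sum.cong[OF refl])
      fix s assume s: "s \<in> ?B"
      have "h (\<lambda>i\<in>?N. y s) = (\<Sum>c\<in>?N \<rightarrow>\<^sub>E ?N. (\<Prod>k\<in>?N. s (c k) / real n) * h (\<lambda>k\<in>?N. x (c k)))"
        by (rule test_expand[OF ht, where w = "\<lambda>_ i. s i / real n" and v = "\<lambda>_ i. x i"])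
          (use y[OF s] PiE_mem[OF x] in auto)
      then show "wt s * h (\<lambda>i\<in>?N. y s) = wt s * (\<Sum>c\<in>?N \<rightarrow>\<^sub>E ?N. (\<Prod>k\<in>?N. s (c k) / real n) * h (\<lambda>k\<in>?N. x (c k)))"
        by simp
    qed
    also have "\<dots> = (\<Sum>c\<in>?N \<rightarrow>\<^sub>E ?N. (\<Sum>s\<in>?B. wt s * (\<Prod>k\<in>?N. s (c k) / real n)) * h (\<lambda>k\<in>?N. x (c k)))"
      unfolding sum_distrib_left sum_distrib_right by (subst sum.swap) (simp add: mult.assoc)
    also have "\<dots> = (\<Sum>c\<in>?N \<rightarrow>\<^sub>E ?N. (if c \<in> ?surj then 1 / real n ^ n else 0) * h (\<lambda>k\<in>?N. x (c k)))"
      by (rule sum.cong[OF refl]) (simp only: cube)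
    also have "\<dots> = (\<Sum>c\<in>?surj. 1 / real n ^ n * h (\<lambda>k\<in>?N. x (c k)))"
      by (rule sum.mono_neutral_cong_right) (auto intro: finite_PiE)
    also have "\<dots> = (\<Sum>c\<in>?surj. 1 / real n ^ n * h x)"
    proof (rule sum.cong[OF refl])
      fix c assume c: "c \<in> ?surj"
      \<comment> \<open>A surjection of a finite set onto itself is a permutation, so symmetry makes
        every surviving term a multiple of \<open>h x\<close>.\<close>
      define \<sigma> where "\<sigma> i = (if i \<in> ?N then c i else i)" for i
      have "inj_on c ?N"
        using c by (intro eq_card_imp_inj_on) auto
      then have "bij_betw c ?N ?N"
        using c by (simp add: bij_betw_def)
      then have "bij_betw \<sigma> ?N ?N"
        by (subst bij_betw_cong[of _ _ c]) (auto simp: \<sigma>_def)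
      then have \<sigma>: "\<sigma> permutes ?N"
        by (rule bij_imp_permutes) (auto simp: \<sigma>_def)
      have "(\<lambda>k\<in>?N. x (c k)) = tuple_perm n \<sigma> x"
        unfolding tuple_perm_def by (rule restrict_ext) (simp add: \<sigma>_def)
      then show "1 / real n ^ n * h (\<lambda>k\<in>?N. x (c k)) = 1 / real n ^ n * h x"
        using h \<sigma> x by (simp add: symmetric_tests_iff)
    qed
    also have "\<dots> = real (card ?surj) / real n ^ n * h x"
      by simp
    finally show ?thesis .
  qed
  \<comment> \<open>The factor is the same for \<open>f\<close> and \<open>g\<close>, so it only has
    to be nonzero; the identity is a witness.\<close>
  have "card ?surj \<noteq> 0"
  proof -
    have "restrict id ?N \<in> ?surj" by auto
    moreover have "finite ?surj"
      by (rule finite_subset[of _ "?N \<rightarrow>\<^sub>E ?N"]) (auto intro!: finite_PiE)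
    ultimately have "0 < card ?surj"
      by (subst card_gt_0_iff) blast
    then show ?thesis by simp
  qed
  then have "real (card ?surj) / real n ^ n \<noteq> 0"
    using self_power_pos[of n] by simp
  moreover have "(\<Sum>s\<in>?B. wt s * f (\<lambda>i\<in>?N. y s)) = (\<Sum>s\<in>?B. wt s * g (\<lambda>i\<in>?N. y s))"
    using eq[OF y(1)] by (intro sum.cong) auto
  ultimately show "f x = g x"
    unfolding main[OF f] main[OF g] by (simp only: mult_cancel_left) blast
qed

subsection \<open>Uniqueness of power series coefficients\<close>

text \<open>Equality is given only to the right of 0. With all lower coefficients of the difference
  already zero, divide by \<open>t ^ k\<close> and let \<open>t\<close> tend to 0 from the right;
  the bounds on the coefficients ensure convergence.\<close>

lemma power_series_unique:
  fixes a b :: "nat \<Rightarrow> real"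
  assumes bd: "\<And>k. 0 \<le> a k \<and> a k \<le> 1" "\<And>k. 0 \<le> b k \<and> b k \<le> 1"
    and eq: "\<And>t. 0 < t \<Longrightarrow> t < 1 \<Longrightarrow> (\<Sum>k. a k * t ^ k) = (\<Sum>k. b k * t ^ k)"
  shows "a = b"
proof -
  define d where "d k = a k - b k" for k
  have d1: "\<bar>d k\<bar> \<le> 1" for k
    using bd[of k] by (auto simp: d_def)
  have summ: "summable (\<lambda>i. c i * t ^ i)" if "\<bar>t\<bar> < 1" "\<And>k. \<bar>c k\<bar> \<le> 1" for c :: "nat \<Rightarrow> real" and t
  proof (rule summable_comparison_test)
    show "\<exists>N. \<forall>n\<ge>N. norm (c n * t ^ n) \<le> \<bar>t\<bar> ^ n"
      using that(2) by (auto simp: abs_mult power_abs mult_left_le_one_le)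
    show "summable (\<lambda>n. \<bar>t\<bar> ^ n)" using that by (intro summable_geometric) auto
  qed
  have zero: "(\<Sum>k. d k * t ^ k) = 0" if "0 < t" "t < 1" for t
  proof -
    have "(\<Sum>k. d k * t ^ k) = (\<Sum>k. a k * t ^ k - b k * t ^ k)"
      by (simp add: d_def algebra_simps)
    also have "\<dots> = (\<Sum>k. a k * t ^ k) - (\<Sum>k. b k * t ^ k)"
      using that bd by (intro suminf_diff[symmetric] summ) auto
    finally show ?thesis using eq[OF that] by simp
  qed
  have "d k = 0" for k
  proof (induction k rule: less_induct)
    case (less k)
    have shift: "(\<Sum>i. d (i + k) * t ^ i) = 0" if t: "0 < t" "t < 1" for t
    proof -
      have "(\<Sum>i. d i * t ^ i) = (\<Sum>i. d (i + k) * t ^ (i + k)) + (\<Sum>i<k. d i * t ^ i)"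
        using t by (intro suminf_split_initial_segment summ d1) auto
      also have "(\<Sum>i<k. d i * t ^ i) = 0"
        using less by simp
      also have "(\<Sum>i. d (i + k) * t ^ (i + k)) = t ^ k * (\<Sum>i. d (i + k) * t ^ i)"
        using summ[of t "\<lambda>i. d (i + k)"] d1 t by (subst suminf_mult[symmetric]) (auto simp: power_add mult_ac)
      finally show ?thesis using zero[OF t] t by simp
    qed
    have "((\<lambda>t. \<Sum>i. d (i + k) * t ^ i) \<longlongrightarrow> d (0 + k)) (at 0)"
      by (rule powser_limit_0[where s = 1]) (use summ[of _ "\<lambda>i. d (i + k)"] d1 in \<open>auto intro: summable_sums\<close>)
    then have lim: "((\<lambda>t. \<Sum>i. d (i + k) * t ^ i) \<longlongrightarrow> d (0 + k)) (at_right 0)"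
      by (rule filterlim_mono) (auto simp: at_within_le_at)
    have "\<forall>\<^sub>F t :: real in at_right 0. (\<Sum>i. d (i + k) * t ^ i) = 0"
      unfolding eventually_at_right_field by (intro exI[of _ 1]) (auto intro: shift)
    then have "((\<lambda>t. \<Sum>i. d (i + k) * t ^ i) \<longlongrightarrow> 0) (at_right 0)"
      by (rule tendsto_eventually)
    with lim show ?case
      using tendsto_unique[OF trivial_limit_at_right_real] by fastforce
  qed
  then show ?thesis by (auto simp: d_def fun_eq_iff)
qed

text \<open>The exponent is \<open>m - k\<close> because \<open>r\<close> counts the slots that do
  not hold \<open>x\<close>. The difference is a polynomial that vanishes on the infinite set
  \<open>[0, 1]\<close>.\<close>

lemma polynomial_coeffs_unique:
  fixes a b :: "nat \<Rightarrow> real"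
  assumes eq: "\<And>r. 0 \<le> r \<Longrightarrow> r \<le> 1 \<Longrightarrow> (\<Sum>k\<le>m. r ^ (m - k) * a k) = (\<Sum>k\<le>m. r ^ (m - k) * b k)"
    and k: "k \<le> m"
  shows "a k = b k"
proof (rule ccontr)
  assume ne: "a k \<noteq> b k"
  define c where "c i = a (m - i) - b (m - i)" for i
  have "(\<Sum>i\<le>m. c i * r ^ i) = 0" if r: "0 \<le> r" "r \<le> 1" for r
  proof -
    have "(\<Sum>i\<le>m. c i * r ^ i) = (\<Sum>k\<le>m. c (m - k) * r ^ (m - k))"
      by (rule sum.reindex_bij_witness[where i = "\<lambda>i. m - i" and j = "\<lambda>i. m - i"]) auto
    also have "\<dots> = (\<Sum>k\<le>m. r ^ (m - k) * a k - r ^ (m - k) * b k)"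
      by (rule sum.cong) (auto simp: c_def algebra_simps)
    also have "\<dots> = 0"
      using eq[OF r] by (simp add: sum_subtractf)
    finally show ?thesis .
  qed
  then have "{0..1} \<subseteq> {r :: real. (\<Sum>i\<le>m. c i * r ^ i) = 0}" by auto
  \<comment> \<open>The disagreement at \<open>k\<close> is a nonzero coefficient at the exponent
    \<open>m - k\<close>.\<close>
  moreover have "finite {r :: real. (\<Sum>i\<le>m. c i * r ^ i) = 0}"
    using Transcendental.polyfun_rootbound[where c = c and k = "m - k" and n = m] ne k by (auto simp: c_def)
  ultimately have "finite {0..1 :: real}"
    by (rule finite_subset)
  then show False
    using infinite_Icc[of "0 :: real" 1] by simp
qed

subsection \<open>Tests are determined by their values on the diagonal\<close>

lemma rho_pos: "0 < rho m"
  using self_power_pos[of m] by (simp add: rho_def)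

lemma SUP_partial_sums:
  fixes c :: "nat \<Rightarrow> real"
  assumes "\<And>k. 0 \<le> c k"
  shows "(SUP n. ennreal (\<Sum>k\<le>n. c k)) = (\<Sum>k. ennreal (c k))"
proof -
  have eq: "ennreal (\<Sum>k\<le>n. c k) = (\<Sum>k\<le>n. ennreal (c k))" for n
    using assms by (simp add: sum_ennreal)
  have "incseq (\<lambda>n. \<Sum>k\<le>n. ennreal (c k))"
    by (auto intro!: incseq_SucI)
  from LIMSEQ_SUP[OF this] show ?thesis
    unfolding eq using summable_LIMSEQ'[OF summableI, of "\<lambda>k. ennreal (c k)"] LIMSEQ_unique by blast
qed

lemma sum_Pow_by_card:
  fixes g :: "nat set \<Rightarrow> real" and w :: "nat \<Rightarrow> real"
  shows "(\<Sum>S\<in>Pow {1..n}. (if card S \<le> m then w (card S) else 0) * g S)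
    = (\<Sum>k\<le>m. w k * (\<Sum>S\<in>{S \<in> Pow {1..n}. card S = k}. g S))"
proof -
  have "(\<Sum>k\<le>m. w k * (\<Sum>S\<in>{S \<in> Pow {1..n}. card S = k}. g S))
      = (\<Sum>k\<le>m. \<Sum>S\<in>{S \<in> {S \<in> Pow {1..n}. card S \<le> m}. card S = k}. w (card S) * g S)"
    unfolding sum_distrib_left by (intro sum.cong) auto
  also have "\<dots> = (\<Sum>S\<in>{S \<in> Pow {1..n}. card S \<le> m}. w (card S) * g S)"
    by (rule sum.group) auto
  also have "\<dots> = (\<Sum>S\<in>Pow {1..n}. (if card S \<le> m then w (card S) else 0) * g S)"
    by (rule sum.mono_neutral_cong_left) auto
  finally show ?thesis by simp
qed

context separated_cqbs
begin

lemma test_diag_expand: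
  assumes f: "f \<in> points (tests (tensor n XW))" and x: "x \<in> points (elts X)" and r: "0 \<le> r" "r \<le> 1"
  shows "f (diag n x r) = (\<Sum>S\<in>Pow {1..n}. r ^ (n - card S) * f (slots n x S))"
proof -
  let ?N = "{1..n}"
  define w where "w b = (if b then 1 else r)" for b
  define v where "v b = (if b then (x, 0) else (czero X, 1 :: real))" for b
  have "f (diag n x r) = (\<Sum>c\<in>?N \<rightarrow>\<^sub>E UNIV. (\<Prod>k\<in>?N. w (c k)) * f (\<lambda>k\<in>?N. v (c k)))"
  proof (rule W.test_expand[OF f])
    fix \<eta> assume "\<eta> \<in> points (tests XW)"
    then show "pairing XW \<eta> (x, r) = (\<Sum>i\<in>UNIV. w i * pairing XW \<eta> (v i))"
      using pairing_czero[of "fst \<eta>"] by (simp add: UNIV_bool test_with_W_iff) (simp add: w_def v_def)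
  qed (use x r czero_in in \<open>auto simp: elt_with_W v_def\<close>)
  also have "\<dots> = (\<Sum>S\<in>Pow ?N. r ^ (n - card S) * f (slots n x S))"
  proof (rule sum.reindex_bij_witness[where i = "\<lambda>S. \<lambda>q\<in>?N. q \<in> S" and j = "\<lambda>c. {q \<in> ?N. c q}"])
    fix c assume c: "c \<in> ?N \<rightarrow>\<^sub>E (UNIV :: bool set)"
    let ?S = "{q \<in> ?N. c q}"
    show "(\<lambda>q\<in>?N. q \<in> ?S) = c"
      using c by (auto simp: fun_eq_iff PiE_iff extensional_def)
    have "(\<Prod>k\<in>?N. w (c k)) = (\<Prod>k\<in>?N - ?S. r)"
      by (rule prod.mono_neutral_cong_right) (auto simp: w_def)
    also have "\<dots> = r ^ card (?N - ?S)"
      by (rule prod_constant)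
    also have "card (?N - ?S) = n - card ?S"
      by (subst card_Diff_subset) auto
    finally have "(\<Prod>k\<in>?N. w (c k)) = r ^ (n - card ?S)" .
    moreover have "(\<lambda>k\<in>?N. v (c k)) = slots n x ?S"
      unfolding slots_def by (rule restrict_ext) (auto simp: v_def)
    ultimately show "r ^ (n - card ?S) * f (slots n x ?S) = (\<Prod>k\<in>?N. w (c k)) * f (\<lambda>k\<in>?N. v (c k))"
      by simp
  qed auto
  finally show ?thesis .
qed

lemma test_slots_scale:
  assumes f: "f \<in> points (tests (tensor n XW))" and x: "x \<in> points (elts X)" and y: "y \<in> points (elts X)"
    and y_eq: "\<And>\<eta>. \<eta> \<in> points (tests X) \<Longrightarrow> pairing X \<eta> y = t * pairing X \<eta> x" and S: "S \<subseteq> {1..n}"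
  shows "f (slots n y S) = t ^ card S * f (slots n x S)"
proof -
  define w where "w q = (if q \<in> S then t else 1)" for q
  have "f (slots n y S) = f (\<lambda>q\<in>{1..n}. slots n y S q)"
    by (simp add: slots_def cong: restrict_cong)
  \<comment> \<open>An expansion with one summand per slot moves a scalar out of every slot; only
    the slots in \<open>S\<close> carry the factor \<open>t\<close>.\<close>
  also have "\<dots> = (\<Sum>c\<in>{1..n} \<rightarrow>\<^sub>E {()}. (\<Prod>q\<in>{1..n}. w q) * f (\<lambda>q\<in>{1..n}. slots n x S q))"
  proof (rule W.test_expand[OF f])
    fix \<eta> q assume "\<eta> \<in> points (tests XW)" "q \<in> {1..n}"
    then show "pairing XW \<eta> (slots n y S q) = (\<Sum>i\<in>{()}. w q * pairing XW \<eta> (slots n x S q))"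
      using y_eq[of "fst \<eta>"] by (auto simp: slots_def w_def test_with_W_iff)
  qed (use PiE_mem[OF slots_in[OF x]] PiE_mem[OF slots_in[OF y]] in auto)
  also have "\<dots> = (\<Prod>q\<in>{1..n}. w q) * f (slots n x S)"
    by (simp add: slots_def card_PiE cong: restrict_cong)
  also have "(\<Prod>q\<in>{1..n}. w q) = (\<Prod>q\<in>S. t)"
    using S by (intro prod.mono_neutral_cong_right) (auto simp: w_def)
  finally show ?thesis by simp
qed

text \<open>A test of \<open>!X\<close> consists of functions on tensors. The \<open>q n\<close> are
  the forms on tuples behind them, normalized by \<open>rho n\<close> so that they are tests of the
  tensor powers.\<close>

definition represents :: "(nat \<Rightarrow> ('a \<times> real) tens \<Rightarrow> real) \<Rightarrow> (nat \<Rightarrow> (nat \<Rightarrow> 'a \<times> real) \<Rightarrow> real) \<Rightarrow> bool" where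
  "represents \<phi> q \<longleftrightarrow> \<phi> \<in> points (bang_tests X) \<and> (\<forall>n. q n \<in> symmetric_tests n XW \<and>
     (\<forall>a\<in>points (elts (tensor n XW)). \<phi> n a = rho n * pairing (tensor n XW) (q n) a))"

text \<open>\<open>\<phi> n / rho n\<close> is a linear map into W, and the value of its adjoint at
  the test 1 is the required form. Pairing with pure tensors transfers the symmetry.\<close>

lemma bang_test_rep:
  assumes \<phi>: "\<phi> \<in> points (bang_tests X)"
  shows "\<exists>q. represents \<phi> q"
proof -
  have "\<exists>q. q \<in> symmetric_tests n XW \<and> (\<forall>a\<in>points (elts (tensor n XW)). \<phi> n a = rho n * pairing (tensor n XW) q a)" for n
  proof -
    have lin: "(\<lambda>a\<in>points (elts (tensor n XW)). \<phi> n a / rho n) \<in> linear_maps (tensor n XW) W_cqbs"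
      and sym: "\<And>\<sigma> a. \<sigma> permutes {1..n} \<Longrightarrow> a \<in> points (elts (tensor n XW)) \<Longrightarrow> \<phi> n (tperm n XW \<sigma> a) = \<phi> n a"
      using \<phi> by (auto simp: bang_tests_def)
    obtain h where h: "h \<in> qbs_hom unit_qbs (tests (tensor n XW))"
      and h_eq: "\<And>a s. a \<in> points (elts (tensor n XW)) \<Longrightarrow> s \<in> {0..1} \<Longrightarrow> s * (\<phi> n a / rho n) = pairing (tensor n XW) (h s) a"
      using lin by (auto simp: linear_maps_def)
    define q where "q = h 1"
    have q: "q \<in> points (tests (tensor n XW))"
      unfolding q_def by (rule qbs_hom_points[OF h]) simp
    have val: "\<phi> n a = rho n * pairing (tensor n XW) q a" if "a \<in> points (elts (tensor n XW))" for a
      using h_eq[OF that, of 1] rho_pos[of n] by (simp add: q_def field_simps)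
    have "q (tuple_perm n \<sigma> y) = q y" if \<sigma>: "\<sigma> permutes {1..n}" and y: "y \<in> tuple_set n XW" for \<sigma> y
    proof -
      have a: "tpure n XW y \<in> points (elts (tensor n XW))"
        by (rule W.tpure_in[OF y])
      have "pairing (tensor n XW) (perm_test n XW \<sigma> q) (tpure n XW y) = pairing (tensor n XW) q (tpure n XW y)"
        using sym[OF \<sigma> a] val[OF a] val[OF W.tperm_props(1)[OF \<sigma> a]] W.tperm_props(2)[OF \<sigma> a q] rho_pos[of n] by simp
      then show ?thesis
        using W.pairing_tpure[OF y q] W.pairing_tpure[OF y W.perm_test_in[OF \<sigma> q]] y by (simp add: perm_test_def)
    qed
    with q val show ?thesis
      by (intro exI[of _ q]) (simp add: symmetric_tests_iff)
  qed
  then have "\<forall>n. \<exists>q. q \<in> symmetric_tests n XW \<and> (\<forall>a\<in>points (elts (tensor n XW)). \<phi> n a = rho n * pairing (tensor n XW) q a)"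
    by blast
  from choice[OF this] show ?thesis
    using \<phi> unfolding represents_def by blast
qed

text \<open>The coefficient \<open>A n k x\<close> of the overview, with the factor
  \<open>rho n\<close> included.\<close>

definition level_sum :: "(nat \<Rightarrow> (nat \<Rightarrow> 'a \<times> real) \<Rightarrow> real) \<Rightarrow> nat \<Rightarrow> nat \<Rightarrow> 'a \<Rightarrow> real" where
  "level_sum q n k x = (\<Sum>S\<in>{S \<in> Pow {1..n}. card S = k}. rho n * q n (slots n x S))"

context
  fixes \<phi> q
  assumes rep: "represents \<phi> q"
begin

lemma q_symmetric: "q n \<in> symmetric_tests n XW"
  using rep by (simp add: represents_def)

lemma q_test: "q n \<in> points (tests (tensor n XW))"
  using q_symmetric[of n] by (simp add: symmetric_tests_iff)

lemma q_val: "a \<in> points (elts (tensor n XW)) \<Longrightarrow> \<phi> n a = rho n * pairing (tensor n XW) (q n) a"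
  using rep by (simp add: represents_def)

lemma test_diag_value:
  assumes x: "x \<in> points (elts X)" and r: "0 \<le> r" "r \<le> 1"
  shows "\<phi> n (tpure n XW (diag n x r)) = rho n * q n (diag n x r)"
  using q_val[OF W.tpure_in[OF diag_in[OF x r]]] W.pairing_tpure[OF diag_in[OF x r] q_test] by simp

lemma diag_level_sum:
  assumes x: "x \<in> points (elts X)" and r: "0 \<le> r" "r \<le> 1"
  shows "rho n * q n (diag n x r) = (\<Sum>k\<le>n. r ^ (n - k) * level_sum q n k x)"
proof -
  have "card S \<le> n" if "S \<in> Pow {1..n}" for S
    using that card_mono[of "{1..n}" S] by simp
  then have "rho n * q n (diag n x r) = (\<Sum>S\<in>Pow {1..n}. (if card S \<le> n then r ^ (n - card S) else 0) * (rho n * q n (slots n x S)))"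
    unfolding test_diag_expand[OF q_test x r] sum_distrib_left by (intro sum.cong) auto
  also have "\<dots> = (\<Sum>k\<le>n. r ^ (n - k) * level_sum q n k x)"
    unfolding level_sum_def by (rule sum_Pow_by_card[where w = "\<lambda>k. r ^ (n - k)"])
  finally show ?thesis .
qed

text \<open>The compatibility condition between degrees \<open>m\<close> and \<open>n\<close>,
  evaluated at a diagonal tensor, writes the value in degree \<open>m\<close> with coefficients of
  degree \<open>n\<close>. \<open>diag_level_sum\<close> writes it with those of degree
  \<open>m\<close>, and the two polynomials in \<open>r\<close> can be compared.\<close>

lemma level_sum_diag:
  assumes x: "x \<in> points (elts X)" and r: "0 \<le> r" "r \<le> 1"
    and mn: "m \<le> n" and dvd: "\<And>k. 0 < k \<Longrightarrow> k \<le> m \<Longrightarrow> k dvd n \<and> n > 0"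
  shows "rho m * q m (diag m x r) = (\<Sum>k\<le>m. r ^ (m - k) * level_sum q n k x)"
proof -
  let ?a = "tpure m XW (diag m x r)"
  have K: "K_map X m n ?a \<in> points (elts (stensor n XW))"
    "rho m * pairing (tensor n XW) (q n) (K_map X m n ?a) =
      (\<Sum>S\<in>Pow {1..n}. (if card S \<le> m then r ^ (m - card S) else 0) * q n (slots n x S))"
    using K_map_diag(1)[OF x r, of m n] K_map_diag(2)[OF x r _ q_symmetric, of m n] dvd by blast+
  have Kn: "K_map X m n ?a \<in> points (elts (tensor n XW))"
    using K(1) by (simp add: W.points_stensor_iff)
  have a: "?a \<in> points (elts (stensor m XW))"
    using x r by (intro W.tpure_const_stensor) (simp add: elt_with_W)
  have "\<phi> m ?a = rho m * \<phi> n (K_map X m n ?a)"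
    using rep a mn unfolding represents_def bang_tests_def by simp
  then have "rho m * q m (diag m x r) = rho n * (rho m * pairing (tensor n XW) (q n) (K_map X m n ?a))"
    using test_diag_value[OF x r] q_val[OF Kn] by simp
  also have "\<dots> = (\<Sum>S\<in>Pow {1..n}. (if card S \<le> m then r ^ (m - card S) else 0) * (rho n * q n (slots n x S)))"
    unfolding K(2) sum_distrib_left by (intro sum.cong) auto
  also have "\<dots> = (\<Sum>k\<le>m. r ^ (m - k) * level_sum q n k x)"
    unfolding level_sum_def by (rule sum_Pow_by_card[where w = "\<lambda>k. r ^ (m - k)"])
  finally show ?thesis .
qed

text \<open>Only degrees divisible by all smaller ones are compared directly: for these the maps
  \<^term>\<open>N_map X k n\<close> involve no restriction \<^term>\<open>J_map X\<close>.\<close>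

lemma level_sum_eq:
  assumes x: "x \<in> points (elts X)" and k: "k \<le> m"
  shows "level_sum q m k x = level_sum q k k x"
proof -
  have step: "level_sum q l k x = level_sum q n k x"
    if "k \<le> l" "l \<le> n" "fact l dvd n" "n > 0" for l n
  proof (rule polynomial_coeffs_unique[OF _ that(1)])
    fix r :: real assume r: "0 \<le> r" "r \<le> 1"
    have "j dvd n \<and> n > 0" if "0 < j" "j \<le> l" for j
      using that \<open>fact l dvd n\<close> \<open>n > 0\<close> dvd_fact[of j l] dvd_trans by auto
    from level_sum_diag[OF x r \<open>l \<le> n\<close> this] diag_level_sum[OF x r]
    show "(\<Sum>k\<le>l. r ^ (l - k) * level_sum q l k x) = (\<Sum>k\<le>l. r ^ (l - k) * level_sum q n k x)"
      by simp
  qed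
  \<comment> \<open>Both \<open>m\<close> and \<open>k\<close> are compared with one common degree,
    a multiple of both factorials.\<close>
  define n :: nat where "n = fact m * fact k"
  have "m \<le> n" "k \<le> n"
  proof -
    have "fact m * 1 \<le> n" "1 * fact k \<le> n"
      unfolding n_def by (rule mult_le_mono; simp add: fact_ge_1)+
    then show "m \<le> n" "k \<le> n"
      using fact_ge_self[of m] fact_ge_self[of k] by linarith+
  qed
  then show ?thesis
    using step[of m n] step[of k n] k by (simp add: n_def)
qed

lemma level_sum_nonneg: "x \<in> points (elts X) \<Longrightarrow> 0 \<le> level_sum q n k x"
  unfolding level_sum_def
  by (intro sum_nonneg mult_nonneg_nonneg less_imp_le[OF rho_pos] W.test_bounds(1)[OF q_test] slots_in)

lemma level_sum_scale:
  assumes x: "x \<in> points (elts X)" and y: "y \<in> points (elts X)"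
    and y_eq: "\<And>\<eta>. \<eta> \<in> points (tests X) \<Longrightarrow> pairing X \<eta> y = t * pairing X \<eta> x"
  shows "level_sum q n k y = t ^ k * level_sum q n k x"
  unfolding level_sum_def sum_distrib_left
proof (rule sum.cong[OF refl])
  fix S assume "S \<in> {S \<in> Pow {1..n}. card S = k}"
  then show "rho n * q n (slots n y S) = t ^ k * (rho n * q n (slots n x S))"
    using test_slots_scale[OF q_test x y y_eq] by auto
qed

text \<open>At \<open>r = 1\<close> the value in degree \<open>n\<close> is a partial sum of a
  series of nonnegative terms that does not depend on \<open>n\<close>, so the supremum is the full
  sum.\<close>

lemma bang_sup_nabla:
  assumes x: "x \<in> points (elts X)"
  shows "bang_sup \<phi> (nabla X x) = (\<Sum>k. ennreal (level_sum q k k x))"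
proof -
  have "\<phi> n (nabla X x n) = (\<Sum>k\<le>n. level_sum q k k x)" for n
  proof -
    have "\<phi> n (nabla X x n) = (\<Sum>k\<le>n. level_sum q n k x)"
      unfolding nabla_def using test_diag_value[OF x, of 1 n] diag_level_sum[OF x, of 1 n] by simp
    also have "\<dots> = (\<Sum>k\<le>n. level_sum q k k x)"
      by (intro sum.cong level_sum_eq[OF x]) auto
    finally show ?thesis .
  qed
  then show ?thesis
    unfolding bang_sup_def using SUP_partial_sums[OF level_sum_nonneg[OF x]] by simp
qed

end

lemma bang_sup_le_1: "\<phi> \<in> points (bang_tests X) \<Longrightarrow> a \<in> points (bang_elts X) \<Longrightarrow> bang_sup \<phi> a \<le> 1"
  by (simp add: bang_tests_def)

lemma bang_sup_eqI:
  assumes \<phi>: "\<phi> \<in> points (bang_tests X)" and \<psi>: "\<psi> \<in> points (bang_tests X)"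
    and eq: "\<And>x. x \<in> points (elts X) \<Longrightarrow> bang_sup \<phi> (nabla X x) = bang_sup \<psi> (nabla X x)"
    and a: "a \<in> points (bang_elts X)"
  shows "bang_sup \<phi> a = bang_sup \<psi> a"
proof -
  obtain p where p: "represents \<phi> p"
    using bang_test_rep[OF \<phi>] by blast
  obtain q where q: "represents \<psi> q"
    using bang_test_rep[OF \<psi>] by blast
  have level: "level_sum p k k x = level_sum q k k x" if x: "x \<in> points (elts X)" for k x
  proof -
    \<comment> \<open>Stated for an arbitrary represented test, to serve both \<open>\<phi>\<close>
      and \<open>\<psi>\<close>. The bound 1 at \<open>nabla X x\<close> confines the coefficients
      to \<open>[0, 1]\<close>; the bound at \<open>nabla X y\<close> makes the scaled series
      finite.\<close>
    have bounds: "0 \<le> level_sum u k k x \<and> level_sum u k k x \<le> 1" and sm: "summable (\<lambda>k. level_sum u k k x * t ^ k)"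
      and sup: "bang_sup \<tau> (nabla X y) = ennreal (\<Sum>k. level_sum u k k x * t ^ k)" "0 \<le> (\<Sum>k. level_sum u k k x * t ^ k)"
      if u: "represents \<tau> u" and y: "y \<in> points (elts X)" "\<And>\<eta>. \<eta> \<in> points (tests X) \<Longrightarrow> pairing X \<eta> y = t * pairing X \<eta> x" and t: "0 \<le> t"
      for \<tau> u k y t
    proof -
      note nn = level_sum_nonneg[OF u]
      have \<tau>: "\<tau> \<in> points (bang_tests X)"
        using u by (simp add: represents_def)
      have "ennreal (level_sum u k k x) \<le> (\<Sum>k. ennreal (level_sum u k k x))"
        using sum_le_suminf[OF summableI, of "{k}" "\<lambda>k. ennreal (level_sum u k k x)"] by simp
      also have "\<dots> \<le> 1"
        using bang_sup_nabla[OF u x] bang_sup_le_1[OF \<tau> nabla_in[OF x]] by simp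
      finally show "0 \<le> level_sum u k k x \<and> level_sum u k k x \<le> 1"
        using nn[OF x] by (simp add: ennreal_le_1)
      have "level_sum u k k y = level_sum u k k x * t ^ k" for k
        using level_sum_scale[OF u x y] by (simp add: mult.commute)
      then have sum_y: "bang_sup \<tau> (nabla X y) = (\<Sum>k. ennreal (level_sum u k k x * t ^ k))"
        using bang_sup_nabla[OF u y(1)] by simp
      then have "(\<Sum>k. ennreal (level_sum u k k x * t ^ k)) \<noteq> \<top>"
        using bang_sup_le_1[OF \<tau> nabla_in[OF y(1)]] by (auto simp: top_unique)
      then show sm: "summable (\<lambda>k. level_sum u k k x * t ^ k)"
        using nn[OF x] t by (intro summable_suminf_not_top) auto
      show "bang_sup \<tau> (nabla X y) = ennreal (\<Sum>k. level_sum u k k x * t ^ k)"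
        unfolding sum_y using nn[OF x] t sm by (intro suminf_ennreal2) auto
      show "0 \<le> (\<Sum>k. level_sum u k k x * t ^ k)"
        using nn[OF x] t sm by (intro suminf_nonneg) auto
    qed
    have "(\<lambda>k. level_sum p k k x) = (\<lambda>k. level_sum q k k x)"
    proof (rule power_series_unique)
      show "0 \<le> level_sum p k k x \<and> level_sum p k k x \<le> 1" for k
        by (rule bounds[OF p x, of 1]) auto
      show "0 \<le> level_sum q k k x \<and> level_sum q k k x \<le> 1" for k
        by (rule bounds[OF q x, of 1]) auto
      fix t :: real assume t: "0 < t" "t < 1"
      \<comment> \<open>The multiple of \<open>x\<close> by \<open>t\<close>, as a convex
        combination with a single term.\<close>
      obtain y where y: "y \<in> points (elts X)" "\<And>\<eta>. \<eta> \<in> points (tests X) \<Longrightarrow> pairing X \<eta> y = t * pairing X \<eta> x"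
        using convex_comb_ex[of "{0}" "\<lambda>_. t" "\<lambda>_. x"] t x by auto
      show "(\<Sum>k. level_sum p k k x * t ^ k) = (\<Sum>k. level_sum q k k x * t ^ k)"
        using eq[OF y(1)] sup[OF p y] sup[OF q y] t by simp
    qed
    then show ?thesis by (rule fun_cong)
  qed
  have "p n = q n" for n
  proof (rule W.symmetric_test_diagonal_eqI[OF q_symmetric[OF p] q_symmetric[OF q]])
    fix y assume "y \<in> points (elts XW)"
    then obtain x r where y: "y = (x, r)" and x: "x \<in> points (elts X)" and r: "0 \<le> r" "r \<le> 1"
      by (cases y) (auto simp: elt_with_W)
    have "rho n * p n (diag n x r) = rho n * q n (diag n x r)"
      unfolding diag_level_sum[OF p x r] diag_level_sum[OF q x r]
    proof (rule sum.cong[OF refl])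
      fix k assume "k \<in> {..n}"
      then have "level_sum p n k x = level_sum q n k x"
        using level_sum_eq[OF p x, of k n] level_sum_eq[OF q x, of k n] level[OF x, of k] by simp
      then show "r ^ (n - k) * level_sum p n k x = r ^ (n - k) * level_sum q n k x" by simp
    qed
    then show "p n (\<lambda>i\<in>{1..n}. y) = q n (\<lambda>i\<in>{1..n}. y)"
      using rho_pos[of n] by (simp add: y)
  qed
  moreover have "a n \<in> points (elts (tensor n XW))" for n
    using a by (auto simp: bang_elts_def PiE_iff W.points_stensor_iff)
  ultimately show ?thesis
    unfolding bang_sup_def using q_val[OF p] q_val[OF q] by simp
qed

end

section \<open>Unique linear extension of an analytic map\<close>

theorem theorem2:
  fixes X :: "('a, 'b) cqbs" and Y :: "('c, 'd) cqbs" and f :: "'a \<Rightarrow> 'c"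
  assumes "convex_qbs X" and "convex_qbs Y" and "analytic X Y f"
  shows "\<exists>!g. g \<in> linear_maps (bang X) Y \<and> (\<forall>x\<in>points (elts X). f x = g (nabla X x))"
proof -
  have "separated X"
    using assms(1) by (simp add: convex_qbs_def)
  then interpret separated_cqbs X
    using convex_qbs_tame[OF assms(1)] by (simp add: separated_cqbs_def separated_cqbs_axioms_def)
  have Y_sep: "separated Y"
    using assms(2) by (simp add: convex_qbs_def)
  have bang: "elts (bang X) = bang_elts X" "tests (bang X) = bang_tests X"
    "pairing (bang X) \<phi> a = enn2real (bang_sup \<phi> a)" for \<phi> a
    by (simp_all add: bang_def)
  \<comment> \<open>Existence is what \<open>analytic\<close> provides.\<close>
  obtain g where g: "g \<in> linear_maps (bang X) Y" "\<forall>x\<in>points (elts X). f x = g (nabla X x)"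
    using assms(3) by (auto simp: analytic_def)
  show ?thesis
  proof (rule ex1I[of _ g])
    fix g' assume g': "g' \<in> linear_maps (bang X) Y \<and> (\<forall>x\<in>points (elts X). f x = g' (nabla X x))"
    \<comment> \<open>The adjoints carry each test of Y to tests of \<open>!X\<close>, where the
      comparison takes place.\<close>
    obtain h where h: "h \<in> qbs_hom (tests Y) (bang_tests X)"
      "\<And>a \<eta>. a \<in> points (bang_elts X) \<Longrightarrow> \<eta> \<in> points (tests Y) \<Longrightarrow> pairing Y \<eta> (g a) = enn2real (bang_sup (h \<eta>) a)"
      using g(1) by (auto simp: linear_maps_def bang)
    obtain h' where h': "h' \<in> qbs_hom (tests Y) (bang_tests X)"
      "\<And>a \<eta>. a \<in> points (bang_elts X) \<Longrightarrow> \<eta> \<in> points (tests Y) \<Longrightarrow> pairing Y \<eta> (g' a) = enn2real (bang_sup (h' \<eta>) a)"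
      using g' by (auto simp: linear_maps_def bang)
    \<comment> \<open>Values of tests are finite, so equality after \<open>enn2real\<close> is
      equality of the suprema.\<close>
    have fin: "bang_sup \<phi> a < \<top>" if "\<phi> \<in> points (bang_tests X)" "a \<in> points (bang_elts X)" for \<phi> a
      using bang_sup_le_1[OF that] by (rule order_le_less_trans) simp
    show "g' = g"
    proof (rule extensionalityI)
      show "g' \<in> extensional (points (bang_elts X))" "g \<in> extensional (points (bang_elts X))"
        using g g' by (auto simp: linear_maps_def points_qbs_fun bang)
      fix a assume a: "a \<in> points (bang_elts X)"
      have "g' a \<in> points (elts Y)" "g a \<in> points (elts Y)"
        using g g' a by (auto simp: linear_maps_def points_qbs_fun bang dest: qbs_hom_points)
      moreover have "pairing Y \<eta> (g' a) = pairing Y \<eta> (g a)" if \<eta>: "\<eta> \<in> points (tests Y)" for \<eta>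
      proof -
        have t: "h \<eta> \<in> points (bang_tests X)" "h' \<eta> \<in> points (bang_tests X)"
          using qbs_hom_points[OF h(1) \<eta>] qbs_hom_points[OF h'(1) \<eta>] by auto
        have "bang_sup (h \<eta>) (nabla X x) = bang_sup (h' \<eta>) (nabla X x)" if x: "x \<in> points (elts X)" for x
        proof -
          have "enn2real (bang_sup (h \<eta>) (nabla X x)) = enn2real (bang_sup (h' \<eta>) (nabla X x))"
            using h(2)[OF nabla_in[OF x] \<eta>] h'(2)[OF nabla_in[OF x] \<eta>] g g' x by (metis)
          then show ?thesis
            using fin[OF t(1) nabla_in[OF x]] fin[OF t(2) nabla_in[OF x]] by (metis ennreal_enn2real)
        qed
        from bang_sup_eqI[OF t this a] show ?thesis
          using h(2)[OF a \<eta>] h'(2)[OF a \<eta>] by simp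
      qed
      ultimately show "g' a = g a"
        using Y_sep by (simp add: separated_def)
    qed
  qed (use g in blast)
qed

end
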